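(* Let $\varphi\in H^\infty+C$ with $\|\varphi\|_\infty\le1$, $\mathbb J\varphi=\bar\varphi$, and suppose $\varphi$ is not unimodular (i.e. $|\varphi|<1$ on a set of positive Lebesgue measure). Then $\|\mathbb H(\varphi)\|<1$.
   Context: $H^2$ ($H^2_-$): Hardy space of the upper (lower) half-plane, identified with boundary values on $\mathbb R$; $\mathbb P_-$ the orthogonal projection of $L^2(\mathbb R)$ onto $H^2_-$; $(\mathbb Jf)(x)=f(-x)$. For $\varphi\in L^\infty(\mathbb R)$, the Hankel operator is $\mathbb H(\varphi)f=\mathbb J\mathbb P_-(\varphi f)$, $f\in H^2$. $H^\infty$: bounded analytic functions in the upper half-plane (boundary values). $C$: continuous functions on $\mathbb R$ with finite limits at $\pm\infty$ that coincide. $H^\infty+C=\{h+g: h\in H^\infty,\ g\in C\}$. *)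

theory Defs
  imports "HOL-Analysis.Analysis"
begin

text \<open>Functions on the real line are complex-valued; L^p classes are taken modulo
  equality almost everywhere w.r.t. Lebesgue measure.\<close>

definition sq_int :: "(real \<Rightarrow> complex) \<Rightarrow> bool" where
  "sq_int f \<longleftrightarrow> f \<in> borel_measurable lborel \<and>
     integrable lborel (\<lambda>x. (cmod (f x))\<^sup>2)"

definition l2norm :: "(real \<Rightarrow> complex) \<Rightarrow> real" where
  "l2norm f = sqrt (\<integral>x. (cmod (f x))\<^sup>2 \<partial>lborel)"

definition l2inner :: "(real \<Rightarrow> complex) \<Rightarrow> (real \<Rightarrow> complex) \<Rightarrow> complex" where
  "l2inner f g = (\<integral>x. f x * cnj (g x) \<partial>lborel)"

text \<open>Hardy space H^2 of the upper half-plane (s = 1) resp. lower half-plane (s = -1),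
  identified with boundary values: f is in L^2(R) and is the L^2 limit of
  x \<mapsto> F(x + i s y) as y \<rightarrow> 0+, where F is holomorphic on the half-plane with
  sup_{y>0} \<integral> |F(x + i s y)|^2 dx < \<infinity>.\<close>

definition hardy2 :: "real \<Rightarrow> (real \<Rightarrow> complex) set" where
  "hardy2 s = {f. sq_int f \<and>
     (\<exists>F M. F holomorphic_on {z. s * Im z > 0} \<and>
        (\<forall>y>0. sq_int (\<lambda>x. F (Complex x (s * y))) \<and>
               l2norm (\<lambda>x. F (Complex x (s * y))) \<le> M) \<and>
        ((\<lambda>y. l2norm (\<lambda>x. F (Complex x (s * y)) - f x)) \<longlongrightarrow> 0) (at_right 0))}"

abbreviation H2 :: "(real \<Rightarrow> complex) set" where "H2 \<equiv> hardy2 1"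
abbreviation H2minus :: "(real \<Rightarrow> complex) set" where "H2minus \<equiv> hardy2 (-1)"

definition is_Pminus :: "(real \<Rightarrow> complex) \<Rightarrow> (real \<Rightarrow> complex) \<Rightarrow> bool" where
  "is_Pminus g h \<longleftrightarrow> h \<in> H2minus \<and> (\<forall>k\<in>H2minus. l2inner (\<lambda>x. g x - h x) k = 0)"

definition Pminus :: "(real \<Rightarrow> complex) \<Rightarrow> (real \<Rightarrow> complex)" where
  "Pminus g = (SOME h. is_Pminus g h)"

definition Jrefl :: "(real \<Rightarrow> complex) \<Rightarrow> (real \<Rightarrow> complex)" where
  "Jrefl f = (\<lambda>x. f (- x))"

definition hankel :: "(real \<Rightarrow> complex) \<Rightarrow> (real \<Rightarrow> complex) \<Rightarrow> (real \<Rightarrow> complex)" where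
  "hankel \<phi> f = Jrefl (Pminus (\<lambda>x. \<phi> x * f x))"

definition hankel_norm :: "(real \<Rightarrow> complex) \<Rightarrow> real" where
  "hankel_norm \<phi> = Sup {l2norm (hankel \<phi> f) | f. f \<in> H2 \<and> l2norm f \<le> 1}"

definition Linf :: "(real \<Rightarrow> complex) set" where
  "Linf = {f. f \<in> borel_measurable lborel \<and> (\<exists>M. AE x in lborel. cmod (f x) \<le> M)}"

definition Hinf :: "(real \<Rightarrow> complex) set" where
  "Hinf = {h. h \<in> Linf \<and>
     (\<exists>F M. F holomorphic_on {z. Im z > 0} \<and> (\<forall>z. Im z > 0 \<longrightarrow> cmod (F z) \<le> M) \<and>
        (AE x in lborel. ((\<lambda>y. F (Complex x y)) \<longlongrightarrow> h x) (at_right 0)))}"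

definition Cinf :: "(real \<Rightarrow> complex) set" where
  "Cinf = {g. continuous_on UNIV g \<and> (\<exists>L. (g \<longlongrightarrow> L) at_top \<and> (g \<longlongrightarrow> L) at_bot)}"

definition HinfC :: "(real \<Rightarrow> complex) set" where
  "HinfC = {\<phi>. \<phi> \<in> Linf \<and>
     (\<exists>h g. h \<in> Hinf \<and> g \<in> Cinf \<and> (AE x in lborel. \<phi> x = h x + g x))}"

end

theory Submission
  imports Defs "HOL-Complex_Analysis.Complex_Analysis"
begin

text \<open>Let \<open>P\<close> be the projection onto \<open>H2minus\<close> and suppose that \<open>f\<^sub>n\<close> in the unit ball of \<open>H2\<close> satisfy
  \<open>\<parallel>P (\<phi> f\<^sub>n)\<parallel> \<rightarrow> 1\<close>. Then \<open>\<phi> f\<^sub>n - P (\<phi> f\<^sub>n) \<rightarrow> 0\<close> and \<open>(1 - |\<phi>|\<^sup>2) f\<^sub>n \<rightarrow> 0\<close>, so differences of the \<open>f\<^sub>n\<close> are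
  controlled by differences of the \<open>P (\<phi> f\<^sub>n)\<close>. Modulo \<open>Hinf\<close>, \<open>\<phi>\<close> is uniformly within 1/4 of a symbol with
  a Hankel operator of finite rank, so along a subsequence the differences of the \<open>P (\<phi> f\<^sub>n)\<close> are at most
  a quarter of those of the \<open>f\<^sub>n\<close>, up to an error tending to 0. Hence the subsequence converges in norm to
  some \<open>f\<close> in \<open>H2\<close> of norm 1 with \<open>(1 - |\<phi>|\<^sup>2) f = 0\<close>. So \<open>f\<close> vanishes on a set of positive measure, and an
  element of \<open>H2\<close> with this property is 0.\<close>

section \<open>Square integrable functions\<close>

text \<open>\<open>hardy2\<close> only provides extensions that approach their boundary values in L2
  along horizontal lines. Closedness, orthogonality to \<open>H2minus\<close> and uniqueness must be
  won from that, and all rest on one fact: integrals of a holomorphic function over horizontal lines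
  vanish if the L1 norms on the lines are bounded (\<open>line_integral_zero\<close>). It yields the
  Poisson representation, hence control of the extension by its boundary values. The limits for
  \<phi> f_n come from Pythagoras: f_n has norm at most 1 while P (\<phi> f_n) has norm tending to
  1, so neither the part of \<phi> f_n outside \<open>H2minus\<close> nor the loss in passing from
  f_n to \<phi> f_n can survive. The constant 1/4 could be any number below 1: it only has to be
  absorbed on the left-hand side. Finite rank is not expressed by operators. On the circle a
  continuous symbol is close to p(z) / z^N, and each division by z costs one scalar, the value at
  \<open>\<i>\<close>. Errors are measured as distances to \<open>H2\<close>, which dominate the
  norm of the projection.\<close>

lemma sq_int_bound:
  assumes "sq_int f" "g \<in> borel_measurable lborel" "AE x in lborel. cmod (g x) \<le> C * cmod (f x)"
  shows "sq_int g"
  unfolding sq_int_def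
proof
  have "integrable lborel (\<lambda>x. C\<^sup>2 * (cmod (f x))\<^sup>2)" using assms(1) by (simp add: sq_int_def)
  then show "integrable lborel (\<lambda>x. (cmod (g x))\<^sup>2)"
  proof (rule Bochner_Integration.integrable_bound)
    show "AE x in lborel. norm ((cmod (g x))\<^sup>2) \<le> norm (C\<^sup>2 * (cmod (f x))\<^sup>2)"
      using assms(3)
    proof eventually_elim
      case (elim x)
      then have "(cmod (g x))\<^sup>2 \<le> (C * cmod (f x))\<^sup>2" by (simp add: power_mono)
      then show ?case by (simp add: power_mult_distrib)
    qed
  qed (use assms(2) in measurable)
qed (rule assms(2))

lemma sq_intD:
  assumes "sq_int f"
  shows "f \<in> borel_measurable lborel" "integrable lborel (\<lambda>x. (cmod (f x))\<^sup>2)"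
  using assms by (auto simp: sq_int_def)

lemma sq_int_zero: "sq_int (\<lambda>x. 0)"
  by (simp add: sq_int_def)

lemma norm_add_sq_le: "(cmod (a + b))\<^sup>2 \<le> 2 * (cmod a)\<^sup>2 + 2 * (cmod b)\<^sup>2"
proof -
  have "(cmod (a + b))\<^sup>2 \<le> (cmod a + cmod b)\<^sup>2" by (simp add: norm_triangle_ineq power_mono)
  also have "\<dots> \<le> 2 * (cmod a)\<^sup>2 + 2 * (cmod b)\<^sup>2"
    using sum_squares_bound[of "cmod a" "cmod b"] by (simp add: power2_sum)
  finally show ?thesis .
qed

lemma sq_int_add:
  assumes "sq_int f" "sq_int g"
  shows "sq_int (\<lambda>x. f x + g x)"
  unfolding sq_int_def
proof
  note [measurable] = sq_intD(1)[OF assms(1)] sq_intD(1)[OF assms(2)]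
  show "(\<lambda>x. f x + g x) \<in> borel_measurable lborel" by measurable
  have "integrable lborel (\<lambda>x. 2 * (cmod (f x))\<^sup>2 + 2 * (cmod (g x))\<^sup>2)"
    using assms by (simp add: sq_int_def)
  then show "integrable lborel (\<lambda>x. (cmod (f x + g x))\<^sup>2)"
  proof (rule Bochner_Integration.integrable_bound)
    show "AE x in lborel. norm ((cmod (f x + g x))\<^sup>2) \<le> norm (2 * (cmod (f x))\<^sup>2 + 2 * (cmod (g x))\<^sup>2)"
      using norm_add_sq_le by (intro AE_I2) simp
  qed measurable
qed

lemma sq_int_cmult:
  assumes "sq_int f"
  shows "sq_int (\<lambda>x. c * f x)"
proof (rule sq_int_bound[OF assms])
  note [measurable] = sq_intD(1)[OF assms]
  show "(\<lambda>x. c * f x) \<in> borel_measurable lborel" by measurable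
  show "AE x in lborel. cmod (c * f x) \<le> cmod c * cmod (f x)" by (simp add: norm_mult)
qed

lemma sq_int_diff: "sq_int f \<Longrightarrow> sq_int g \<Longrightarrow> sq_int (\<lambda>x. f x - g x)"
  using sq_int_add[of f "\<lambda>x. -1 * g x"] sq_int_cmult[of g "-1"] by simp

lemma borel_measurable_cnj:
  assumes [measurable]: "f \<in> borel_measurable M"
  shows "(\<lambda>x. cnj (f x)) \<in> borel_measurable M"
  by (rule borel_measurable_continuous_on[OF _ assms]) (intro continuous_intros)

lemma sq_int_cnj: "sq_int f \<Longrightarrow> sq_int (\<lambda>x. cnj (f x))"
  using borel_measurable_cnj[of f lborel] by (simp add: sq_int_def)

lemma l2norm_nonneg [simp]: "l2norm f \<ge> 0"
  by (simp add: l2norm_def)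

lemma l2norm_sq: "(l2norm f)\<^sup>2 = (LBINT x. (cmod (f x))\<^sup>2)"
  by (simp add: l2norm_def)

lemma l2norm_cnj [simp]: "l2norm (\<lambda>x. cnj (f x)) = l2norm f"
  by (simp add: l2norm_def)

lemma l2norm_zero [simp]: "l2norm (\<lambda>x. 0) = 0"
  by (simp add: l2norm_def)

lemma l2norm_minus_commute: "l2norm (\<lambda>x. f x - g x) = l2norm (\<lambda>x. g x - f x)"
  by (simp add: l2norm_def norm_minus_commute)

lemma l2norm_mono_AE:
  assumes "sq_int f" "sq_int g" "AE x in lborel. cmod (g x) \<le> cmod (f x)"
  shows "l2norm g \<le> l2norm f"
  unfolding l2norm_def
  by (intro real_sqrt_le_mono integral_mono_AE) (use assms in \<open>auto simp: sq_int_def power_mono\<close>)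

lemma l2norm_cmult: "l2norm (\<lambda>x. c * f x) = cmod c * l2norm f"
  by (simp add: l2norm_def norm_mult power_mult_distrib real_sqrt_mult)

lemma l2norm_bound_AE:
  assumes "sq_int f" "g \<in> borel_measurable lborel" "AE x in lborel. cmod (g x) \<le> C * cmod (f x)" "C \<ge> 0"
  shows "l2norm g \<le> C * l2norm f"
proof -
  have "l2norm g \<le> l2norm (\<lambda>x. of_real C * f x)"
    by (rule l2norm_mono_AE[OF sq_int_cmult[OF assms(1)] sq_int_bound[OF assms(1-3)]])
      (use assms(3,4) in \<open>simp add: norm_mult\<close>)
  then show ?thesis using assms(4) by (simp add: l2norm_cmult)
qed

lemma l2_contractive_mult:
  assumes w: "sq_int w" and [measurable]: "a \<in> borel_measurable lborel" and le: "AE x in lborel. cmod (a x) \<le> 1"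
  shows "sq_int (\<lambda>x. a x * w x)" "l2norm (\<lambda>x. a x * w x) \<le> l2norm w"
proof -
  note [measurable] = sq_intD(1)[OF w]
  have m: "(\<lambda>x. a x * w x) \<in> borel_measurable lborel" by measurable
  have b: "AE x in lborel. cmod (a x * w x) \<le> 1 * cmod (w x)"
    using le by eventually_elim (simp add: norm_mult mult_left_le_one_le)
  show "sq_int (\<lambda>x. a x * w x)" by (rule sq_int_bound[OF w m b])
  show "l2norm (\<lambda>x. a x * w x) \<le> l2norm w" using l2norm_bound_AE[OF w m b] by simp
qed

lemma l2norm_cong_AE:
  assumes "f \<in> borel_measurable lborel" "g \<in> borel_measurable lborel" "AE x in lborel. f x = g x"
  shows "l2norm f = l2norm g"
  unfolding l2norm_def
  by (intro arg_cong[where f=sqrt] integral_cong_AE) (use assms in auto)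

lemma l2norm_eq_0:
  assumes "sq_int f" "l2norm f = 0"
  shows "AE x in lborel. f x = 0"
  using assms integral_nonneg_eq_0_iff_AE[of lborel "\<lambda>x. (cmod (f x))\<^sup>2"]
  by (auto simp: l2norm_def sq_int_def)

lemma integrable_norm_mult:
  assumes "sq_int f" "sq_int g"
  shows "integrable lborel (\<lambda>x. cmod (f x) * cmod (g x))"
proof (rule Bochner_Integration.integrable_bound)
  note [measurable] = sq_intD(1)[OF assms(1)] sq_intD(1)[OF assms(2)]
  show "integrable lborel (\<lambda>x. (cmod (f x))\<^sup>2 + (cmod (g x))\<^sup>2)"
    using assms by (simp add: sq_int_def)
  show "(\<lambda>x. cmod (f x) * cmod (g x)) \<in> borel_measurable lborel" by measurable
  have "cmod (f x) * cmod (g x) \<le> (cmod (f x))\<^sup>2 + (cmod (g x))\<^sup>2" for x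
  proof -
    have "2 * (cmod (f x) * cmod (g x)) \<le> (cmod (f x))\<^sup>2 + (cmod (g x))\<^sup>2"
      using sum_squares_bound[of "cmod (f x)" "cmod (g x)"] by (simp add: mult.assoc)
    moreover have "0 \<le> cmod (f x) * cmod (g x)" by simp
    ultimately show ?thesis by linarith
  qed
  then show "AE x in lborel. norm (cmod (f x) * cmod (g x)) \<le> norm ((cmod (f x))\<^sup>2 + (cmod (g x))\<^sup>2)"
    by (simp)
qed

lemma integrable_mult:
  assumes "sq_int f" "sq_int g"
  shows "integrable lborel (\<lambda>x. f x * g x)"
  using integrable_norm_mult[OF assms] sq_intD(1)[OF assms(1)] sq_intD(1)[OF assms(2)]
  by (subst integrable_norm_iff[symmetric]) (auto simp: norm_mult)

lemma cauchy_schwarz_norm: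
  assumes "sq_int f" "sq_int g"
  shows "(LBINT x. cmod (f x) * cmod (g x)) \<le> l2norm f * l2norm g"
proof -
  let ?I = "LBINT x. cmod (f x) * cmod (g x)"
  note i = integrable_norm_mult[OF assms] sq_intD(2)[OF assms(1)] sq_intD(2)[OF assms(2)]
  \<comment> \<open>The square of s|f| - t|g| is integrated with free parameters; taking s and t to
    be the norms of g and f makes the product of the norms a factor, which can be cancelled when it
    is not 0.\<close>
  have *: "0 \<le> (l2norm f)\<^sup>2 * s\<^sup>2 - 2 * s * t * ?I + (l2norm g)\<^sup>2 * t\<^sup>2" for s t
  proof -
    have "0 \<le> (LBINT x. (s * cmod (f x) - t * cmod (g x))\<^sup>2)"
      by (rule Bochner_Integration.integral_nonneg) simp
    also have "\<dots> = (LBINT x. s\<^sup>2 * (cmod (f x))\<^sup>2 - 2 * s * t * (cmod (f x) * cmod (g x)) + t\<^sup>2 * (cmod (g x))\<^sup>2)"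
      by (intro Bochner_Integration.integral_cong) (auto simp: power2_diff power_mult_distrib algebra_simps)
    also have "\<dots> = s\<^sup>2 * (l2norm f)\<^sup>2 - 2 * s * t * ?I + t\<^sup>2 * (l2norm g)\<^sup>2"
      using i by (simp add: l2norm_sq)
    finally show ?thesis by (simp add: algebra_simps)
  qed
  show ?thesis
  proof (cases "l2norm g = 0 \<or> l2norm f = 0")
    case True
    then have "AE x in lborel. cmod (f x) * cmod (g x) = 0"
      using l2norm_eq_0[OF assms(1)] l2norm_eq_0[OF assms(2)] by (auto elim: eventually_mono)
    then have "?I = 0" by (simp add: integral_eq_zero_AE)
    then show ?thesis by simp
  next
    case False
    then have p: "l2norm f > 0" "l2norm g > 0" using l2norm_nonneg[of f] l2norm_nonneg[of g] by linarith+
    have "0 \<le> 2 * (l2norm f * l2norm g) * (l2norm f * l2norm g - ?I)"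
      using *[of "l2norm g" "l2norm f"] by (simp add: algebra_simps power2_eq_square)
    moreover have "0 < 2 * (l2norm f * l2norm g)" using p by simp
    ultimately have "0 \<le> l2norm f * l2norm g - ?I" by (metis zero_le_mult_iff not_less)
    then show ?thesis by simp
  qed
qed

lemma cauchy_schwarz:
  assumes "sq_int f" "sq_int g"
  shows "cmod (LBINT x. f x * g x) \<le> l2norm f * l2norm g"
proof -
  have "cmod (LBINT x. f x * g x) \<le> (LBINT x. cmod (f x * g x))"
    by (rule integral_norm_bound)
  also have "\<dots> \<le> l2norm f * l2norm g" using cauchy_schwarz_norm[OF assms] by (simp add: norm_mult)
  finally show ?thesis .
qed

lemma l2norm_triangle:
  assumes "sq_int f" "sq_int g"
  shows "l2norm (\<lambda>x. f x + g x) \<le> l2norm f + l2norm g"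
proof (rule power2_le_imp_le)
  note i = integrable_norm_mult[OF assms] sq_intD(2)[OF assms(1)] sq_intD(2)[OF assms(2)]
  have "(l2norm (\<lambda>x. f x + g x))\<^sup>2 \<le> (LBINT x. (cmod (f x))\<^sup>2 + 2 * (cmod (f x) * cmod (g x)) + (cmod (g x))\<^sup>2)"
    unfolding l2norm_sq
  proof (rule integral_mono)
    show "integrable lborel (\<lambda>x. (cmod (f x + g x))\<^sup>2)" using sq_int_add[OF assms] by (simp add: sq_int_def)
    fix x
    have "(cmod (f x + g x))\<^sup>2 \<le> (cmod (f x) + cmod (g x))\<^sup>2" by (simp add: norm_triangle_ineq power_mono)
    then show "(cmod (f x + g x))\<^sup>2 \<le> (cmod (f x))\<^sup>2 + 2 * (cmod (f x) * cmod (g x)) + (cmod (g x))\<^sup>2"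
      by (simp add: power2_sum algebra_simps)
  qed (use i in simp)
  also have "\<dots> = (l2norm f)\<^sup>2 + 2 * (LBINT x. cmod (f x) * cmod (g x)) + (l2norm g)\<^sup>2"
    using i by (simp add: l2norm_sq)
  also have "\<dots> \<le> (l2norm f + l2norm g)\<^sup>2"
    using cauchy_schwarz_norm[OF assms] by (simp add: power2_sum algebra_simps)
  finally show "(l2norm (\<lambda>x. f x + g x))\<^sup>2 \<le> (l2norm f + l2norm g)\<^sup>2" .
qed simp

lemma l2norm_triangle_diff:
  assumes "sq_int f" "sq_int g" "sq_int h"
  shows "l2norm (\<lambda>x. f x - h x) \<le> l2norm (\<lambda>x. f x - g x) + l2norm (\<lambda>x. g x - h x)"
  using l2norm_triangle[OF sq_int_diff[OF assms(1,2)] sq_int_diff[OF assms(2,3)]] by simp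

lemma l2norm_triangle_le:
  assumes "sq_int f" "sq_int g"
  shows "l2norm f \<le> l2norm g + l2norm (\<lambda>x. f x - g x)"
  using l2norm_triangle[OF assms(2) sq_int_diff[OF assms]] by simp

lemma l2norm_triangle_minus:
  assumes "sq_int f" "sq_int g"
  shows "l2norm (\<lambda>x. f x - g x) \<le> l2norm f + l2norm g"
  using l2norm_triangle_diff[OF assms(1) sq_int_zero assms(2)] l2norm_minus_commute[of "\<lambda>x. 0" g] by simp

lemma parallelogram:
  assumes "sq_int f" "sq_int g"
  shows "(l2norm (\<lambda>x. f x + g x))\<^sup>2 + (l2norm (\<lambda>x. f x - g x))\<^sup>2 = 2 * (l2norm f)\<^sup>2 + 2 * (l2norm g)\<^sup>2"
proof -
  have p: "(cmod (a + b))\<^sup>2 + (cmod (a - b))\<^sup>2 = 2 * (cmod a)\<^sup>2 + 2 * (cmod b)\<^sup>2" for a b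
    unfolding cmod_power2 by (simp add: power2_eq_square algebra_simps)
  note i = sq_intD(2)[OF sq_int_add[OF assms]] sq_intD(2)[OF sq_int_diff[OF assms]]
    sq_intD(2)[OF assms(1)] sq_intD(2)[OF assms(2)]
  have "(l2norm (\<lambda>x. f x + g x))\<^sup>2 + (l2norm (\<lambda>x. f x - g x))\<^sup>2 =
     (LBINT x. (cmod (f x + g x))\<^sup>2 + (cmod (f x - g x))\<^sup>2)"
    using i by (simp add: l2norm_sq)
  also have "\<dots> = (LBINT x. 2 * (cmod (f x))\<^sup>2 + 2 * (cmod (g x))\<^sup>2)" by (simp only: p)
  also have "\<dots> = 2 * (l2norm f)\<^sup>2 + 2 * (l2norm g)\<^sup>2" using i by (simp add: l2norm_sq)
  finally show ?thesis .
qed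

lemma l2inner_self: "l2inner f f = of_real ((l2norm f)\<^sup>2)"
  unfolding l2inner_def l2norm_sq complex_norm_square[symmetric] by (rule integral_complex_of_real)

lemma l2norm_add_sq:
  assumes "sq_int f" "sq_int g"
  shows "(l2norm (\<lambda>x. f x + g x))\<^sup>2 = (l2norm f)\<^sup>2 + (l2norm g)\<^sup>2 + 2 * Re (l2inner f g)"
proof -
  have p: "(cmod (a + b))\<^sup>2 = (cmod a)\<^sup>2 + (cmod b)\<^sup>2 + 2 * Re (a * cnj b)" for a b
    unfolding cmod_power2 by (simp add: power2_eq_square algebra_simps)
  note i = sq_intD(2)[OF assms(1)] sq_intD(2)[OF assms(2)] integrable_mult[OF assms(1) sq_int_cnj[OF assms(2)]]
  have "(l2norm (\<lambda>x. f x + g x))\<^sup>2 = (LBINT x. (cmod (f x))\<^sup>2 + (cmod (g x))\<^sup>2 + 2 * Re (f x * cnj (g x)))"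
    unfolding l2norm_sq p ..
  also have "\<dots> = (l2norm f)\<^sup>2 + (l2norm g)\<^sup>2 + 2 * (LBINT x. Re (f x * cnj (g x)))"
    using i(1,2) integrable_Re[OF i(3)] unfolding l2norm_sq
    by (subst Bochner_Integration.integral_add Bochner_Integration.integral_mult_right_zero; simp only: Bochner_Integration.integrable_add Bochner_Integration.integral_add integrable_mult_right Bochner_Integration.integral_mult_right_zero simp_thms)+
  also have "(LBINT x. Re (f x * cnj (g x))) = Re (l2inner f g)"
    unfolding l2inner_def by (rule integral_Re[OF i(3)])
  finally show ?thesis .
qed

section \<open>Completeness of L2 and orthogonal projection\<close>

text \<open>The squared increments stay summable after weighting by 2^k, since 2^k * 4^(-k) is
  summable. So for almost every x the weighted squares tend to 0, the increments are eventually
  below 2^(-k/2), and the telescoping series converges.\<close>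

lemma l2_AE_Cauchy:
  assumes f: "\<And>n. sq_int (f n)"
    and d: "\<And>k. l2norm (\<lambda>x. f (Suc k) x - f k x) \<le> (1/2) ^ k"
  shows "AE x in lborel. convergent (\<lambda>k. f k x)"
proof -
  let ?D = "\<lambda>k x. f (Suc k) x - f k x"
  have sq: "sq_int (?D k)" for k by (intro sq_int_diff f)
  have [measurable]: "?D k \<in> borel_measurable lborel" for k using sq_intD(1)[OF sq] .
  have "(\<integral>\<^sup>+x. (\<Sum>k. ennreal (2 ^ k * (cmod (?D k x))\<^sup>2)) \<partial>lborel) =
     (\<Sum>k. \<integral>\<^sup>+x. ennreal (2 ^ k * (cmod (?D k x))\<^sup>2) \<partial>lborel)"
    by (rule nn_integral_suminf) measurable
  also have "\<dots> \<le> (\<Sum>k. ennreal ((1/2) ^ k))"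
  proof (intro suminf_le summableI)
    fix k
    have "(\<integral>\<^sup>+x. ennreal (2 ^ k * (cmod (?D k x))\<^sup>2) \<partial>lborel) = ennreal (LBINT x. 2 ^ k * (cmod (?D k x))\<^sup>2)"
      by (rule nn_integral_eq_integral) (use sq_intD(2)[OF sq] in simp_all)
    also have "(LBINT x. 2 ^ k * (cmod (?D k x))\<^sup>2) = 2 ^ k * (l2norm (?D k))\<^sup>2"
      by (simp add: l2norm_sq)
    also have "\<dots> \<le> 2 ^ k * ((1/2) ^ k)\<^sup>2"
      by (intro mult_left_mono power_mono d) auto
    also have "\<dots> = (1/2) ^ k" by (simp add: power2_eq_square power_divide)
    finally show "(\<integral>\<^sup>+x. ennreal (2 ^ k * (cmod (?D k x))\<^sup>2) \<partial>lborel) \<le> ennreal ((1/2) ^ k)"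
      by (simp add: ennreal_leI)
  qed
  also have "\<dots> = ennreal (\<Sum>k. (1/2) ^ k)" by (rule suminf_ennreal2) auto
  also have "\<dots> < \<infinity>" by simp
  finally have "AE x in lborel. (\<Sum>k. ennreal (2 ^ k * (cmod (?D k x))\<^sup>2)) \<noteq> \<infinity>"
    by (intro nn_integral_PInf_AE) (auto intro!: borel_measurable_suminf)
  then show ?thesis
  proof eventually_elim
    case (elim x)
    then have "summable (\<lambda>k. 2 ^ k * (cmod (?D k x))\<^sup>2)"
      by (intro summable_suminf_not_top) auto
    then have "eventually (\<lambda>k. 2 ^ k * (cmod (?D k x))\<^sup>2 < 1) sequentially"
      using summable_LIMSEQ_zero order_tendstoD(2) zero_less_one by blast
    then have "eventually (\<lambda>k. norm (?D k x) \<le> (sqrt (1/2)) ^ k) sequentially"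
    proof eventually_elim
      case (elim k)
      then have "(cmod (?D k x))\<^sup>2 \<le> (1/2) ^ k" by (simp add: field_simps power_divide)
      also have "\<dots> = ((sqrt (1/2)) ^ k)\<^sup>2"
        by (metis power_mult mult.commute real_sqrt_pow2 zero_le_divide_1_iff zero_le_numeral)
      finally show ?case by (rule power2_le_imp_le) simp
    qed
    moreover have "summable (\<lambda>k. (sqrt (1/2)) ^ k)" by (rule summable_geometric) (simp add: real_sqrt_divide)
    ultimately have "summable (\<lambda>k. ?D k x)" by (rule summable_comparison_test_ev)
    then have "convergent (\<lambda>n. \<Sum>k<n. ?D k x)" by (simp add: summable_iff_convergent)
    then have "convergent (\<lambda>n. f n x - f 0 x)" using sum_lessThan_telescope[of "\<lambda>k. f k x"] by simp
    then show ?case by (simp add: convergent_diff_const_right_iff)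
  qed
qed

text \<open>Fatou's lemma for the squared moduli: the bound passes to the almost everywhere limit,
  whose square integrability is part of the conclusion.\<close>

lemma l2_Fatou:
  assumes f: "\<And>n. sq_int (f n)" and [measurable]: "g \<in> borel_measurable lborel"
    and lim: "AE x in lborel. (\<lambda>k. f k x) \<longlonglongrightarrow> g x"
    and le: "\<And>n. l2norm (f n) \<le> C"
  shows "sq_int g" "l2norm g \<le> C"
proof -
  have [measurable]: "f n \<in> borel_measurable lborel" for n using sq_intD(1)[OF f] .
  have C0: "C \<ge> 0" by (rule order_trans[OF l2norm_nonneg le[of 0]])
  have "(\<integral>\<^sup>+x. ennreal ((cmod (g x))\<^sup>2) \<partial>lborel) = (\<integral>\<^sup>+x. liminf (\<lambda>n. ennreal ((cmod (f n x))\<^sup>2)) \<partial>lborel)"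
  proof (intro nn_integral_cong_AE)
    show "AE x in lborel. ennreal ((cmod (g x))\<^sup>2) = liminf (\<lambda>n. ennreal ((cmod (f n x))\<^sup>2))"
      using lim
    proof eventually_elim
      case (elim x)
      then have "(\<lambda>n. ennreal ((cmod (f n x))\<^sup>2)) \<longlonglongrightarrow> ennreal ((cmod (g x))\<^sup>2)"
        by (intro tendsto_ennrealI tendsto_intros)
      from lim_imp_Liminf[OF _ this] show ?case by simp
    qed
  qed
  also have "\<dots> \<le> liminf (\<lambda>n. \<integral>\<^sup>+x. ennreal ((cmod (f n x))\<^sup>2) \<partial>lborel)"
    by (rule nn_integral_liminf) measurable
  also have "\<dots> \<le> ennreal (C\<^sup>2)"
  proof (intro Liminf_le always_eventually allI)
    fix n
    have "(\<integral>\<^sup>+x. ennreal ((cmod (f n x))\<^sup>2) \<partial>lborel) = ennreal ((l2norm (f n))\<^sup>2)"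
      unfolding l2norm_sq by (rule nn_integral_eq_integral) (use sq_intD(2)[OF f] in simp_all)
    also have "\<dots> \<le> ennreal (C\<^sup>2)" using le[of n] by (intro ennreal_leI power_mono) auto
    finally show "(\<integral>\<^sup>+x. ennreal ((cmod (f n x))\<^sup>2) \<partial>lborel) \<le> ennreal (C\<^sup>2)" .
  qed simp
  finally have le: "(\<integral>\<^sup>+x. ennreal ((cmod (g x))\<^sup>2) \<partial>lborel) \<le> ennreal (C\<^sup>2)" .
  have i: "integrable lborel (\<lambda>x. (cmod (g x))\<^sup>2)"
  proof (rule integrableI_bounded)
    show "(\<integral>\<^sup>+x. ennreal (norm ((cmod (g x))\<^sup>2)) \<partial>lborel) < \<infinity>"
      using le_less_trans[OF le ennreal_less_top] by simp
  qed measurable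
  then show "sq_int g" by (simp add: sq_int_def)
  have "ennreal ((l2norm g)\<^sup>2) \<le> ennreal (C\<^sup>2)"
    using le nn_integral_eq_integral[OF i] by (simp add: l2norm_sq)
  then have "(l2norm g)\<^sup>2 \<le> C\<^sup>2" by (simp add: ennreal_le_iff)
  then show "l2norm g \<le> C" using C0 by (rule power2_le_imp_le)
qed

lemma l2_complete:
  assumes f: "\<And>n. sq_int (f n)"
    and cauchy: "\<And>e. e > 0 \<Longrightarrow> \<exists>N. \<forall>m\<ge>N. \<forall>n\<ge>N. l2norm (\<lambda>x. f m x - f n x) < e"
  obtains g where "sq_int g" "(\<lambda>n. l2norm (\<lambda>x. f n x - g x)) \<longlonglongrightarrow> 0"
proof -
  have "\<exists>N. \<forall>k. \<forall>m\<ge>N k. \<forall>n\<ge>N k. l2norm (\<lambda>x. f m x - f n x) < (1/2) ^ k"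
    using cauchy by (intro choice) simp
  then obtain N where N: "\<And>k m n. m \<ge> N k \<Longrightarrow> n \<ge> N k \<Longrightarrow> l2norm (\<lambda>x. f m x - f n x) < (1/2) ^ k" by blast
  \<comment> \<open>Summing all \<open>N j\<close> up to k makes \<open>r k\<close> and
    \<open>r (Suc k)\<close> both at least \<open>N k\<close> without any monotonicity of
    \<open>N\<close>.\<close>
  define r where "r k = k + (\<Sum>j\<le>k. N j)" for k
  have rN: "r k \<ge> N k" for k unfolding r_def using member_le_sum[of k "{..k}" N] by simp
  have rS: "r (Suc k) \<ge> N k" for k unfolding r_def using member_le_sum[of k "{..Suc k}" N] by simp
  have rk: "r k \<ge> k" for k by (simp add: r_def)
  have d: "l2norm (\<lambda>x. f (r (Suc k)) x - f (r k) x) \<le> (1/2) ^ k" for k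
    using N[OF rS rN] by (simp add: less_imp_le)
  have conv: "AE x in lborel. convergent (\<lambda>k. f (r k) x)"
    by (rule l2_AE_Cauchy[of "\<lambda>k. f (r k)"]) (use f d in auto)
  define g where "g x = lim (\<lambda>k. f (r k) x)" for x
  have fm [measurable]: "f n \<in> borel_measurable lborel" for n using sq_intD(1)[OF f] .
  have [measurable]: "g \<in> borel_measurable lborel" unfolding g_def by (rule borel_measurable_lim_metric) simp
  have lim: "AE x in lborel. (\<lambda>k. f (r k) x) \<longlonglongrightarrow> g x"
    using conv by eventually_elim (simp add: g_def convergent_LIMSEQ_iff)
  \<comment> \<open>Fatou is applied to differences with one index fixed and the other running along
    the subsequence. This gives membership of \<open>g\<close> in L2 and convergence of the full
    sequence at once.\<close>
  have key: "\<exists>M. \<forall>n\<ge>M. sq_int (\<lambda>x. g x - f n x) \<and> l2norm (\<lambda>x. g x - f n x) \<le> e" if "e > 0" for e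
  proof -
    obtain M where M: "\<And>m n. m \<ge> M \<Longrightarrow> n \<ge> M \<Longrightarrow> l2norm (\<lambda>x. f m x - f n x) < e" using cauchy[OF \<open>e > 0\<close>] by blast
    have "sq_int (\<lambda>x. g x - f n x) \<and> l2norm (\<lambda>x. g x - f n x) \<le> e" if n: "n \<ge> M" for n
    proof -
      let ?h = "\<lambda>k x. f (r (k + M)) x - f n x"
      have "sq_int (?h k)" for k by (intro sq_int_diff f)
      moreover have "AE x in lborel. (\<lambda>k. ?h k x) \<longlonglongrightarrow> g x - f n x"
        using lim by eventually_elim (intro tendsto_intros LIMSEQ_ignore_initial_segment)
      moreover have "l2norm (?h k) \<le> e" for k
        using M[of "r (k + M)" n] rk[of "k + M"] n by simp
      ultimately show ?thesis
        using l2_Fatou[of ?h "\<lambda>x. g x - f n x" e] by simp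
    qed
    then show ?thesis by blast
  qed
  obtain M where M: "sq_int (\<lambda>x. g x - f M x)" using key[of 1] by auto
  have sg: "sq_int g" using sq_int_add[OF M f[of M]] by simp
  moreover have "(\<lambda>n. l2norm (\<lambda>x. f n x - g x)) \<longlonglongrightarrow> 0"
  proof (rule LIMSEQ_I)
    fix e :: real assume "e > 0"
    then obtain M where M: "\<forall>n\<ge>M. l2norm (\<lambda>x. g x - f n x) \<le> e/2" using key[of "e/2"] by auto
    show "\<exists>no. \<forall>n\<ge>no. norm (l2norm (\<lambda>x. f n x - g x) - 0) < e"
    proof (intro exI[of _ M] allI impI)
      fix n assume "n \<ge> M"
      then have "l2norm (\<lambda>x. f n x - g x) \<le> e/2" using M by (simp add: l2norm_minus_commute)
      then show "norm (l2norm (\<lambda>x. f n x - g x) - 0) < e" using \<open>e > 0\<close> by simp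
    qed
  qed
  ultimately show ?thesis by (rule that)
qed

text \<open>Hilbert's projection theorem for plain functions: a minimizing sequence is Cauchy by the
  parallelogram law, and minimality of its limit forces orthogonality.\<close>

lemma l2_projection:
  assumes V: "\<And>v. v \<in> V \<Longrightarrow> sq_int v" "(\<lambda>x. 0) \<in> V"
      "\<And>v w. v \<in> V \<Longrightarrow> w \<in> V \<Longrightarrow> (\<lambda>x. v x + w x) \<in> V"
      "\<And>c v. v \<in> V \<Longrightarrow> (\<lambda>x. c * v x) \<in> V"
    and closed: "\<And>vn v. (\<And>n. vn n \<in> V) \<Longrightarrow> sq_int v \<Longrightarrow> (\<lambda>n. l2norm (\<lambda>x. vn n x - v x)) \<longlonglongrightarrow> 0 \<Longrightarrow> v \<in> V"
    and g: "sq_int g"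
  obtains h where "h \<in> V" "\<And>k. k \<in> V \<Longrightarrow> l2inner (\<lambda>x. g x - h x) k = 0"
proof -
  define S where "S = (\<lambda>v. (l2norm (\<lambda>x. g x - v x))\<^sup>2) ` V"
  define d where "d = Inf S"
  have S: "S \<noteq> {}" "bdd_below S" using V(2) by (auto simp: S_def intro!: bdd_belowI[of _ 0])
  have dle: "d \<le> (l2norm (\<lambda>x. g x - v x))\<^sup>2" if "v \<in> V" for v
    unfolding d_def by (rule cInf_lower) (use that S in \<open>auto simp: S_def\<close>)
  have "\<exists>v\<in>V. (l2norm (\<lambda>x. g x - v x))\<^sup>2 < d + 1 / real (Suc n)" for n
    using cInf_lessD[OF S(1), of "d + 1 / real (Suc n)"] by (auto simp: S_def d_def)
  then obtain v where v: "\<And>n. v n \<in> V" "\<And>n. (l2norm (\<lambda>x. g x - v n x))\<^sup>2 < d + 1 / real (Suc n)"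
    by metis
  have vs: "sq_int (v n)" for n using V(1) v(1) by blast
  have gv: "sq_int (\<lambda>x. g x - v n x)" for n by (intro sq_int_diff g vs)
  have par: "(l2norm (\<lambda>x. v m x - v n x))\<^sup>2 \<le> 2 / real (Suc m) + 2 / real (Suc n)" for m n
  proof -
    \<comment> \<open>The midpoint cannot beat the infimum \<open>d\<close>; the parallelogram law
      turns this into smallness of the difference.\<close>
    have mid: "(\<lambda>x. (1/2) * (v m x + v n x)) \<in> V" by (intro V v)
    have "(l2norm (\<lambda>x. (g x - v m x) + (g x - v n x)))\<^sup>2 + (l2norm (\<lambda>x. (g x - v m x) - (g x - v n x)))\<^sup>2
       = 2 * (l2norm (\<lambda>x. g x - v m x))\<^sup>2 + 2 * (l2norm (\<lambda>x. g x - v n x))\<^sup>2"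
      by (rule parallelogram[OF gv gv])
    moreover have "(\<lambda>x. (g x - v m x) + (g x - v n x)) = (\<lambda>x. 2 * (g x - (1/2) * (v m x + v n x)))"
      by (auto simp: algebra_simps)
    then have "(l2norm (\<lambda>x. (g x - v m x) + (g x - v n x)))\<^sup>2 = 4 * (l2norm (\<lambda>x. g x - (1/2) * (v m x + v n x)))\<^sup>2"
      using l2norm_cmult[of 2 "\<lambda>x. g x - (1/2) * (v m x + v n x)"] by (simp add: power_mult_distrib)
    moreover have "(\<lambda>x. (g x - v m x) - (g x - v n x)) = (\<lambda>x. v n x - v m x)" by auto
    ultimately show ?thesis
      using dle[OF mid] v(2)[of m] v(2)[of n] l2norm_minus_commute[of "v m" "v n"] by simp
  qed
  have "\<exists>N. \<forall>m\<ge>N. \<forall>n\<ge>N. l2norm (\<lambda>x. v m x - v n x) < e" if e: "e > 0" for e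
  proof -
    obtain N where N: "4 / e\<^sup>2 < real N" using reals_Archimedean2 by blast
    moreover have "0 \<le> 4 / e\<^sup>2" by simp
    ultimately have "real N > 0" by linarith
    then have "N > 0" by simp
    with N e have N': "4 / real N < e\<^sup>2" by (simp add: field_simps)
    have "l2norm (\<lambda>x. v m x - v n x) < e" if "m \<ge> N" "n \<ge> N" for m n
    proof (rule power2_less_imp_less)
      have "2 / real (Suc m) \<le> 2 / real N" "2 / real (Suc n) \<le> 2 / real N"
        using that \<open>N > 0\<close> by (auto intro!: divide_left_mono)
      then show "(l2norm (\<lambda>x. v m x - v n x))\<^sup>2 < e\<^sup>2"
        using par[of m n] N' by linarith
    qed (use e in simp)
    then show ?thesis by blast
  qed
  then obtain h where h: "sq_int h" "(\<lambda>n. l2norm (\<lambda>x. v n x - h x)) \<longlonglongrightarrow> 0"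
    using l2_complete[of v] vs by blast
  have hV: "h \<in> V" using closed[OF v(1) h] .
  have gh: "sq_int (\<lambda>x. g x - h x)" by (intro sq_int_diff g h)
  have "l2norm (\<lambda>x. g x - h x) \<le> sqrt d"
  proof (rule LIMSEQ_le)
    show "(\<lambda>n. l2norm (\<lambda>x. g x - h x)) \<longlonglongrightarrow> l2norm (\<lambda>x. g x - h x)" by simp
    have "(\<lambda>n. d + 1 / real (Suc n)) \<longlonglongrightarrow> d + 0"
      by (intro tendsto_intros LIMSEQ_Suc lim_1_over_n)
    then have "(\<lambda>n. sqrt (d + 1 / real (Suc n)) + l2norm (\<lambda>x. v n x - h x)) \<longlonglongrightarrow> sqrt d + 0"
      using h(2) by (intro tendsto_add tendsto_real_sqrt) auto
    then show "(\<lambda>n. sqrt (d + 1 / real (Suc n)) + l2norm (\<lambda>x. v n x - h x)) \<longlonglongrightarrow> sqrt d" by simp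
    have "l2norm (\<lambda>x. g x - h x) \<le> sqrt (d + 1 / real (Suc n)) + l2norm (\<lambda>x. v n x - h x)" for n
    proof -
      have "l2norm (\<lambda>x. g x - v n x) \<le> sqrt (d + 1 / real (Suc n))"
        using v(2)[of n] by (intro real_le_rsqrt) simp
      then show ?thesis using l2norm_triangle_diff[OF g vs[of n] h(1)] by linarith
    qed
    then show "\<exists>N. \<forall>n\<ge>N. l2norm (\<lambda>x. g x - h x) \<le> sqrt (d + 1 / real (Suc n)) + l2norm (\<lambda>x. v n x - h x)"
      by blast
  qed
  moreover have "d \<ge> 0" unfolding d_def by (rule cInf_greatest) (use S in \<open>auto simp: S_def\<close>)
  ultimately have hd: "(l2norm (\<lambda>x. g x - h x))\<^sup>2 \<le> d"
    using power_mono[OF _ l2norm_nonneg, of "\<lambda>x. g x - h x" "sqrt d" 2] by simp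
  have "l2inner (\<lambda>x. g x - h x) k = 0" if k: "k \<in> V" for k
  proof (rule ccontr)
    define a where "a = l2inner (\<lambda>x. g x - h x) k"
    assume "l2inner (\<lambda>x. g x - h x) k \<noteq> 0"
    then have a: "(cmod a)\<^sup>2 > 0" by (simp add: a_def)
    \<comment> \<open>Replacing h by h + t a k gains 2 t |a|^2 in the squared distance and loses t^2
      |a|^2 times the squared norm of k. This \<open>t\<close> keeps the loss below the gain; the
      \<open>+ 1\<close> covers norm 0.\<close>
    define t where "t = 1 / ((l2norm k)\<^sup>2 + 1)"
    have t: "t > 0" unfolding t_def by (simp add: add_nonneg_pos)
    have "0 < 1 + (l2norm k)\<^sup>2" by (simp add: add_pos_nonneg)
    then have tk: "t * (l2norm k)\<^sup>2 < 1" unfolding t_def by (simp add: field_simps)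
    define c where "c = - (of_real t * a)"
    have ks: "sq_int k" using V(1) k by blast
    have "(\<lambda>x. h x + (- c) * k x) \<in> V" by (intro V hV k)
    from dle[OF this] have "d \<le> (l2norm (\<lambda>x. (g x - h x) + c * k x))\<^sup>2"
      by (simp add: algebra_simps)
    also have "\<dots> = (l2norm (\<lambda>x. g x - h x))\<^sup>2 + (l2norm (\<lambda>x. c * k x))\<^sup>2 + 2 * Re (l2inner (\<lambda>x. g x - h x) (\<lambda>x. c * k x))"
      by (rule l2norm_add_sq[OF gh sq_int_cmult[OF ks]])
    also have "l2inner (\<lambda>x. g x - h x) (\<lambda>x. c * k x) = cnj c * a"
      unfolding a_def l2inner_def by (simp flip: integral_mult_right_zero add: mult_ac)
    also have "Re (cnj c * a) = - t * (cmod a)\<^sup>2"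
      unfolding c_def cmod_power2 by (simp add: power2_eq_square algebra_simps)
    also have "(l2norm (\<lambda>x. c * k x))\<^sup>2 = t\<^sup>2 * (cmod a)\<^sup>2 * (l2norm k)\<^sup>2"
      unfolding l2norm_cmult using t by (simp add: c_def norm_mult power_mult_distrib)
    finally have "2 * (t * (cmod a)\<^sup>2) \<le> (t * (cmod a)\<^sup>2) * (t * (l2norm k)\<^sup>2)"
      using hd by (simp add: power2_eq_square algebra_simps)
    moreover have "(t * (cmod a)\<^sup>2) * (t * (l2norm k)\<^sup>2) < (t * (cmod a)\<^sup>2) * 2"
      using tk t a by (intro mult_strict_left_mono) auto
    ultimately show False by simp
  qed
  then show ?thesis using that hV by blast
qed

section \<open>Line integrals in a half-plane\<close>

lemma open_Im_gt: "open {z. Im z > c}" by (rule open_halfspace_Im_gt)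
lemma convex_Im_gt: "convex {z. Im z > c}" by (rule convex_halfspace_Im_gt)

lemma continuous_on_line:
  assumes "f holomorphic_on {z. Im z > c}" "y > c"
  shows "continuous_on S (\<lambda>x. f (Complex x y))"
proof (rule continuous_on_compose2[OF holomorphic_on_imp_continuous_on[OF assms(1)]])
  show "continuous_on S (\<lambda>x. Complex x y)" unfolding Complex_eq by (intro continuous_intros)
qed (use assms(2) in auto)

lemma borel_measurable_line:
  assumes "f holomorphic_on {z. Im z > c}" "y > c"
  shows "(\<lambda>x. f (Complex x y)) \<in> borel_measurable lborel"
  using borel_measurable_continuous_onI[OF continuous_on_line[OF assms]] by simp

lemma half_plane_primitive:
  assumes "f holomorphic_on {z. Im z > c}"
  obtains A where "\<And>z. Im z > c \<Longrightarrow> (A has_field_derivative f z) (at z)"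
proof -
  obtain A where "\<And>z. z \<in> {z. Im z > c} \<Longrightarrow> (A has_field_derivative f z) (at z within {z. Im z > c})"
    using holomorphic_convex_primitive'[OF convex_Im_gt open_Im_gt assms] by blast
  then show ?thesis using at_within_open[OF _ open_Im_gt] by (intro that[of A]) auto
qed

text \<open>The factor \<open>\<sigma>\<close> will be 1 or -1, so that one argument serves both
  ends of a line.\<close>

lemma has_vector_derivative_horizontal:
  assumes "(A has_field_derivative d) (at (Complex (\<sigma> * x) y))"
  shows "((\<lambda>x. A (Complex (\<sigma> * x) y)) has_vector_derivative of_real \<sigma> * d) (at x within S)"
proof -
  have "((\<lambda>x. Complex (\<sigma> * x) y) has_vector_derivative of_real \<sigma>) (at x within S)"
    unfolding Complex_eq by (auto intro!: derivative_eq_intros)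
  from field_vector_diff_chain_within[OF this has_field_derivative_at_within[OF assms]]
  show ?thesis by (simp add: o_def)
qed

lemma has_vector_derivative_vertical:
  assumes "(A has_field_derivative d) (at (Complex x y))"
  shows "((\<lambda>y. A (Complex x y)) has_vector_derivative \<i> * d) (at y within S)"
proof -
  have "((\<lambda>y. Complex x y) has_vector_derivative \<i>) (at y within S)"
    unfolding Complex_eq by (auto intro!: derivative_eq_intros)
  from field_vector_diff_chain_within[OF this has_field_derivative_at_within[OF assms]]
  show ?thesis by (simp add: o_def)
qed

lemma tendsto_integral_indicator:
  fixes f :: "real \<Rightarrow> complex" and A :: "real \<Rightarrow> real set"
  assumes f: "integrable lborel f" and m: "\<And>s. A s \<in> sets borel" "B \<in> sets borel"
    and ev: "\<And>x. eventually (\<lambda>s. x \<in> A s \<longleftrightarrow> x \<in> B) at_top"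
  shows "((\<lambda>s. LBINT x. indicator (A s) x *\<^sub>R f x) \<longlongrightarrow> (LBINT x. indicator B x *\<^sub>R f x)) at_top"
proof (rule integral_dominated_convergence_at_top[where w="\<lambda>x. norm (f x)"])
  note [measurable] = borel_measurable_integrable[OF f] m
  show "(\<lambda>x. indicat_real B x *\<^sub>R f x) \<in> borel_measurable lborel" by measurable
  show "(\<lambda>x. indicat_real (A s) x *\<^sub>R f x) \<in> borel_measurable lborel" for s by measurable
  show "AE x in lborel. ((\<lambda>s. indicat_real (A s) x *\<^sub>R f x) \<longlongrightarrow> indicat_real B x *\<^sub>R f x) at_top"
  proof (intro AE_I2 tendsto_eventually)
    show "eventually (\<lambda>s. indicat_real (A s) x *\<^sub>R f x = indicat_real B x *\<^sub>R f x) at_top" for x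
      using ev[of x] by eventually_elim (simp add: indicator_def)
  qed
  show "\<forall>\<^sub>F s in at_top. AE x in lborel. norm (indicat_real (A s) x *\<^sub>R f x) \<le> norm (f x)"
    by (auto split: split_indicator)
qed (rule integrable_norm[OF f])

text \<open>On one line the primitive converges because \<open>f\<close> is integrable there. The
  difficulty is that the limit must not depend on the height: \<open>f\<close> has no pointwise
  decay, so the vertical sides of Cauchy's rectangle cannot be estimated directly. Averages of the
  primitive over unit windows repair this, because their derivative is a difference of two values of
  \<open>A\<close> with the same limit.\<close>

lemma primitive_limit:
  fixes \<sigma> :: real
  assumes hol: "f holomorphic_on {z. Im z > c}"
    and A: "\<And>z. Im z > c \<Longrightarrow> (A has_field_derivative f z) (at z)"
    and int: "\<And>y. y > c \<Longrightarrow> integrable lborel (\<lambda>x. f (Complex x y))"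
    and M: "\<And>y. y > c \<Longrightarrow> (LBINT x. cmod (f (Complex x y))) \<le> M"
    and \<sigma>: "\<sigma> = 1 \<or> \<sigma> = -1"
  obtains p where "\<And>y. y > c \<Longrightarrow> ((\<lambda>s. A (Complex (\<sigma> * s) y)) \<longlongrightarrow> p) at_top"
proof -
  have \<sigma>': "\<bar>\<sigma>\<bar> = 1" "\<sigma> \<noteq> 0" using \<sigma> by auto
  have int\<sigma>: "integrable lborel (\<lambda>x. f (Complex (\<sigma> * x) y))" if "y > c" for y
    using lborel_integrable_real_affine[OF int[OF that] \<sigma>'(2), of 0] by simp
  have M\<sigma>: "(LBINT x. cmod (f (Complex (\<sigma> * x) y))) \<le> M" if "y > c" for y
    using lborel_integral_real_affine[OF \<sigma>'(2), of "\<lambda>x. cmod (f (Complex x y))" 0] M[OF that] \<sigma>' by simp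
  have cont: "continuous_on S (\<lambda>x. of_real \<sigma> * f (Complex (\<sigma> * x) y))" if "y > c" for y S
    by (intro continuous_intros continuous_on_compose2[OF continuous_on_line[OF hol that, of UNIV]]) auto
  have FTC: "has_bochner_integral lborel (\<lambda>x. indicator {s..t} x *\<^sub>R (of_real \<sigma> * f (Complex (\<sigma> * x) y)))
      (A (Complex (\<sigma> * t) y) - A (Complex (\<sigma> * s) y))" if "s \<le> t" "y > c" for s t y
    by (rule has_bochner_integral_FTC_Icc[OF that(1) has_vector_derivative_horizontal[OF A] cont]) (use that in auto)
  \<comment> \<open>Uniform in the height, so that it can dominate the vertical integrals further
    down.\<close>
  have osc: "cmod (A (Complex (\<sigma> * t) y) - A (Complex (\<sigma> * s) y)) \<le> M" if "s \<le> t" "y > c" for s t y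
  proof -
    have "cmod (A (Complex (\<sigma> * t) y) - A (Complex (\<sigma> * s) y)) \<le>
        (LBINT x. norm (indicator {s..t} x *\<^sub>R (of_real \<sigma> * f (Complex (\<sigma> * x) y))))"
      unfolding has_bochner_integral_integral_eq[OF FTC[OF that], symmetric] by (rule integral_norm_bound)
    also have "\<dots> \<le> (LBINT x. cmod (f (Complex (\<sigma> * x) y)))"
    proof (rule integral_mono)
      show "integrable lborel (\<lambda>x. norm (indicator {s..t} x *\<^sub>R (of_real \<sigma> * f (Complex (\<sigma> * x) y))))"
        using FTC[OF that] by (intro integrable_norm) (rule integrable.intros)
      show "integrable lborel (\<lambda>x. cmod (f (Complex (\<sigma> * x) y)))"
        using int\<sigma>[OF that(2)] by (rule integrable_norm)
    qed (auto simp: norm_mult \<sigma>' split: split_indicator)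
    finally show ?thesis using M\<sigma>[OF that(2)] by simp
  qed
  have lim: "\<exists>q. ((\<lambda>s. A (Complex (\<sigma> * s) y)) \<longlongrightarrow> q) at_top" if y: "y > c" for y
  proof -
    let ?f = "\<lambda>x. of_real \<sigma> * f (Complex (\<sigma> * x) y)"
    have intf: "integrable lborel ?f" using int\<sigma>[OF y] by simp
    have "((\<lambda>s. LBINT x. indicator {0..s} x *\<^sub>R ?f x) \<longlongrightarrow> (LBINT x. indicator {0..} x *\<^sub>R ?f x)) at_top"
    proof (rule tendsto_integral_indicator[OF intf])
      show "eventually (\<lambda>s. x \<in> {0..s} \<longleftrightarrow> x \<in> {0..}) at_top" for x :: real
        using eventually_ge_at_top[of x] by eventually_elim auto
    qed auto
    then have "((\<lambda>s. A (Complex (\<sigma> * 0) y) + (LBINT x. indicator {0..s} x *\<^sub>R ?f x)) \<longlongrightarrow>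
       A (Complex (\<sigma> * 0) y) + (LBINT x. indicator {0..} x *\<^sub>R ?f x)) at_top"
      by (intro tendsto_intros)
    then have "((\<lambda>s. A (Complex (\<sigma> * s) y)) \<longlongrightarrow>
       A (Complex (\<sigma> * 0) y) + (LBINT x. indicator {0..} x *\<^sub>R ?f x)) at_top"
    proof (rule Lim_transform_eventually)
      show "eventually (\<lambda>s. A (Complex (\<sigma> * 0) y) + (LBINT x. indicator {0..s} x *\<^sub>R ?f x) = A (Complex (\<sigma> * s) y)) at_top"
        using eventually_ge_at_top[of 0]
        by eventually_elim (use has_bochner_integral_integral_eq[OF FTC[OF _ y, of 0]] in simp)
    qed
    then show ?thesis by blast
  qed
  then obtain q where q: "\<And>y. y > c \<Longrightarrow> ((\<lambda>s. A (Complex (\<sigma> * s) y)) \<longlongrightarrow> q y) at_top" by metis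
  have "A holomorphic_on {z. Im z > c}"
    using A by (auto simp: holomorphic_on_open[OF open_Im_gt])
  then obtain B where B: "\<And>z. Im z > c \<Longrightarrow> (B has_field_derivative A z) (at z)"
    using half_plane_primitive by blast
  \<comment> \<open>Along a line, \<open>D\<close> is \<open>\<sigma>\<close> times the integral of
    \<open>A\<close> over a window of length 1, so it inherits a limit from
    \<open>A\<close>.\<close>
  define D where "D z = B (z + of_real \<sigma>) - B z" for z
  have D': "(D has_field_derivative (A (z + of_real \<sigma>) - A z)) (at z)" if "Im z > c" for z
    unfolding D_def using B[of "z + of_real \<sigma>"] B[OF that] that
    by (intro DERIV_diff) (simp_all add: DERIV_shift[symmetric])
  have Dlim: "((\<lambda>s. D (Complex (\<sigma> * s) y)) \<longlongrightarrow> of_real \<sigma> * q y) at_top" if y: "y > c" for y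
  proof (rule tendstoI)
    fix e :: real assume e: "e > 0"
    obtain S where S: "\<And>s. s \<ge> S \<Longrightarrow> dist (A (Complex (\<sigma> * s) y)) (q y) < e/2"
      using tendstoD[OF q[OF y], of "e/2"] e by (auto simp: eventually_at_top_linorder)
    show "eventually (\<lambda>s. dist (D (Complex (\<sigma> * s) y)) (of_real \<sigma> * q y) < e) at_top"
      using eventually_ge_at_top[of S]
    proof eventually_elim
      case (elim s)
      let ?g = "\<lambda>x. B (Complex (\<sigma> * x) y) - of_real x * (of_real \<sigma> * q y)"
      have hi: "((\<lambda>x. of_real \<sigma> * A (Complex (\<sigma> * x) y) - of_real \<sigma> * q y) has_integral (?g (s + 1) - ?g s)) {s..s + 1}"
        by (intro fundamental_theorem_of_calculus)
          (use y in \<open>auto intro!: derivative_eq_intros has_vector_derivative_horizontal B simp: scaleR_conv_of_real\<close>)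
      have "norm (?g (s + 1) - ?g s) \<le> e/2 * measure lborel {s..s+1}"
      proof (rule has_integral_bound_real[OF _ finite.emptyI hi])
        show "norm (of_real \<sigma> * A (Complex (\<sigma> * x) y) - of_real \<sigma> * q y) \<le> e/2" if "x \<in> {s..s+1} - {}" for x
        proof -
          have "norm (of_real \<sigma> * A (Complex (\<sigma> * x) y) - of_real \<sigma> * q y) = norm (A (Complex (\<sigma> * x) y) - q y)"
            using \<sigma>' by (simp add: right_diff_distrib[symmetric] norm_mult)
          then show ?thesis using S[of x] that elim by (simp add: dist_norm)
        qed
      qed (use e in auto)
      moreover have "Complex (\<sigma> * s) y + of_real \<sigma> = Complex (\<sigma> * (s + 1)) y"
        by (simp add: complex_eq_iff algebra_simps)
      then have "?g (s + 1) - ?g s = D (Complex (\<sigma> * s) y) - of_real \<sigma> * q y"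
        by (simp add: D_def algebra_simps)
      ultimately have "norm (D (Complex (\<sigma> * s) y) - of_real \<sigma> * q y) \<le> e/2" by simp
      then show ?case using e by (simp add: dist_norm)
    qed
  qed
  have eq: "q a = q b" if ab: "c < a" "a \<le> b" for a b
  proof -
    let ?d = "\<lambda>s t. \<i> * (A (Complex (\<sigma> * s) t + of_real \<sigma>) - A (Complex (\<sigma> * s) t))"
    have shift: "Complex (\<sigma> * s) t + of_real \<sigma> = Complex (\<sigma> * (s + 1)) t" for s t
      by (simp add: complex_eq_iff algebra_simps)
    have contd: "continuous_on {a..b} (?d s)" for s
    proof -
      have "continuous_on {a..b} (\<lambda>t. A (Complex r t))" for r
        by (rule continuous_on_vector_derivative, rule has_vector_derivative_vertical[OF A]) (use ab in auto)
      then show ?thesis unfolding shift by (intro continuous_intros)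
    qed
    have ftc: "has_bochner_integral lborel (\<lambda>t. indicator {a..b} t *\<^sub>R ?d s t)
        (D (Complex (\<sigma> * s) b) - D (Complex (\<sigma> * s) a))" for s
      by (rule has_bochner_integral_FTC_Icc[OF ab(2) has_vector_derivative_vertical[OF D'] contd]) (use ab in auto)
    \<comment> \<open>At each height both arguments of \<open>A\<close> run to the same end of the
      same line, so the integrand tends to 0.\<close>
    have "((\<lambda>s. LBINT t. indicator {a..b} t *\<^sub>R ?d s t) \<longlongrightarrow> (\<integral>t. 0 \<partial>(lborel :: real measure))) at_top"
    proof (rule integral_dominated_convergence_at_top[where w="\<lambda>t. indicator {a..b} t *\<^sub>R M"])
      show "(\<lambda>t. indicat_real {a..b} t *\<^sub>R ?d s t) \<in> borel_measurable lborel" for s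
        by (rule borel_measurable_integrable) (rule integrable.intros[OF ftc])
      show "AE t in lborel. ((\<lambda>s. indicat_real {a..b} t *\<^sub>R ?d s t) \<longlongrightarrow> 0) at_top"
      proof (rule AE_I2)
        fix t
        show "((\<lambda>s. indicat_real {a..b} t *\<^sub>R ?d s t) \<longlongrightarrow> 0) at_top"
        proof (cases "t \<in> {a..b}")
          case True
          then have t: "t > c" using ab by simp
          have "filterlim (\<lambda>s::real. 1 + s) at_top at_top"
            by (rule filterlim_tendsto_add_at_top[OF tendsto_const filterlim_ident])
          then have "filterlim (\<lambda>s::real. s + 1) at_top at_top" by (simp add: add.commute)
          from filterlim_compose[OF q[OF t] this]
          have "((\<lambda>s. ?d s t) \<longlongrightarrow> \<i> * (q t - q t)) at_top"
            unfolding shift by (intro tendsto_intros q t)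
          then show ?thesis using True by simp
        qed simp
      qed
      show "\<forall>\<^sub>F s in at_top. AE t in lborel. norm (indicat_real {a..b} t *\<^sub>R ?d s t) \<le> indicat_real {a..b} t *\<^sub>R M"
      proof (intro always_eventually allI AE_I2)
        fix s t
        show "norm (indicat_real {a..b} t *\<^sub>R ?d s t) \<le> indicat_real {a..b} t *\<^sub>R M"
          using osc[of s "s+1" t] ab unfolding shift by (auto simp: norm_mult split: split_indicator)
      qed
    qed (use integrable_real_indicator[of "{a..b}" lborel] ab in auto)
    then have "((\<lambda>s. D (Complex (\<sigma> * s) b) - D (Complex (\<sigma> * s) a)) \<longlongrightarrow> 0) at_top"
      using has_bochner_integral_integral_eq[OF ftc] by simp
    moreover have "((\<lambda>s. D (Complex (\<sigma> * s) b) - D (Complex (\<sigma> * s) a)) \<longlongrightarrow> of_real \<sigma> * q b - of_real \<sigma> * q a) at_top"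
      by (intro tendsto_intros Dlim) (use ab in auto)
    ultimately have "0 = of_real \<sigma> * q b - of_real \<sigma> * q a"
      by (intro tendsto_unique[OF trivial_limit_at_top_linorder])
    then show ?thesis using \<sigma>' by simp
  qed
  show ?thesis
  proof (rule that[of "q (c + 1)"])
    fix y assume y: "y > c"
    have "q y = q (c + 1)"
    proof (cases "y \<le> c + 1")
      case True
      show ?thesis by (rule eq[OF y True])
    next
      case False
      then have "q (c + 1) = q y" by (intro eq) auto
      then show ?thesis by (rule sym)
    qed
    then show "((\<lambda>s. A (Complex (\<sigma> * s) y)) \<longlongrightarrow> q (c + 1)) at_top" using q[OF y] by simp
  qed
qed

text \<open>Both integrals are the difference of the two end limits of one primitive, and those
  limits are shared by all heights.\<close>

lemma line_integral_const:
  assumes hol: "f holomorphic_on {z. Im z > c}"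
    and int: "\<And>y. y > c \<Longrightarrow> integrable lborel (\<lambda>x. f (Complex x y))"
    and M: "\<And>y. y > c \<Longrightarrow> (LBINT x. cmod (f (Complex x y))) \<le> M"
    and ab: "a > c" "b > c"
  shows "(LBINT x. f (Complex x a)) = (LBINT x. f (Complex x b))"
proof -
  obtain A where A: "\<And>z. Im z > c \<Longrightarrow> (A has_field_derivative f z) (at z)"
    using half_plane_primitive[OF hol] by blast
  obtain p where p: "\<And>y. y > c \<Longrightarrow> ((\<lambda>s. A (Complex (1 * s) y)) \<longlongrightarrow> p) at_top"
    by (rule primitive_limit[OF hol A int M, of 1]) auto
  obtain m where m: "\<And>y. y > c \<Longrightarrow> ((\<lambda>s. A (Complex (-1 * s) y)) \<longlongrightarrow> m) at_top"
    by (rule primitive_limit[OF hol A int M, of "-1"]) auto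
  have "(LBINT x. f (Complex x y)) = p - m" if y: "y > c" for y
  proof -
    have FTC: "(LBINT x. indicator {-s..s} x *\<^sub>R f (Complex x y)) = A (Complex s y) - A (Complex (-s) y)"
      if "s \<ge> 0" for s
    proof (rule has_bochner_integral_integral_eq, rule has_bochner_integral_FTC_Icc)
      show "((\<lambda>x. A (Complex x y)) has_vector_derivative f (Complex x y)) (at x within {-s..s})" for x
        using has_vector_derivative_horizontal[of A "f (Complex x y)" 1 x y] A[of "Complex x y"] y by simp
    qed (use that y continuous_on_line[OF hol] in auto)
    have "((\<lambda>s. LBINT x. indicator {-s..s} x *\<^sub>R f (Complex x y)) \<longlongrightarrow> (LBINT x. indicator UNIV x *\<^sub>R f (Complex x y))) at_top"
    proof (rule tendsto_integral_indicator[OF int[OF y]])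
      show "eventually (\<lambda>s. x \<in> {-s..s} \<longleftrightarrow> x \<in> UNIV) at_top" for x :: real
        using eventually_ge_at_top[of "\<bar>x\<bar>"] by eventually_elim auto
    qed auto
    then have "((\<lambda>s. LBINT x. indicator {-s..s} x *\<^sub>R f (Complex x y)) \<longlongrightarrow> (LBINT x. f (Complex x y))) at_top"
      by simp
    moreover have "((\<lambda>s. LBINT x. indicator {-s..s} x *\<^sub>R f (Complex x y)) \<longlongrightarrow> p - m) at_top"
    proof (rule Lim_transform_eventually)
      show "((\<lambda>s. A (Complex (1 * s) y) - A (Complex (-1 * s) y)) \<longlongrightarrow> p - m) at_top"
        by (intro tendsto_intros p m y)
      show "eventually (\<lambda>s. A (Complex (1 * s) y) - A (Complex (-1 * s) y) = (LBINT x. indicator {-s..s} x *\<^sub>R f (Complex x y))) at_top"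
        using eventually_ge_at_top[of 0] by eventually_elim (simp add: FTC)
    qed
    ultimately show ?thesis by (intro tendsto_unique[OF trivial_limit_at_top_linorder])
  qed
  then show ?thesis using ab by simp
qed

text \<open>Moving the line to height infinity only works after damping by the factor
  \<open>\<i>R / (z + \<i>(R - c))\<close>, which has modulus at most 1 and tends to 1 as \<open>R\<close> grows.\<close>

lemma line_integral_zero:
  assumes hol: "f holomorphic_on {z. Im z > c}"
    and int: "\<And>y. y > c \<Longrightarrow> integrable lborel (\<lambda>x. f (Complex x y))"
    and M: "\<And>y. y > c \<Longrightarrow> (LBINT x. cmod (f (Complex x y))) \<le> M"
    and a: "a > c"
  shows "(LBINT x. f (Complex x a)) = 0"
proof -
  define w where "w R z = \<i> * of_real R / (z + \<i> * of_real (R - c))" for R z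
  have ImR: "cmod (z + \<i> * of_real (R - c)) \<ge> R + (Im z - c)" "z + \<i> * of_real (R - c) \<noteq> 0"
    if "R > 0" "Im z > c" for R z
    using abs_Im_le_cmod[of "z + \<i> * of_real (R - c)"] that by (auto simp: complex_eq_iff)
  have wle: "cmod (w R z) \<le> R / (R + (Im z - c))" if "R > 0" "Im z > c" for R z
    unfolding w_def using ImR(1)[OF that] that by (simp add: norm_divide norm_mult frac_le)
  have wle1: "cmod (w R z) \<le> 1" if "R > 0" "Im z > c" for R z
    by (rule order_trans[OF wle[OF that]]) (use that in simp)
  have [measurable]: "(\<lambda>x. f (Complex x y)) \<in> borel_measurable lborel" if "y > c" for y
    using borel_measurable_line[OF hol that] .
  have wm [measurable]: "(\<lambda>x. w R (Complex x y)) \<in> borel_measurable lborel" for y R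
    unfolding w_def Complex_eq by measurable
  have zero: "(LBINT x. w R (Complex x a) * f (Complex x a)) = 0" if R: "R > 0" for R
  proof -
    let ?g = "\<lambda>z. w R z * f z"
    have "w R holomorphic_on {z. Im z > c}"
      unfolding w_def using ImR(2)[OF R] by (intro holomorphic_intros) auto
    then have holg: "?g holomorphic_on {z. Im z > c}" by (intro holomorphic_intros hol)
    have le: "cmod (?g (Complex x y)) \<le> cmod (f (Complex x y))" if "y > c" for x y
      using wle1[OF R, of "Complex x y"] that by (simp add: norm_mult mult_left_le_one_le)
    have intg: "integrable lborel (\<lambda>x. ?g (Complex x y))" if "y > c" for y
      by (rule Bochner_Integration.integrable_bound[OF int[OF that]])
        (use le that borel_measurable_line[OF holg that] in auto)
    have "(LBINT x. cmod (?g (Complex x y))) \<le> M" if "y > c" for y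
    proof -
      have "(LBINT x. cmod (?g (Complex x y))) \<le> (LBINT x. cmod (f (Complex x y)))"
        by (intro integral_mono integrable_norm int intg le that)
      then show ?thesis using M[OF that] by simp
    qed
    note const = line_integral_const[OF holg intg this a]
    \<comment> \<open>The value may be computed at any height b. There the damping contributes R /
      (R + b - c), which tends to 0 as b grows with R fixed; only afterwards does R grow.\<close>
    have bound: "cmod (LBINT x. ?g (Complex x a)) \<le> R / (R + (b - c)) * M" if b: "b > c" for b
    proof -
      have "cmod (LBINT x. ?g (Complex x a)) = cmod (LBINT x. ?g (Complex x b))"
        using const[OF _ _ b] by simp
      also have "\<dots> \<le> (LBINT x. cmod (?g (Complex x b)))" by (rule integral_norm_bound)
      also have "\<dots> \<le> (LBINT x. R / (R + (b - c)) * cmod (f (Complex x b)))"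
      proof (rule integral_mono)
        show "cmod (?g (Complex x b)) \<le> R / (R + (b - c)) * cmod (f (Complex x b))" for x
          using wle[OF R, of "Complex x b"] b unfolding norm_mult by (intro mult_right_mono) auto
      qed (use intg[OF b] int[OF b] in \<open>auto intro: integrable_norm\<close>)
      also have "\<dots> \<le> R / (R + (b - c)) * M"
        using M[OF b] R b by (simp add: divide_right_mono)
      finally show ?thesis .
    qed
    have "filterlim (\<lambda>b. (R - c) + b) at_top at_top"
      by (rule filterlim_tendsto_add_at_top[OF tendsto_const filterlim_ident])
    then have "((\<lambda>b. R / ((R - c) + b) * M) \<longlongrightarrow> 0 * M) at_top"
      by (intro tendsto_intros tendsto_divide_0[OF tendsto_const] filterlim_at_top_imp_at_infinity)
    then have "((\<lambda>b. R / (R + (b - c)) * M) \<longlongrightarrow> 0) at_top" by (simp add: algebra_simps)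
    moreover have "eventually (\<lambda>b. cmod (LBINT x. ?g (Complex x a)) \<le> R / (R + (b - c)) * M) at_top"
      using eventually_gt_at_top[of c] by eventually_elim (rule bound)
    ultimately have "cmod (LBINT x. ?g (Complex x a)) \<le> 0"
      by (intro tendsto_lowerbound) auto
    then show ?thesis by simp
  qed
  have "((\<lambda>R. LBINT x. w R (Complex x a) * f (Complex x a)) \<longlongrightarrow> (LBINT x. f (Complex x a))) at_top"
  proof (rule integral_dominated_convergence_at_top[where w="\<lambda>x. cmod (f (Complex x a))"])
    show "AE x in lborel. ((\<lambda>R. w R (Complex x a) * f (Complex x a)) \<longlongrightarrow> f (Complex x a)) at_top"
    proof (rule AE_I2)
      fix x
      let ?z = "Complex x a - \<i> * of_real c"
      \<comment> \<open>Numerator and denominator of \<open>w\<close> are divided by R, so that only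
        1/R varies.\<close>
      have "((\<lambda>R. \<i> / (?z * of_real (inverse R) + \<i>)) \<longlongrightarrow> \<i> / (?z * of_real 0 + \<i>)) at_top"
        by (intro tendsto_intros tendsto_inverse_0_at_top) (auto simp: filterlim_ident)
      then have "((\<lambda>R. w R (Complex x a)) \<longlongrightarrow> \<i> / (?z * of_real 0 + \<i>)) at_top"
      proof (rule Lim_transform_eventually)
        show "eventually (\<lambda>R. \<i> / (?z * of_real (inverse R) + \<i>) = w R (Complex x a)) at_top"
          using eventually_gt_at_top[of 0]
        proof eventually_elim
          case (elim R)
          have "?z * of_real (inverse R) + \<i> = (Complex x a + \<i> * of_real (R - c)) / of_real R"
            using elim by (simp add: field_simps)
          then show ?case unfolding w_def by simp
        qed
      qed
      from tendsto_mult[OF this tendsto_const[of "f (Complex x a)"]]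
      show "((\<lambda>R. w R (Complex x a) * f (Complex x a)) \<longlongrightarrow> f (Complex x a)) at_top" by simp
    qed
    show "\<forall>\<^sub>F R in at_top. AE x in lborel. norm (w R (Complex x a) * f (Complex x a)) \<le> cmod (f (Complex x a))"
      using eventually_gt_at_top[of 0]
    proof eventually_elim
      case (elim R)
      show ?case using wle1[OF elim] a by (intro AE_I2) (simp add: norm_mult mult_left_le_one_le)
    qed
  qed (use a int[OF a] in \<open>auto intro: integrable_norm\<close>)
  moreover have "((\<lambda>R. LBINT x. w R (Complex x a) * f (Complex x a)) \<longlongrightarrow> 0) at_top"
    by (rule tendsto_eventually) (rule eventually_mono[OF eventually_gt_at_top[of 0] zero])
  ultimately show ?thesis by (intro tendsto_unique[OF trivial_limit_at_top_linorder])
qed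

section \<open>The Poisson integral\<close>

lemma has_bochner_integral_poisson_kernel:
  assumes y: "y > 0"
  shows "has_bochner_integral lborel (\<lambda>x. 1 / ((x - u)\<^sup>2 + y\<^sup>2)) (pi / y)"
proof -
  let ?F = "\<lambda>x. arctan ((x - u) / y) / y"
  have pos: "(x - u)\<^sup>2 + y\<^sup>2 > 0" for x using y by (simp add: add_nonneg_pos)
  have d: "(?F has_real_derivative 1 / ((x - u)\<^sup>2 + y\<^sup>2)) (at x)" for x
  proof -
    have "1 + ((x - u) / y)\<^sup>2 = ((x - u)\<^sup>2 + y\<^sup>2) / y\<^sup>2" using y by (simp add: field_simps)
    moreover have "1 / Q = inverse (Q / y\<^sup>2) * (1 / y) / y" for Q
      using y by (simp add: power2_eq_square)
    ultimately have "1 / ((x - u)\<^sup>2 + y\<^sup>2) = inverse (1 + ((x - u) / y)\<^sup>2) * (1 / y) / y"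
      by metis
    then show ?thesis using y by (auto intro!: derivative_eq_intros)
  qed
  have lim1: "filterlim (\<lambda>x. (x - u) / y) at_top at_top"
  proof -
    have "filterlim (\<lambda>x::real. - u + x) at_top at_top"
      by (rule filterlim_tendsto_add_at_top[OF tendsto_const filterlim_ident])
    with y have "filterlim (\<lambda>x::real. (1 / y) * (- u + x)) at_top at_top"
      by (intro filterlim_tendsto_pos_mult_at_top[OF tendsto_const]) auto
    then show ?thesis by (simp add: field_simps)
  qed
  have lim2: "filterlim (\<lambda>x. (x - u) / y) at_bot at_bot"
  proof -
    have "filterlim (\<lambda>x::real. u + x) at_top at_top"
      by (rule filterlim_tendsto_add_at_top[OF tendsto_const filterlim_ident])
    with y have "filterlim (\<lambda>x::real. (1 / y) * (u + x)) at_top at_top"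
      by (intro filterlim_tendsto_pos_mult_at_top[OF tendsto_const]) auto
    then have "filterlim (\<lambda>x::real. - ((1 / y) * (u + x))) at_bot at_top"
      by (simp add: filterlim_uminus_at_top)
    moreover have "(\<lambda>x. (- x - u) / y) = (\<lambda>x. - ((1 / y) * (u + x)))" using y by (auto simp: field_simps)
    ultimately show ?thesis by (subst filterlim_at_bot_mirror) simp
  qed
  have c: "isCont (\<lambda>x. 1 / ((x - u)\<^sup>2 + y\<^sup>2)) x" for x
    using pos[of x] by (intro continuous_intros) auto
  have t1: "((\<lambda>x. ?F x) \<longlongrightarrow> (pi / 2) / y) at_top"
    by (intro tendsto_intros filterlim_compose[OF tendsto_arctan_at_top lim1]) (use y in auto)
  have t2: "((\<lambda>x. ?F x) \<longlongrightarrow> (- (pi / 2)) / y) at_bot"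
    by (intro tendsto_intros filterlim_compose[OF tendsto_arctan_at_bot lim2]) (use y in auto)
  have A: "((?F \<circ> real_of_ereal) \<longlongrightarrow> (- (pi / 2)) / y) (at_right (-\<infinity>))"
    unfolding ereal_tendsto_simps by (rule t2)
  have B: "((?F \<circ> real_of_ereal) \<longlongrightarrow> (pi / 2) / y) (at_left \<infinity>)"
    unfolding ereal_tendsto_simps by (rule t1)
  have "set_integrable lborel (einterval (-\<infinity>) \<infinity>) (\<lambda>x. 1 / ((x - u)\<^sup>2 + y\<^sup>2))"
    "(LBINT x=-\<infinity>..\<infinity>. 1 / ((x - u)\<^sup>2 + y\<^sup>2)) = (pi / 2) / y - (- (pi / 2)) / y"
    using interval_integral_FTC_nonneg[OF _ d c _ A B] pos by (auto simp: less_imp_le)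
  then show ?thesis
    by (simp add: has_bochner_integral_iff interval_lebesgue_integral_def set_integrable_def set_lebesgue_integral_def field_simps)
qed

lemmas integrable_poisson_kernel = integrable.intros[OF has_bochner_integral_poisson_kernel]
lemmas integral_poisson_kernel = has_bochner_integral_integral_eq[OF has_bochner_integral_poisson_kernel]

lemma poisson_kernel_bounds:
  fixes y :: real
  assumes "y > 0"
  shows "0 \<le> 1 / ((x - u)\<^sup>2 + y\<^sup>2)" "1 / ((x - u)\<^sup>2 + y\<^sup>2) \<le> 1 / y\<^sup>2" "(x - u)\<^sup>2 + y\<^sup>2 > 0"
  using assms by (auto intro!: divide_left_mono add_nonneg_pos mult_pos_pos)

lemma sq_int_poisson_kernel:
  assumes y: "y > 0"
  shows "sq_int (\<lambda>x. complex_of_real (1 / ((x - u)\<^sup>2 + y\<^sup>2)))"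
  unfolding sq_int_def
proof
  show "(\<lambda>x. complex_of_real (1 / ((x - u)\<^sup>2 + y\<^sup>2))) \<in> borel_measurable lborel" by measurable
  have "integrable lborel (\<lambda>x. (1 / y\<^sup>2) * (1 / ((x - u)\<^sup>2 + y\<^sup>2)))"
    by (intro integrable_mult_right integrable_poisson_kernel y)
  then show "integrable lborel (\<lambda>x. (cmod (complex_of_real (1 / ((x - u)\<^sup>2 + y\<^sup>2))))\<^sup>2)"
  proof (rule Bochner_Integration.integrable_bound)
    show "AE x in lborel. norm ((cmod (complex_of_real (1 / ((x - u)\<^sup>2 + y\<^sup>2))))\<^sup>2) \<le> norm ((1 / y\<^sup>2) * (1 / ((x - u)\<^sup>2 + y\<^sup>2)))"
    proof (rule AE_I2)
      fix x
      note b = poisson_kernel_bounds[OF y, of x u]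
      have "(cmod (complex_of_real (1 / ((x - u)\<^sup>2 + y\<^sup>2))))\<^sup>2 = (1 / ((x - u)\<^sup>2 + y\<^sup>2)) * (1 / ((x - u)\<^sup>2 + y\<^sup>2))"
        unfolding norm_of_real by (simp add: power2_eq_square)
      also have "\<dots> \<le> (1 / y\<^sup>2) * (1 / ((x - u)\<^sup>2 + y\<^sup>2))"
        by (intro mult_right_mono b)
      finally show "norm ((cmod (complex_of_real (1 / ((x - u)\<^sup>2 + y\<^sup>2))))\<^sup>2) \<le> norm ((1 / y\<^sup>2) * (1 / ((x - u)\<^sup>2 + y\<^sup>2)))"
        using b by simp
    qed
  qed measurable
qed

text \<open>The value at the point u + iy. With the height before the abscissa,
  \<open>poisson f y\<close> is a function on a line, to which \<open>sq_int\<close> and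
  \<open>l2norm\<close> apply.\<close>

definition poisson :: "(real \<Rightarrow> complex) \<Rightarrow> real \<Rightarrow> real \<Rightarrow> complex" where
  "poisson f y u = of_real (y / pi) * (LBINT x. f x * of_real (1 / ((x - u)\<^sup>2 + y\<^sup>2)))"

lemma integrable_poisson:
  assumes "sq_int f" "y > 0"
  shows "integrable lborel (\<lambda>x. f x * of_real (1 / ((x - u)\<^sup>2 + y\<^sup>2)))"
  by (rule integrable_mult[OF assms(1) sq_int_poisson_kernel[OF assms(2)]])

lemma poisson_diff:
  assumes "sq_int f" "sq_int g" "y > 0"
  shows "poisson (\<lambda>x. f x - g x) y u = poisson f y u - poisson g y u"
  unfolding poisson_def using integrable_poisson[OF assms(1,3)] integrable_poisson[OF assms(2,3)]
  by (simp add: left_diff_distrib right_diff_distrib del: of_real_divide)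

lemma integrable_sq_poisson:
  assumes "sq_int f" "y > 0"
  shows "integrable lborel (\<lambda>x. (cmod (f x))\<^sup>2 * (1 / ((x - u)\<^sup>2 + y\<^sup>2)))"
proof (rule Bochner_Integration.integrable_bound)
  note [measurable] = sq_intD(1)[OF assms(1)]
  show "integrable lborel (\<lambda>x. (cmod (f x))\<^sup>2 * (1 / y\<^sup>2))"
    using sq_intD(2)[OF assms(1)] by (rule integrable_mult_left)
  show "(\<lambda>x. (cmod (f x))\<^sup>2 * (1 / ((x - u)\<^sup>2 + y\<^sup>2))) \<in> borel_measurable lborel" by measurable
  show "AE x in lborel. norm ((cmod (f x))\<^sup>2 * (1 / ((x - u)\<^sup>2 + y\<^sup>2))) \<le> norm ((cmod (f x))\<^sup>2 * (1 / y\<^sup>2))"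
  proof (rule AE_I2)
    fix x
    show "norm ((cmod (f x))\<^sup>2 * (1 / ((x - u)\<^sup>2 + y\<^sup>2))) \<le> norm ((cmod (f x))\<^sup>2 * (1 / y\<^sup>2))"
      using poisson_kernel_bounds[OF assms(2), of x u] mult_left_mono[of "1 / ((x - u)\<^sup>2 + y\<^sup>2)" "1 / y\<^sup>2" "(cmod (f x))\<^sup>2"]
      by (simp add: abs_mult)
  qed
qed

text \<open>Jensen's inequality for a probability density, obtained from Cauchy-Schwarz by splitting
  the kernel into two square roots; one factor then has squared norm pi/y.\<close>

lemma poisson_sq_le:
  assumes f: "sq_int f" and y: "y > 0"
  shows "(cmod (poisson f y u))\<^sup>2 \<le> (LBINT x. (cmod (f x))\<^sup>2 * (y / pi * (1 / ((x - u)\<^sup>2 + y\<^sup>2))))"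
proof -
  let ?k = "\<lambda>x. 1 / ((x - u)\<^sup>2 + y\<^sup>2)"
  let ?s = "\<lambda>x. complex_of_real (sqrt (?k x))"
  note k0 = poisson_kernel_bounds(1)[OF y]
  note [measurable] = sq_intD(1)[OF f]
  have s1: "sq_int ?s" unfolding sq_int_def
    using integrable_poisson_kernel[OF y, of u] k0 by simp
  have e2: "(cmod (f x * ?s x))\<^sup>2 = (cmod (f x))\<^sup>2 * ?k x" for x
    using k0[of x u] by (simp add: norm_mult power_mult_distrib)
  have s2: "sq_int (\<lambda>x. f x * ?s x)" unfolding sq_int_def e2
    using integrable_sq_poisson[OF f y, of u] by simp
  have n1: "(l2norm ?s)\<^sup>2 = pi / y" unfolding l2norm_sq using integral_poisson_kernel[OF y, of u] k0 by simp
  have n2: "(l2norm (\<lambda>x. f x * ?s x))\<^sup>2 = (LBINT x. (cmod (f x))\<^sup>2 * ?k x)"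
    unfolding l2norm_sq e2 ..
  have eq: "f x * complex_of_real (?k x) = (f x * ?s x) * ?s x" for x
  proof -
    have "complex_of_real (?k x) = ?s x * ?s x" unfolding of_real_mult[symmetric] using k0[of x u] by simp
    then show ?thesis by (simp only: mult.assoc)
  qed
  have "cmod (poisson f y u) = y / pi * cmod (LBINT x. (f x * ?s x) * ?s x)"
    unfolding poisson_def eq using y by (simp add: norm_mult del: of_real_divide)
  also have "\<dots> \<le> y / pi * (l2norm (\<lambda>x. f x * ?s x) * l2norm ?s)"
    using cauchy_schwarz[OF s2 s1] y by (intro mult_left_mono) auto
  finally have "(cmod (poisson f y u))\<^sup>2 \<le> (y / pi * (l2norm (\<lambda>x. f x * ?s x) * l2norm ?s))\<^sup>2"
    by (intro power_mono) auto
  also have "\<dots> = (y / pi)\<^sup>2 * ((l2norm (\<lambda>x. f x * ?s x))\<^sup>2 * (l2norm ?s)\<^sup>2)"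
    by (simp add: power_mult_distrib power_divide)
  also have "\<dots> = (y / pi) * (LBINT x. (cmod (f x))\<^sup>2 * ?k x)"
    unfolding n1 n2 using y by (simp add: power2_eq_square)
  also have "\<dots> = (LBINT x. (y / pi) * ((cmod (f x))\<^sup>2 * ?k x))"
    by (rule integral_mult_right_zero[symmetric])
  also have "\<dots> = (LBINT x. (cmod (f x))\<^sup>2 * (y / pi * ?k x))"
    by (rule arg_cong[where f="integral\<^sup>L lborel"]) (rule ext, rule mult.left_commute)
  finally show ?thesis .
qed

text \<open>The kernel is at most 1/y^2 and y/pi * 1/y^2 = 1/(pi y). As the bound is uniform on
  half-planes away from the axis, L2 convergence of boundary values gives locally uniform
  convergence inside.\<close>

lemma poisson_pointwise_le:
  assumes f: "sq_int f" and y: "y > 0"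
  shows "cmod (poisson f y u) \<le> l2norm f / sqrt (pi * y)"
proof (rule power2_le_imp_le)
  have "(cmod (poisson f y u))\<^sup>2 \<le> (LBINT x. (cmod (f x))\<^sup>2 * (y / pi * (1 / ((x - u)\<^sup>2 + y\<^sup>2))))"
    by (rule poisson_sq_le[OF assms])
  also have "\<dots> \<le> (LBINT x. (cmod (f x))\<^sup>2 * (y / pi * (1 / y\<^sup>2)))"
  proof (rule integral_mono)
    have "integrable lborel (\<lambda>x. (y / pi) * ((cmod (f x))\<^sup>2 * (1 / ((x - u)\<^sup>2 + y\<^sup>2))))"
      by (intro integrable_mult_right integrable_sq_poisson assms)
    then show "integrable lborel (\<lambda>x. (cmod (f x))\<^sup>2 * (y / pi * (1 / ((x - u)\<^sup>2 + y\<^sup>2))))"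
      by (simp add: mult_ac)
    show "integrable lborel (\<lambda>x. (cmod (f x))\<^sup>2 * (y / pi * (1 / y\<^sup>2)))"
      using sq_intD(2)[OF f] by (rule integrable_mult_left)
    show "(cmod (f x))\<^sup>2 * (y / pi * (1 / ((x - u)\<^sup>2 + y\<^sup>2))) \<le> (cmod (f x))\<^sup>2 * (y / pi * (1 / y\<^sup>2))" for x
      using poisson_kernel_bounds[OF y] y by (intro mult_left_mono) auto
  qed
  also have "\<dots> = (l2norm f)\<^sup>2 * (y / pi * (1 / y\<^sup>2))" by (simp add: l2norm_sq)
  also have "\<dots> = (l2norm f / sqrt (pi * y))\<^sup>2" using y by (simp add: power_divide power2_eq_square)
  finally show "(cmod (poisson f y u))\<^sup>2 \<le> (l2norm f / sqrt (pi * y))\<^sup>2" .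
qed (use y in simp)

text \<open>\<open>poisson_sq_le\<close> is integrated over u and the integrations are exchanged; by
  symmetry in x and u the normalized kernel has mass 1 in u as well.\<close>

lemma poisson_contraction:
  assumes f: "sq_int f" and y: "y > 0"
  shows "sq_int (poisson f y)" "l2norm (poisson f y) \<le> l2norm f"
proof -
  note [measurable] = sq_intD(1)[OF f]
  let ?k = "\<lambda>u x. y / pi * (1 / ((x - u)\<^sup>2 + y\<^sup>2))"
  have k0: "?k u x \<ge> 0" for u x using y by simp
  have [measurable]: "poisson f y \<in> borel_measurable lborel"
    unfolding poisson_def by measurable
  have "(\<integral>\<^sup>+u. ennreal ((cmod (poisson f y u))\<^sup>2) \<partial>lborel) \<le>
      (\<integral>\<^sup>+u. (\<integral>\<^sup>+x. ennreal ((cmod (f x))\<^sup>2 * ?k u x) \<partial>lborel) \<partial>lborel)"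
  proof (rule nn_integral_mono)
    fix u
    have "integrable lborel (\<lambda>x. (y / pi) * ((cmod (f x))\<^sup>2 * (1 / ((x - u)\<^sup>2 + y\<^sup>2))))"
      by (intro integrable_mult_right integrable_sq_poisson assms)
    then have "integrable lborel (\<lambda>x. (cmod (f x))\<^sup>2 * ?k u x)" by (simp add: mult_ac)
    then have "(\<integral>\<^sup>+x. ennreal ((cmod (f x))\<^sup>2 * ?k u x) \<partial>lborel) = ennreal (LBINT x. (cmod (f x))\<^sup>2 * ?k u x)"
      by (rule nn_integral_eq_integral) (intro AE_I2 mult_nonneg_nonneg k0 zero_le_power2)
    then show "ennreal ((cmod (poisson f y u))\<^sup>2) \<le> (\<integral>\<^sup>+x. ennreal ((cmod (f x))\<^sup>2 * ?k u x) \<partial>lborel)"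
      using poisson_sq_le[OF assms, of u] by (simp add: ennreal_leI)
  qed
  also have "\<dots> = (\<integral>\<^sup>+x. (\<integral>\<^sup>+u. ennreal ((cmod (f x))\<^sup>2 * ?k u x) \<partial>lborel) \<partial>lborel)"
    by (rule lborel_pair.Fubini') measurable
  also have "\<dots> = (\<integral>\<^sup>+x. ennreal ((cmod (f x))\<^sup>2) \<partial>lborel)"
  proof (rule nn_integral_cong)
    fix x
    have "has_bochner_integral lborel (\<lambda>u. (y / pi) * (1 / ((u - x)\<^sup>2 + y\<^sup>2))) ((y / pi) * (pi / y))"
      by (intro has_bochner_integral_mult_right has_bochner_integral_poisson_kernel y)
    then have "has_bochner_integral lborel (\<lambda>u. ?k u x) 1" using y by (simp add: power2_commute)
    then have "(\<integral>\<^sup>+u. ennreal (?k u x) \<partial>lborel) = 1"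
      using nn_integral_eq_integral[of lborel "\<lambda>u. ?k u x"] k0 by (simp add: has_bochner_integral_iff)
    then show "(\<integral>\<^sup>+u. ennreal ((cmod (f x))\<^sup>2 * ?k u x) \<partial>lborel) = ennreal ((cmod (f x))\<^sup>2)"
      by (subst ennreal_mult) (use k0 in \<open>auto simp: nn_integral_cmult\<close>)
  qed
  also have "\<dots> = ennreal ((l2norm f)\<^sup>2)"
    unfolding l2norm_sq by (rule nn_integral_eq_integral) (use sq_intD(2)[OF f] in simp_all)
  finally have le: "(\<integral>\<^sup>+u. ennreal ((cmod (poisson f y u))\<^sup>2) \<partial>lborel) \<le> ennreal ((l2norm f)\<^sup>2)" .
  have i: "integrable lborel (\<lambda>u. (cmod (poisson f y u))\<^sup>2)"
  proof (rule integrableI_bounded)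
    show "(\<integral>\<^sup>+u. ennreal (norm ((cmod (poisson f y u))\<^sup>2)) \<partial>lborel) < \<infinity>"
      using le_less_trans[OF le ennreal_less_top] by simp
  qed measurable
  then show "sq_int (poisson f y)" by (simp add: sq_int_def)
  have "ennreal ((l2norm (poisson f y))\<^sup>2) \<le> ennreal ((l2norm f)\<^sup>2)"
    using le nn_integral_eq_integral[OF i] by (simp add: l2norm_sq)
  then have "(l2norm (poisson f y))\<^sup>2 \<le> (l2norm f)\<^sup>2" by (simp add: ennreal_le_iff)
  then show "l2norm (poisson f y) \<le> l2norm f" by (rule power2_le_imp_le) simp
qed

text \<open>A removable singularity. It serves to cancel a simple pole, both in the Poisson formula
  and when dividing by \<open>cayley\<close>.\<close>

lemma holomorphic_divided_difference:
  assumes "f holomorphic_on S" "open S"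
  shows "(\<lambda>z. if z = w then deriv f w else (f z - f w) / (z - w)) holomorphic_on S"
proof (cases "w \<in> S")
  case True
  have d: "deriv (\<lambda>z. f z - f w) w = deriv f w"
  proof -
    have "(f has_field_derivative deriv f w) (at w)"
      using holomorphic_derivI[OF assms True] .
    then have "((\<lambda>z. f z - f w) has_field_derivative deriv f w - 0) (at w)"
      by (intro derivative_intros)
    then show ?thesis by (simp add: DERIV_imp_deriv)
  qed
  show ?thesis
  proof (rule pole_theorem_open_0[where g="\<lambda>z. f z - f w" and a=w])
    show "(\<lambda>z. f z - f w) holomorphic_on S" by (intro holomorphic_intros assms)
  qed (use assms(2) d in auto)
next
  case False
  then have "(\<lambda>z. (f z - f w) / (z - w)) holomorphic_on S"
    by (intro holomorphic_intros assms) auto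
  then show ?thesis by (rule holomorphic_transform) (use False in auto)
qed

text \<open>The kernel \<open>1 / ((x - u)\<^sup>2 + y\<^sup>2)\<close> is \<open>1 / ((z - w) (z - w'))\<close> on the line of height \<open>a\<close>, with
  \<open>w\<close>, \<open>w'\<close> symmetric about that line; subtracting \<open>f w\<close> removes the pole above it.\<close>

lemma poisson_representation:
  assumes hol: "f holomorphic_on {z. Im z > 0}"
    and sq: "\<And>t. t > 0 \<Longrightarrow> sq_int (\<lambda>x. f (Complex x t))"
    and M: "\<And>t. t > 0 \<Longrightarrow> l2norm (\<lambda>x. f (Complex x t)) \<le> M"
    and a: "a > 0" and y: "y > 0"
  shows "f (Complex u (a + y)) = poisson (\<lambda>x. f (Complex x a)) y u"
proof -
  define w where "w = Complex u (a + y)"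
  define w' where "w' = Complex u (a - y)"
  define c where "c = a - min a y / 2"
  have c: "c > 0" "c < a" "c > a - y" "c \<ge> a - y / 2" using a y by (auto simp: c_def min_def)
  define q where "q z = (if z = w then deriv f w else (f z - f w) / (z - w))" for z
  have q: "q holomorphic_on {z. Im z > 0}"
    unfolding q_def by (rule holomorphic_divided_difference[OF hol open_Im_gt])
  \<comment> \<open>Inside this disc the quotient \<open>q\<close> is bounded by compactness;
    outside it z - w is bounded below. The two cases of the estimate for \<open>g\<close> follow
    this split.\<close>
  have sub: "cball w (y / 2) \<subseteq> {z. Im z > 0}"
  proof
    fix z assume "z \<in> cball w (y/2)"
    then have "Im (w - z) \<le> y / 2" using abs_Im_le_cmod[of "w - z"] by (simp add: dist_norm)
    moreover have "Im (w - z) = a + y - Im z" by (simp add: w_def)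
    ultimately show "z \<in> {z. Im z > 0}" using a y by simp
  qed
  have "bounded (q ` cball w (y / 2))"
    using holomorphic_on_imp_continuous_on[OF holomorphic_on_subset[OF q sub]]
    by (intro compact_imp_bounded compact_continuous_image) auto
  then obtain B where B: "B > 0" "\<And>z. z \<in> cball w (y/2) \<Longrightarrow> cmod (q z) \<le> B"
    unfolding bounded_pos by blast
  define g where "g z = q z / (z - w')" for z
  have nz: "z - w' \<noteq> 0" if "Im z > c" for z using that c by (auto simp: w'_def complex_eq_iff)
  have holg: "g holomorphic_on {z. Im z > c}"
    unfolding g_def using nz c by (intro holomorphic_intros holomorphic_on_subset[OF q]) auto
  define k where "k x = 1 / ((x - u)\<^sup>2 + (y / 2)\<^sup>2)" for x
  \<comment> \<open>One summand per case: \<open>B * y\<close> inside the disc, where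
    \<open>k\<close> is at least 2/y^2, and twice |f w| outside, from |f z - f w|.\<close>
  define C where "C = 2 * cmod (f w) + B * y"
  have C: "C \<ge> 0" using B y by (simp add: C_def)
  have y2: "y / 2 > 0" using y by simp
  note kpos = poisson_kernel_bounds[OF y2, of _ u]
  have sk: "sq_int (\<lambda>x. complex_of_real (k x))" unfolding k_def by (rule sq_int_poisson_kernel[OF y2])
  have ik: "integrable lborel k" unfolding k_def by (rule integrable_poisson_kernel[OF y2])
  have bound: "cmod (g (Complex x t)) \<le> (2 * cmod (f (Complex x t)) + C) * k x" if t: "t > c" for x t
  proof -
    let ?z = "Complex x t"
    let ?r = "(x - u)\<^sup>2 + (y / 2)\<^sup>2"
    have r: "?r > 0" using kpos(3) .
    have ty: "t - (a - y) \<ge> y / 2" using t c by linarith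
    have w'1: "?r \<le> (cmod (?z - w'))\<^sup>2"
      unfolding cmod_power2 w'_def using ty y by (auto intro!: add_mono power_mono)
    have w'2: "cmod (?z - w') \<ge> y / 2"
      using abs_Im_le_cmod[of "?z - w'"] ty by (simp add: w'_def)
    show ?thesis
    proof (cases "?z \<in> cball w (y / 2)")
      case True
      have xu: "\<bar>x - u\<bar> \<le> y / 2"
        using True abs_Re_le_cmod[of "w - ?z"] abs_minus_commute[of x u] by (simp add: dist_norm w_def)
      then have "(x - u)\<^sup>2 \<le> (y / 2)\<^sup>2" using y by (metis abs_le_square_iff abs_of_pos y2)
      then have r2: "?r \<le> y\<^sup>2 / 2" by (simp add: power2_eq_square)
      have "cmod (g ?z) = cmod (q ?z) / cmod (?z - w')" by (simp add: g_def norm_divide)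
      also have "\<dots> \<le> B / (y / 2)" using B(1) B(2)[OF True] w'2 y by (intro frac_le) auto
      also have "\<dots> = B * y * (1 / (y\<^sup>2 / 2))" using y by (simp add: power2_eq_square field_simps)
      also have "\<dots> \<le> B * y * k x"
        unfolding k_def using r r2 B y by (intro mult_left_mono divide_left_mono) auto
      also have "\<dots> \<le> (2 * cmod (f ?z) + C) * k x"
        unfolding C_def k_def using kpos(1)[of x] by (intro mult_right_mono) auto
      finally show ?thesis .
    next
      case False
      then have d: "cmod (?z - w) > y / 2" by (simp add: dist_norm norm_minus_commute)
      then have zw: "?z \<noteq> w" using y by auto
      have "(x - u)\<^sup>2 \<le> (cmod (?z - w))\<^sup>2" unfolding cmod_power2 by (simp add: w_def)
      moreover have "(y / 2)\<^sup>2 \<le> (cmod (?z - w))\<^sup>2" using d y by (intro power_mono) auto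
      ultimately have w1: "?r \<le> 2 * (cmod (?z - w))\<^sup>2" by linarith
      \<comment> \<open>The squared distances to \<open>w\<close> and \<open>w'\<close> are at least
        r/2 and r; multiplying and taking roots recovers r up to a constant.\<close>
      have "?r / 2 \<le> cmod (?z - w) * cmod (?z - w')"
      proof (rule power2_le_imp_le)
        have "(?r / 2)\<^sup>2 = (1/2) * ((?r / 2) * ?r)" by (simp add: power2_eq_square)
        also have "\<dots> \<le> (1/2) * ((cmod (?z - w))\<^sup>2 * (cmod (?z - w'))\<^sup>2)"
          using w1 w'1 r by (intro mult_left_mono mult_mono) auto
        also have "\<dots> \<le> (cmod (?z - w) * cmod (?z - w'))\<^sup>2" by (simp add: power_mult_distrib)
        finally show "(?r / 2)\<^sup>2 \<le> (cmod (?z - w) * cmod (?z - w'))\<^sup>2" .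
      qed simp
      have "cmod (g ?z) = cmod (f ?z - f w) / (cmod (?z - w) * cmod (?z - w'))"
        using zw by (simp add: g_def q_def norm_divide norm_mult)
      also have "\<dots> \<le> (cmod (f ?z) + cmod (f w)) / (?r / 2)"
        using \<open>?r / 2 \<le> _\<close> r norm_triangle_ineq4[of "f ?z" "f w"] by (intro frac_le) auto
      also have "\<dots> = (2 * cmod (f ?z) + 2 * cmod (f w)) * k x" by (simp add: k_def)
      also have "\<dots> \<le> (2 * cmod (f ?z) + C) * k x"
        using B y kpos(1)[of x] unfolding C_def k_def by (intro mult_right_mono) auto
      finally show ?thesis .
    qed
  qed
  have k0: "k x \<ge> 0" for x unfolding k_def by (rule kpos(1))
  have ib: "integrable lborel (\<lambda>x. (2 * cmod (f (Complex x t)) + C) * k x)"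
    and Ib: "(LBINT x. (2 * cmod (f (Complex x t)) + C) * k x) \<le> 2 * (M * l2norm (\<lambda>x. of_real (k x))) + C * integral\<^sup>L lborel k"
    if t: "t > c" for t
  proof -
    have t0: "t > 0" using t c by simp
    have i1: "integrable lborel (\<lambda>x. cmod (f (Complex x t)) * k x)"
      using integrable_norm_mult[OF sq[OF t0] sk] k0 by simp
    have e: "(\<lambda>x. (2 * cmod (f (Complex x t)) + C) * k x) = (\<lambda>x. 2 * (cmod (f (Complex x t)) * k x) + C * k x)"
      by (auto simp: algebra_simps)
    show "integrable lborel (\<lambda>x. (2 * cmod (f (Complex x t)) + C) * k x)"
      unfolding e using i1 ik by simp
    have "(LBINT x. cmod (f (Complex x t)) * k x) \<le> l2norm (\<lambda>x. f (Complex x t)) * l2norm (\<lambda>x. of_real (k x))"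
      using cauchy_schwarz_norm[OF sq[OF t0] sk] k0 by simp
    also have "\<dots> \<le> M * l2norm (\<lambda>x. of_real (k x))" by (intro mult_right_mono M t0) simp
    finally show "(LBINT x. (2 * cmod (f (Complex x t)) + C) * k x) \<le> 2 * (M * l2norm (\<lambda>x. of_real (k x))) + C * integral\<^sup>L lborel k"
      unfolding e using i1 ik by simp
  qed
  have ig: "integrable lborel (\<lambda>x. g (Complex x t))" if t: "t > c" for t
  proof (rule Bochner_Integration.integrable_bound[OF ib[OF t]])
    show "(\<lambda>x. g (Complex x t)) \<in> borel_measurable lborel" by (rule borel_measurable_line[OF holg t])
    show "AE x in lborel. norm (g (Complex x t)) \<le> norm ((2 * cmod (f (Complex x t)) + C) * k x)"
      using bound[OF t] k0 C by (intro AE_I2) (simp add: abs_mult)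
  qed
  have "(LBINT x. cmod (g (Complex x t))) \<le> 2 * (M * l2norm (\<lambda>x. of_real (k x))) + C * integral\<^sup>L lborel k" if t: "t > c" for t
  proof -
    have "(LBINT x. cmod (g (Complex x t))) \<le> (LBINT x. (2 * cmod (f (Complex x t)) + C) * k x)"
      by (intro integral_mono integrable_norm ig ib t bound)
    then show ?thesis using Ib[OF t] by linarith
  qed
  from line_integral_zero[OF holg ig this c(2)]
  have zero: "(LBINT x. g (Complex x a)) = 0" by simp
  let ?k = "\<lambda>x. complex_of_real (1 / ((x - u)\<^sup>2 + y\<^sup>2))"
  have ge: "g (Complex x a) = f (Complex x a) * ?k x - f w * ?k x" for x
  proof -
    have ne: "Complex x a \<noteq> w" using y by (simp add: w_def)
    have "(Complex x a - w) * (Complex x a - w') = of_real ((x - u)\<^sup>2 + y\<^sup>2)"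
      by (simp add: w_def w'_def complex_eq_iff power2_eq_square algebra_simps)
    then have "g (Complex x a) = (f (Complex x a) - f w) / of_real ((x - u)\<^sup>2 + y\<^sup>2)"
      using ne by (simp add: g_def q_def)
    then show ?thesis by (simp add: diff_divide_distrib)
  qed
  have i1: "integrable lborel (\<lambda>x. f (Complex x a) * ?k x)" by (rule integrable_poisson[OF sq[OF a] y])
  have i2: "integrable lborel ?k" using integrable_poisson_kernel[OF y, of u] by (rule integrable_of_real)
  have "(LBINT x. ?k x) = of_real (pi / y)"
    using integral_poisson_kernel[OF y, of u] by (simp only: integral_complex_of_real)
  then have "(LBINT x. f (Complex x a) * ?k x) = f w * of_real (pi / y)"
    using zero i1 i2 unfolding ge by (simp del: of_real_divide)
  then show ?thesis using y by (simp add: poisson_def w_def)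
qed

section \<open>Hardy spaces\<close>

text \<open>Exposes the extension that \<open>hardy2\<close> hides behind a quantifier, so that it
  can be related to its boundary values. Only the upper half-plane is treated; the lower one is
  reached by conjugation.\<close>

definition hardy_ext :: "(real \<Rightarrow> complex) \<Rightarrow> (complex \<Rightarrow> complex) \<Rightarrow> bool" where
  "hardy_ext f F \<longleftrightarrow> F holomorphic_on {z. Im z > 0} \<and>
     (\<exists>M. \<forall>y>0. sq_int (\<lambda>x. F (Complex x y)) \<and> l2norm (\<lambda>x. F (Complex x y)) \<le> M) \<and>
     ((\<lambda>y. l2norm (\<lambda>x. F (Complex x y) - f x)) \<longlongrightarrow> 0) (at_right 0)"

lemma H2_iff: "f \<in> H2 \<longleftrightarrow> sq_int f \<and> (\<exists>F. hardy_ext f F)"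
  unfolding hardy2_def hardy_ext_def by auto

lemma hardy_extD:
  assumes "hardy_ext f F"
  shows "F holomorphic_on {z. Im z > 0}" "y > 0 \<Longrightarrow> sq_int (\<lambda>x. F (Complex x y))"
    "((\<lambda>y. l2norm (\<lambda>x. F (Complex x y) - f x)) \<longlongrightarrow> 0) (at_right 0)"
  using assms by (auto simp: hardy_ext_def)

lemma eventually_at_right_pos: "eventually (\<lambda>y. y > 0) (at_right (0::real))"
  by (rule eventually_at_right_less)

text \<open>\<open>poisson_representation\<close> takes its data from a line strictly inside the
  half-plane; here that line sinks to the axis. One side converges by continuity of
  \<open>F\<close>, the other by L2 convergence and \<open>poisson_pointwise_le\<close>. In
  particular \<open>f\<close> determines \<open>F\<close>.\<close>

lemma hardy_ext_poisson:
  assumes F: "hardy_ext f F" and f: "sq_int f" and y: "y > 0"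
  shows "F (Complex u y) = poisson f y u"
proof -
  note hol = hardy_extD(1)[OF F] and sq = hardy_extD(2)[OF F] and lim = hardy_extD(3)[OF F]
  obtain M where M: "\<And>t. t > 0 \<Longrightarrow> l2norm (\<lambda>x. F (Complex x t)) \<le> M"
    using F by (auto simp: hardy_ext_def)
  have rep: "F (Complex u (a + y)) = poisson (\<lambda>x. F (Complex x a)) y u" if "a > 0" for a
    by (rule poisson_representation[OF hol sq M that y])
  have "((\<lambda>a. F (Complex u (a + y))) \<longlongrightarrow> F (Complex u y)) (at_right 0)"
  proof -
    have "isCont F (Complex u y)"
      using holomorphic_on_imp_continuous_on[OF hol] y
      by (simp add: continuous_on_eq_continuous_at open_Im_gt)
    moreover have "((\<lambda>a. Complex u (a + y)) \<longlongrightarrow> Complex u (0 + y)) (at_right 0)"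
      unfolding Complex_eq by (intro tendsto_intros)
    ultimately show ?thesis using isCont_tendsto_compose by fastforce
  qed
  moreover have "((\<lambda>a. F (Complex u (a + y))) \<longlongrightarrow> poisson f y u) (at_right 0)"
  proof (rule Lim_transform2)
    show "((\<lambda>a. poisson f y u) \<longlongrightarrow> poisson f y u) (at_right 0)" by simp
    show "((\<lambda>a. poisson f y u - F (Complex u (a + y))) \<longlongrightarrow> 0) (at_right 0)"
    proof (rule Lim_null_comparison)
      show "((\<lambda>a. l2norm (\<lambda>x. F (Complex x a) - f x) / sqrt (pi * y)) \<longlongrightarrow> 0) (at_right 0)"
        using tendsto_divide[OF lim tendsto_const, of "sqrt (pi * y)"] y by simp
      show "eventually (\<lambda>a. norm (poisson f y u - F (Complex u (a + y))) \<le> l2norm (\<lambda>x. F (Complex x a) - f x) / sqrt (pi * y)) (at_right 0)"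
        using eventually_at_right_pos
      proof eventually_elim
        case (elim a)
        have "norm (poisson f y u - F (Complex u (a + y))) = cmod (poisson (\<lambda>x. F (Complex x a) - f x) y u)"
          unfolding rep[OF elim] poisson_diff[OF sq[OF elim] f y] by (rule norm_minus_commute)
        also have "\<dots> \<le> l2norm (\<lambda>x. F (Complex x a) - f x) / sqrt (pi * y)"
          by (rule poisson_pointwise_le[OF sq_int_diff[OF sq[OF elim] f] y])
        finally show ?case .
      qed
    qed
  qed
  ultimately show ?thesis by (rule tendsto_unique[rotated]) simp
qed

text \<open>Replaces the anonymous bound M of the definition by the norm of the boundary
  values.\<close>

lemma hardy_ext_contraction:
  assumes F: "hardy_ext f F" and f: "sq_int f" and y: "y > 0"
  shows "l2norm (\<lambda>x. F (Complex x y)) \<le> l2norm f"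
  using poisson_contraction(2)[OF f y] unfolding hardy_ext_poisson[OF assms] .

lemma hardy_ext_add:
  assumes "hardy_ext f F" "hardy_ext g G" "sq_int f" "sq_int g"
  shows "hardy_ext (\<lambda>x. f x + g x) (\<lambda>z. F z + G z)"
  unfolding hardy_ext_def
proof (intro conjI)
  show "(\<lambda>z. F z + G z) holomorphic_on {z. Im z > 0}"
    by (intro holomorphic_intros hardy_extD(1)[OF assms(1)] hardy_extD(1)[OF assms(2)])
  have sF: "sq_int (\<lambda>x. F (Complex x y))" "sq_int (\<lambda>x. G (Complex x y))" if "y > 0" for y
    using hardy_extD(2)[OF assms(1) that] hardy_extD(2)[OF assms(2) that] .
  have "l2norm (\<lambda>x. F (Complex x y) + G (Complex x y)) \<le> l2norm f + l2norm g" if "y > 0" for y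
    using l2norm_triangle[OF sF[OF that]] hardy_ext_contraction[OF assms(1,3) that]
      hardy_ext_contraction[OF assms(2,4) that] by linarith
  then show "\<exists>M. \<forall>y>0. sq_int (\<lambda>x. F (Complex x y) + G (Complex x y)) \<and>
      l2norm (\<lambda>x. F (Complex x y) + G (Complex x y)) \<le> M"
    using sq_int_add[OF sF] by blast
  show "((\<lambda>y. l2norm (\<lambda>x. F (Complex x y) + G (Complex x y) - (f x + g x))) \<longlongrightarrow> 0) (at_right 0)"
  proof (rule Lim_null_comparison)
    show "((\<lambda>y. l2norm (\<lambda>x. F (Complex x y) - f x) + l2norm (\<lambda>x. G (Complex x y) - g x)) \<longlongrightarrow> 0) (at_right 0)"
      using tendsto_add[OF hardy_extD(3)[OF assms(1)] hardy_extD(3)[OF assms(2)]] by simp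
    show "eventually (\<lambda>y. norm (l2norm (\<lambda>x. F (Complex x y) + G (Complex x y) - (f x + g x))) \<le>
        l2norm (\<lambda>x. F (Complex x y) - f x) + l2norm (\<lambda>x. G (Complex x y) - g x)) (at_right 0)"
      using eventually_at_right_pos
    proof eventually_elim
      case (elim y)
      show ?case
        using l2norm_triangle[OF sq_int_diff[OF sF(1)[OF elim] assms(3)] sq_int_diff[OF sF(2)[OF elim] assms(4)]]
        by (simp add: algebra_simps)
    qed
  qed
qed

lemma H2_sq_int: "f \<in> H2 \<Longrightarrow> sq_int f"
  by (simp add: H2_iff)

lemma H2_add: "f \<in> H2 \<Longrightarrow> g \<in> H2 \<Longrightarrow> (\<lambda>x. f x + g x) \<in> H2"
  unfolding H2_iff using hardy_ext_add sq_int_add by blast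

lemma H2_cmult:
  assumes "f \<in> H2"
  shows "(\<lambda>x. c * f x) \<in> H2"
proof -
  obtain F where F: "hardy_ext f F" and f: "sq_int f" using assms by (auto simp: H2_iff)
  have "hardy_ext (\<lambda>x. c * f x) (\<lambda>z. c * F z)"
    unfolding hardy_ext_def
  proof (intro conjI)
    show "(\<lambda>z. c * F z) holomorphic_on {z. Im z > 0}" by (intro holomorphic_intros hardy_extD(1)[OF F])
    have "l2norm (\<lambda>x. c * F (Complex x y)) \<le> cmod c * l2norm f" if "y > 0" for y
      unfolding l2norm_cmult by (intro mult_left_mono hardy_ext_contraction[OF F f that]) simp
    then show "\<exists>M. \<forall>y>0. sq_int (\<lambda>x. c * F (Complex x y)) \<and> l2norm (\<lambda>x. c * F (Complex x y)) \<le> M"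
      using sq_int_cmult[OF hardy_extD(2)[OF F]] by blast
    show "((\<lambda>y. l2norm (\<lambda>x. c * F (Complex x y) - c * f x)) \<longlongrightarrow> 0) (at_right 0)"
      unfolding right_diff_distrib[symmetric] l2norm_cmult
      using tendsto_mult[OF tendsto_const hardy_extD(3)[OF F]] by simp
  qed
  then show ?thesis using sq_int_cmult[OF f] by (auto simp: H2_iff)
qed

lemma H2_diff: "f \<in> H2 \<Longrightarrow> g \<in> H2 \<Longrightarrow> (\<lambda>x. f x - g x) \<in> H2"
  using H2_add[of f "\<lambda>x. -1 * g x"] H2_cmult[of g "-1"] by simp

lemma H2_zero: "(\<lambda>x. 0) \<in> H2"
  unfolding H2_iff hardy_ext_def by (auto intro!: exI[of _ "\<lambda>z. 0"] simp: sq_int_zero)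

text \<open>The only candidate for the extension is the Poisson integral of the limit. It is
  holomorphic as a locally uniform limit, bounded on lines by \<open>poisson_contraction\<close>,
  and attains its boundary values by a three-term estimate through one \<open>fn n\<close>.\<close>

lemma H2_closed:
  assumes fn: "\<And>n. fn n \<in> H2" and f: "sq_int f"
    and lim: "(\<lambda>n. l2norm (\<lambda>x. fn n x - f x)) \<longlonglongrightarrow> 0"
  shows "f \<in> H2"
proof -
  obtain Fn where Fn: "\<And>n. hardy_ext (fn n) (Fn n)" using fn unfolding H2_iff by metis
  have sn: "sq_int (fn n)" for n using fn by (simp add: H2_iff)
  define F where "F z = poisson f (Im z) (Re z)" for z
  have diff: "Fn n z - F z = poisson (\<lambda>x. fn n x - f x) (Im z) (Re z)" if "Im z > 0" for n z
    using hardy_ext_poisson[OF Fn sn that, of n "Re z"] poisson_diff[OF sn f that] by (simp add: F_def)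
  have ptw: "cmod (Fn n z - F z) \<le> l2norm (\<lambda>x. fn n x - f x) / sqrt (pi * Im z)" if "Im z > 0" for n z
    unfolding diff[OF that] by (rule poisson_pointwise_le[OF sq_int_diff[OF sn f] that])
  have "F holomorphic_on {z. Im z > 0}"
  proof (rule holomorphic_uniform_sequence[OF open_Im_gt hardy_extD(1)[OF Fn]])
    fix z assume "z \<in> {z. Im z > 0}"
    then have z: "Im z > 0" by simp
    \<comment> \<open>Heights on this disc are bounded below, which makes the pointwise Poisson
      bound uniform.\<close>
    have sub: "Im w \<ge> Im z / 2" if "w \<in> cball z (Im z / 2)" for w
    proof -
      have "Im (z - w) \<le> Im z / 2" using that abs_Im_le_cmod[of "z - w"] by (simp add: dist_norm)
      then show ?thesis by simp
    qed
    have "uniform_limit (cball z (Im z / 2)) Fn F sequentially"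
    proof (rule uniform_limitI)
      fix e :: real assume e: "e > 0"
      have "(\<lambda>n. l2norm (\<lambda>x. fn n x - f x) / sqrt (pi * (Im z / 2))) \<longlonglongrightarrow> 0"
        using tendsto_divide[OF lim tendsto_const, of "sqrt (pi * (Im z / 2))"] z by simp
      then have "eventually (\<lambda>n. l2norm (\<lambda>x. fn n x - f x) / sqrt (pi * (Im z / 2)) < e) sequentially"
        using e by (rule order_tendstoD)
      then show "eventually (\<lambda>n. \<forall>w\<in>cball z (Im z / 2). dist (Fn n w) (F w) < e) sequentially"
      proof eventually_elim
        case (elim n)
        show ?case
        proof
          fix w assume w: "w \<in> cball z (Im z / 2)"
          have w2: "Im w \<ge> Im z / 2" by (rule sub[OF w])
          then have w0: "Im w > 0" using z by simp
          have "dist (Fn n w) (F w) \<le> l2norm (\<lambda>x. fn n x - f x) / sqrt (pi * Im w)"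
            unfolding dist_norm by (rule ptw[OF w0])
          also have "\<dots> \<le> l2norm (\<lambda>x. fn n x - f x) / sqrt (pi * (Im z / 2))"
            using z w2 by (intro divide_left_mono real_sqrt_le_mono mult_left_mono mult_pos_pos) auto
          finally show "dist (Fn n w) (F w) < e" using elim by simp
        qed
      qed
    qed
    then show "\<exists>d>0. cball z d \<subseteq> {z. Im z > 0} \<and> uniform_limit (cball z d) Fn F sequentially"
      using z sub by (intro exI[of _ "Im z / 2"]) force
  qed
  moreover have Fp: "(\<lambda>x. F (Complex x y)) = poisson f y" for y by (auto simp: F_def)
  moreover have "\<exists>M. \<forall>y>0. sq_int (\<lambda>x. F (Complex x y)) \<and> l2norm (\<lambda>x. F (Complex x y)) \<le> M"
    unfolding Fp using poisson_contraction[OF f] by blast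
  moreover have "((\<lambda>y. l2norm (\<lambda>x. F (Complex x y) - f x)) \<longlongrightarrow> 0) (at_right 0)"
  proof (rule tendstoI)
    fix e :: real assume e: "e > 0"
    obtain n where n: "l2norm (\<lambda>x. fn n x - f x) < e / 4"
      using order_tendstoD(2)[OF lim, of "e/4"] e by (auto simp: eventually_sequentially)
    have "eventually (\<lambda>y. l2norm (\<lambda>x. Fn n (Complex x y) - fn n x) < e / 4) (at_right 0)"
      using order_tendstoD(2)[OF hardy_extD(3)[OF Fn], of "e/4" n] e by simp
    then show "eventually (\<lambda>y. dist (l2norm (\<lambda>x. F (Complex x y) - f x)) 0 < e) (at_right 0)"
      using eventually_at_right_pos
    proof eventually_elim
      case (elim y)
      have sF: "sq_int (\<lambda>x. F (Complex x y))" unfolding Fp using poisson_contraction(1)[OF f elim(2)] .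
      have sFn: "sq_int (\<lambda>x. Fn n (Complex x y))" by (rule hardy_extD(2)[OF Fn elim(2)])
      have "l2norm (\<lambda>x. Fn n (Complex x y) - F (Complex x y)) = l2norm (poisson (\<lambda>x. fn n x - f x) y)"
        using diff[of "Complex _ y"] elim(2) by simp
      also have "\<dots> \<le> l2norm (\<lambda>x. fn n x - f x)"
        by (rule poisson_contraction(2)[OF sq_int_diff[OF sn f] elim(2)])
      finally have 1: "l2norm (\<lambda>x. F (Complex x y) - Fn n (Complex x y)) \<le> l2norm (\<lambda>x. fn n x - f x)"
        by (simp add: l2norm_minus_commute)
      have "l2norm (\<lambda>x. F (Complex x y) - f x) \<le> l2norm (\<lambda>x. F (Complex x y) - Fn n (Complex x y)) +
          (l2norm (\<lambda>x. Fn n (Complex x y) - fn n x) + l2norm (\<lambda>x. fn n x - f x))"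
        using l2norm_triangle_diff[OF sF sFn f] l2norm_triangle_diff[OF sFn sn[of n] f] by linarith
      then show ?case using 1 n elim e by simp
    qed
  qed
  ultimately show ?thesis using f unfolding H2_iff hardy_ext_def by blast
qed

section \<open>Bounded multipliers and the lower half-plane\<close>

text \<open>m F - q f = m (F - f) + (m - q) f: the bound on m handles the first term, dominated
  convergence the second. The bound is asked only near the axis, because the multiplier in
  \<open>H2_div_cayley\<close> has a pole at \<open>\<i>\<close>.\<close>

lemma tendsto_l2_bounded_mult:
  fixes b :: real
  assumes f: "sq_int f" and F: "\<And>y. y > 0 \<Longrightarrow> sq_int (F y)"
    and lim: "((\<lambda>y. l2norm (\<lambda>x. F y x - f x)) \<longlongrightarrow> 0) (at_right 0)"
    and m: "\<And>y. y > 0 \<Longrightarrow> m y \<in> borel_measurable lborel"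
    and q [measurable]: "q \<in> borel_measurable lborel"
    and b: "b > 0" "\<And>y x. 0 < y \<Longrightarrow> y < b \<Longrightarrow> cmod (m y x) \<le> B"
    and mq: "AE x in lborel. ((\<lambda>y. m y x) \<longlongrightarrow> q x) (at_right 0)"
  shows "sq_int (\<lambda>x. q x * f x)"
    "((\<lambda>y. l2norm (\<lambda>x. m y x * F y x - q x * f x)) \<longlongrightarrow> 0) (at_right 0)"
proof -
  note [measurable] = sq_intD(1)[OF f]
  have B: "B \<ge> 0" using order_trans[OF norm_ge_zero b(2)[of "b/2" 0]] b(1) by simp
  have ev: "eventually (\<lambda>y. 0 < y \<and> y < b) (at_right 0)"
    using b(1) by (intro eventually_at_rightI[of 0 b]) auto
  have qB: "AE x in lborel. cmod (q x) \<le> B"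
    using mq
  proof eventually_elim
    case (elim x)
    show ?case
    proof (rule tendsto_upperbound[OF tendsto_norm[OF elim]])
      show "eventually (\<lambda>y. norm (m y x) \<le> B) (at_right 0)"
        using ev by eventually_elim (use b(2) in auto)
    qed simp
  qed
  show sqf: "sq_int (\<lambda>x. q x * f x)"
    by (rule sq_int_bound[OF f, where C=B]) (use qB in \<open>auto simp: norm_mult mult_right_mono\<close>)
  show "((\<lambda>y. l2norm (\<lambda>x. m y x * F y x - q x * f x)) \<longlongrightarrow> 0) (at_right 0)"
  \<comment> \<open>The limit is tested along sequences, where dominated convergence
    applies.\<close>
  proof (rule tendsto_at_right_sequentially[OF b(1)])
    fix S assume S: "\<And>n. 0 < S n" "\<And>n. S n < b" "decseq S" "S \<longlonglongrightarrow> (0::real)"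
    have Sr: "filterlim S (at_right 0) sequentially"
    proof -
      have "S n \<noteq> 0" for n using S(1)[of n] by simp
      then show ?thesis using S(1,4) by (auto simp: filterlim_at intro!: always_eventually)
    qed
    note [measurable] = m[OF S(1)] sq_intD(1)[OF F[OF S(1)]]
    have sm: "sq_int (\<lambda>x. m (S n) x * (F (S n) x - f x))" for n
      by (rule sq_int_bound[OF sq_int_diff[OF F[OF S(1)[of n]] f], where C=B])
        (use b(2)[OF S(1,2)] in \<open>auto simp: norm_mult mult_right_mono\<close>)
    have le1: "l2norm (\<lambda>x. m (S n) x * (F (S n) x - f x)) \<le> B * l2norm (\<lambda>x. F (S n) x - f x)" for n
      by (rule l2norm_bound_AE[OF sq_int_diff[OF F[OF S(1)[of n]] f]])
        (use b(2)[OF S(1,2)] B in \<open>auto simp: norm_mult mult_right_mono\<close>)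
    have bd: "AE x in lborel. cmod ((m (S n) x - q x) * f x) \<le> (2 * B) * cmod (f x)" for n
      using qB
    proof eventually_elim
      case (elim x)
      have "cmod (m (S n) x - q x) \<le> 2 * B"
        using norm_triangle_ineq4[of "m (S n) x" "q x"] b(2)[OF S(1,2), of n x] elim by linarith
      then show ?case unfolding norm_mult by (rule mult_right_mono) simp
    qed
    have sd: "sq_int (\<lambda>x. (m (S n) x - q x) * f x)" for n
      by (rule sq_int_bound[OF f _ bd]) measurable
    have "(\<lambda>n. LBINT x. (cmod ((m (S n) x - q x) * f x))\<^sup>2) \<longlonglongrightarrow> (\<integral>x. (0::real) \<partial>(lborel :: real measure))"
    proof (rule integral_dominated_convergence[where w="\<lambda>x. ((2 * B) * cmod (f x))\<^sup>2"])
      show "integrable lborel (\<lambda>x. ((2 * B) * cmod (f x))\<^sup>2)"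
        using sq_intD(2)[OF f] by (simp add: power_mult_distrib)
      show "AE x in lborel. (\<lambda>n. (cmod ((m (S n) x - q x) * f x))\<^sup>2) \<longlonglongrightarrow> 0"
        using mq
      proof eventually_elim
        case (elim x)
        have "(\<lambda>n. (cmod ((m (S n) x - q x) * f x))\<^sup>2) \<longlonglongrightarrow> (cmod ((q x - q x) * f x))\<^sup>2"
          by (intro tendsto_intros filterlim_compose[OF elim Sr])
        then show ?case by simp
      qed
      show "AE x in lborel. norm ((cmod ((m (S n) x - q x) * f x))\<^sup>2) \<le> ((2 * B) * cmod (f x))\<^sup>2" for n
        using bd[of n] by eventually_elim (simp add: power_mono)
    qed measurable
    then have "(\<lambda>n. sqrt (LBINT x. (cmod ((m (S n) x - q x) * f x))\<^sup>2)) \<longlonglongrightarrow> sqrt 0"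
      by (intro tendsto_real_sqrt) simp
    then have l2: "(\<lambda>n. l2norm (\<lambda>x. (m (S n) x - q x) * f x)) \<longlonglongrightarrow> 0" by (simp add: l2norm_def)
    show "(\<lambda>n. l2norm (\<lambda>x. m (S n) x * F (S n) x - q x * f x)) \<longlonglongrightarrow> 0"
    proof (rule Lim_null_comparison)
      show "(\<lambda>n. B * l2norm (\<lambda>x. F (S n) x - f x) + l2norm (\<lambda>x. (m (S n) x - q x) * f x)) \<longlonglongrightarrow> 0"
        using tendsto_add[OF tendsto_mult[OF tendsto_const filterlim_compose[OF lim Sr], of B] l2] by simp
      have "l2norm (\<lambda>x. m (S n) x * F (S n) x - q x * f x) \<le>
          B * l2norm (\<lambda>x. F (S n) x - f x) + l2norm (\<lambda>x. (m (S n) x - q x) * f x)" for n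
      proof -
        have "(\<lambda>x. m (S n) x * F (S n) x - q x * f x) = (\<lambda>x. m (S n) x * (F (S n) x - f x) + (m (S n) x - q x) * f x)"
          by (auto simp: algebra_simps)
        then show ?thesis using l2norm_triangle[OF sm[of n] sd[of n]] le1[of n] by simp
      qed
      then show "eventually (\<lambda>n. norm (l2norm (\<lambda>x. m (S n) x * F (S n) x - q x * f x)) \<le>
          B * l2norm (\<lambda>x. F (S n) x - f x) + l2norm (\<lambda>x. (m (S n) x - q x) * f x)) sequentially"
        by (intro always_eventually) simp
    qed
  qed
qed

text \<open>Stated for an arbitrary bounded holomorphic \<open>Q\<close>, since it serves both the
  \<open>Hinf\<close> part of the symbol and polynomials in \<open>cayley\<close>.\<close>

lemma H2_mult_bounded:
  assumes f: "f \<in> H2" and Q: "Q holomorphic_on {z. Im z > 0}" "\<And>z. Im z > 0 \<Longrightarrow> cmod (Q z) \<le> B"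
    and q: "q \<in> borel_measurable lborel" "AE x in lborel. ((\<lambda>y. Q (Complex x y)) \<longlongrightarrow> q x) (at_right 0)"
  shows "(\<lambda>x. q x * f x) \<in> H2"
proof -
  obtain F where F: "hardy_ext f F" and sf: "sq_int f" using f by (auto simp: H2_iff)
  note sF = hardy_extD(2)[OF F]
  have B: "B \<ge> 0" using order_trans[OF norm_ge_zero Q(2)[of \<i>]] by simp
  have Qm: "(\<lambda>x. Q (Complex x y)) \<in> borel_measurable lborel" if "y > 0" for y
    by (rule borel_measurable_line[OF Q(1) that])
  have Qb: "cmod (Q (Complex x y)) \<le> B" if "y > 0" for x y using Q(2) that by simp
  note lim = tendsto_l2_bounded_mult[where m="\<lambda>y x. Q (Complex x y)", OF sf sF hardy_extD(3)[OF F] Qm q(1) zero_less_one Qb q(2)]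
  have "hardy_ext (\<lambda>x. q x * f x) (\<lambda>z. Q z * F z)"
    unfolding hardy_ext_def
  proof (intro conjI)
    show "(\<lambda>z. Q z * F z) holomorphic_on {z. Im z > 0}"
      by (intro holomorphic_intros Q hardy_extD(1)[OF F])
    have "sq_int (\<lambda>x. Q (Complex x y) * F (Complex x y)) \<and>
        l2norm (\<lambda>x. Q (Complex x y) * F (Complex x y)) \<le> B * l2norm f" if y: "y > 0" for y
    proof -
      note [measurable] = Qm[OF y] sq_intD(1)[OF sF[OF y]]
      have b: "AE x in lborel. cmod (Q (Complex x y) * F (Complex x y)) \<le> B * cmod (F (Complex x y))"
        using Qb[OF y] by (auto simp: norm_mult mult_right_mono)
      have ms: "(\<lambda>x. Q (Complex x y) * F (Complex x y)) \<in> borel_measurable lborel" by measurable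
      have "l2norm (\<lambda>x. Q (Complex x y) * F (Complex x y)) \<le> B * l2norm (\<lambda>x. F (Complex x y))"
        by (rule l2norm_bound_AE[OF sF[OF y] ms b B])
      also have "\<dots> \<le> B * l2norm f" by (intro mult_left_mono hardy_ext_contraction[OF F sf y] B)
      finally show ?thesis using sq_int_bound[OF sF[OF y] ms b] by blast
    qed
    then show "\<exists>M. \<forall>y>0. sq_int (\<lambda>x. Q (Complex x y) * F (Complex x y)) \<and>
        l2norm (\<lambda>x. Q (Complex x y) * F (Complex x y)) \<le> M" by blast
  qed (rule lim(2))
  then show ?thesis using lim(1) by (auto simp: H2_iff)
qed

lemma H2_mult_Hinf:
  assumes "h \<in> Hinf" "f \<in> H2"
  shows "(\<lambda>x. h x * f x) \<in> H2"
proof -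
  obtain F M where "F holomorphic_on {z. Im z > 0}" "\<And>z. Im z > 0 \<Longrightarrow> cmod (F z) \<le> M"
    "AE x in lborel. ((\<lambda>y. F (Complex x y)) \<longlongrightarrow> h x) (at_right 0)" "h \<in> borel_measurable lborel"
    using assms(1) unfolding Hinf_def Linf_def by blast
  then show ?thesis by (intro H2_mult_bounded[OF assms(2)])
qed

text \<open>Passing from F to \<open>cnj \<circ> F \<circ> cnj\<close> exchanges the half-planes, so
  the facts on \<open>H2minus\<close> below are inherited from \<open>H2\<close>.\<close>

lemma H2minus_iff: "k \<in> H2minus \<longleftrightarrow> (\<lambda>x. cnj (k x)) \<in> H2"
proof -
  have cc: "cnj (Complex x y) = Complex x (- y)" for x y by (simp add: complex_eq_iff)
  have sqc: "sq_int (\<lambda>x. cnj (g x)) \<longleftrightarrow> sq_int g" for g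
    using sq_int_cnj[of g] sq_int_cnj[of "\<lambda>x. cnj (g x)"] by auto
  have nd: "l2norm (\<lambda>x. cnj (g x) - cnj (h x)) = l2norm (\<lambda>x. g x - h x)" for g h
    using l2norm_cnj[of "\<lambda>x. g x - h x"] by simp
  show ?thesis
  proof
    assume "k \<in> H2minus"
    then obtain F M where F: "sq_int k" "F holomorphic_on {z. - Im z > 0}"
      "\<And>y. y > 0 \<Longrightarrow> sq_int (\<lambda>x. F (Complex x (- y))) \<and> l2norm (\<lambda>x. F (Complex x (- y))) \<le> M"
      "((\<lambda>y. l2norm (\<lambda>x. F (Complex x (- y)) - k x)) \<longlongrightarrow> 0) (at_right 0)"
      unfolding hardy2_def by auto
    have "(cnj \<circ> F \<circ> cnj) holomorphic_on {z. Im z > 0}"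
      by (rule holomorphic_on_compose_cnj_cnj) (rule holomorphic_on_subset[OF F(2)], auto intro: open_Im_gt)
    then have "hardy_ext (\<lambda>x. cnj (k x)) (\<lambda>z. cnj (F (cnj z)))"
      unfolding hardy_ext_def cc sqc nd l2norm_cnj using F(3,4) by (auto simp: o_def)
    then show "(\<lambda>x. cnj (k x)) \<in> H2" using F(1) by (auto simp: H2_iff sqc)
  next
    assume "(\<lambda>x. cnj (k x)) \<in> H2"
    then obtain F where F: "hardy_ext (\<lambda>x. cnj (k x)) F" "sq_int k" by (auto simp: H2_iff sqc)
    have "(cnj \<circ> F \<circ> cnj) holomorphic_on {z. - Im z > 0}"
      by (rule holomorphic_on_compose_cnj_cnj) (rule holomorphic_on_subset[OF hardy_extD(1)[OF F(1)]], auto simp: open_halfspace_Im_lt)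
    moreover obtain M where "\<And>y. y > 0 \<Longrightarrow> sq_int (\<lambda>x. F (Complex x y)) \<and> l2norm (\<lambda>x. F (Complex x y)) \<le> M"
      using F(1) by (auto simp: hardy_ext_def)
    moreover have "((\<lambda>y. l2norm (\<lambda>x. cnj (F (Complex x y)) - k x)) \<longlongrightarrow> 0) (at_right 0)"
      using hardy_extD(3)[OF F(1)] nd[of "\<lambda>x. cnj (F (Complex x _))" k] by simp
    ultimately show "k \<in> H2minus" unfolding hardy2_def
      using F(2) by (auto intro!: exI[of _ "cnj \<circ> F \<circ> cnj"] exI[of _ M] simp: cc sqc)
  qed
qed

lemma H2minus_sq_int: "k \<in> H2minus \<Longrightarrow> sq_int k"
  using sq_int_cnj[of "\<lambda>x. cnj (k x)"] H2_sq_int[of "\<lambda>x. cnj (k x)"] by (simp add: H2minus_iff)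

lemma H2minus_zero: "(\<lambda>x. 0) \<in> H2minus"
  using H2_zero by (simp add: H2minus_iff)

lemma H2minus_add: "f \<in> H2minus \<Longrightarrow> g \<in> H2minus \<Longrightarrow> (\<lambda>x. f x + g x) \<in> H2minus"
  using H2_add[of "\<lambda>x. cnj (f x)" "\<lambda>x. cnj (g x)"] by (simp add: H2minus_iff)

lemma H2minus_diff: "f \<in> H2minus \<Longrightarrow> g \<in> H2minus \<Longrightarrow> (\<lambda>x. f x - g x) \<in> H2minus"
  using H2_diff[of "\<lambda>x. cnj (f x)" "\<lambda>x. cnj (g x)"] by (simp add: H2minus_iff)

lemma H2minus_cmult: "f \<in> H2minus \<Longrightarrow> (\<lambda>x. c * f x) \<in> H2minus"
  using H2_cmult[of "\<lambda>x. cnj (f x)" "cnj c"] by (simp add: H2minus_iff)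

lemma H2minus_closed:
  assumes "\<And>n. fn n \<in> H2minus" "sq_int f" "(\<lambda>n. l2norm (\<lambda>x. fn n x - f x)) \<longlonglongrightarrow> 0"
  shows "f \<in> H2minus"
  unfolding H2minus_iff
proof (rule H2_closed)
  show "(\<lambda>x. cnj (fn n x)) \<in> H2" for n using assms(1) by (simp add: H2minus_iff)
  show "(\<lambda>n. l2norm (\<lambda>x. cnj (fn n x) - cnj (f x))) \<longlonglongrightarrow> 0"
    using assms(3) l2norm_cnj[of "\<lambda>x. fn _ x - f x"] by simp
qed (rule sq_int_cnj[OF assms(2)])

text \<open>The conjugate of k extends to the upper half-plane. On every line the product of the two
  extensions has L1 norm bounded by Cauchy-Schwarz, so \<open>line_integral_zero\<close> applies;
  the identity survives the L2 limit at the axis.\<close>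

lemma H2_orthogonal_H2minus:
  assumes "f \<in> H2" "k \<in> H2minus"
  shows "l2inner f k = 0"
proof -
  define g where "g x = cnj (k x)" for x
  have "g \<in> H2" using assms(2) unfolding g_def H2minus_iff .
  then obtain G where G: "hardy_ext g G" and sg: "sq_int g" by (auto simp: H2_iff)
  obtain F where F: "hardy_ext f F" and sf: "sq_int f" using assms(1) by (auto simp: H2_iff)
  note sF = hardy_extD(2)[OF F] and sG = hardy_extD(2)[OF G]
  have M: "(LBINT x. cmod (F (Complex x y) * G (Complex x y))) \<le> l2norm f * l2norm g" if "y > 0" for y
    using cauchy_schwarz_norm[OF sF[OF that] sG[OF that]]
      mult_mono[OF hardy_ext_contraction[OF F sf that] hardy_ext_contraction[OF G sg that] l2norm_nonneg l2norm_nonneg]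
    by (simp add: norm_mult)
  have hol: "(\<lambda>z. F z * G z) holomorphic_on {z. Im z > 0}"
    by (intro holomorphic_intros hardy_extD(1)[OF F] hardy_extD(1)[OF G])
  have zero: "(LBINT x. F (Complex x y) * G (Complex x y)) = 0" if "y > 0" for y
    by (rule line_integral_zero[OF hol integrable_mult[OF sF sG] M that])
  have "cmod (LBINT x. f x * g x) \<le> 0"
  proof (rule tendsto_lowerbound)
    show "((\<lambda>y. l2norm (\<lambda>x. F (Complex x y) - f x) * l2norm g + l2norm f * l2norm (\<lambda>x. G (Complex x y) - g x)) \<longlongrightarrow> 0) (at_right 0)"
      using tendsto_add[OF tendsto_mult[OF hardy_extD(3)[OF F] tendsto_const] tendsto_mult[OF tendsto_const hardy_extD(3)[OF G]]]
      by simp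
    show "eventually (\<lambda>y. cmod (LBINT x. f x * g x) \<le>
       l2norm (\<lambda>x. F (Complex x y) - f x) * l2norm g + l2norm f * l2norm (\<lambda>x. G (Complex x y) - g x)) (at_right 0)"
      using eventually_at_right_pos
    proof eventually_elim
      case (elim y)
      let ?F = "\<lambda>x. F (Complex x y)" and ?G = "\<lambda>x. G (Complex x y)"
      note dF = sq_int_diff[OF sF[OF elim] sf] and dG = sq_int_diff[OF sG[OF elim] sg]
      have "(LBINT x. ?F x * ?G x - f x * g x) = (LBINT x. (?F x - f x) * ?G x + f x * (?G x - g x))"
        by (intro Bochner_Integration.integral_cong) (auto simp: algebra_simps)
      also have "\<dots> = (LBINT x. (?F x - f x) * ?G x) + (LBINT x. f x * (?G x - g x))"
        by (intro Bochner_Integration.integral_add integrable_mult dF dG sG elim sf)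
      finally have "- (LBINT x. f x * g x) = (LBINT x. (?F x - f x) * ?G x) + (LBINT x. f x * (?G x - g x))"
        using zero[OF elim] integrable_mult[OF sF[OF elim] sG[OF elim]] integrable_mult[OF sf sg] by simp
      then have "cmod (LBINT x. f x * g x) \<le> cmod (LBINT x. (?F x - f x) * ?G x) + cmod (LBINT x. f x * (?G x - g x))"
        using norm_triangle_ineq[of "LBINT x. (?F x - f x) * ?G x" "LBINT x. f x * (?G x - g x)"]
        by (simp flip: norm_minus_cancel[of "LBINT x. f x * g x"])
      also have "\<dots> \<le> l2norm (\<lambda>x. ?F x - f x) * l2norm ?G + l2norm f * l2norm (\<lambda>x. ?G x - g x)"
        by (intro add_mono cauchy_schwarz dF dG sG elim sf)
      also have "\<dots> \<le> l2norm (\<lambda>x. ?F x - f x) * l2norm g + l2norm f * l2norm (\<lambda>x. ?G x - g x)"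
        by (intro add_right_mono mult_left_mono hardy_ext_contraction[OF G sg elim]) simp
      finally show ?case .
    qed
  qed simp
  then show ?thesis by (simp add: l2inner_def g_def)
qed

section \<open>Uniqueness of boundary values\<close>

text \<open>Inner regularity. Closedness will give points off K a positive distance to it, and
  finite measure makes bounded functions integrable over K; the Schwarz transform relies on
  both.\<close>

lemma positive_measure_closed_subset:
  fixes E :: "real set"
  assumes E: "E \<in> sets lborel" "emeasure lborel E > 0"
  obtains K where "closed K" "K \<subseteq> E" "emeasure lborel K > 0" "emeasure lborel K < \<infinity>"
proof -
  have [measurable]: "E \<in> sets borel" using E(1) by simp
  have "\<exists>n::nat. emeasure lborel (E \<inter> {-real n..real n}) > 0"
  proof (rule ccontr)
    assume "\<not> ?thesis"
    then have "E \<inter> {-real n..real n} \<in> null_sets lborel" for n by (auto simp: null_sets_def)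
    then have "(\<Union>n. E \<inter> {-real n..real n}) \<in> null_sets lborel" by (intro null_sets_UN) auto
    moreover have "(\<Union>n. E \<inter> {-real n..real n}) = E"
    proof -
      have "\<exists>n. x \<in> {-real n..real n}" for x
      proof -
        obtain n where "\<bar>x\<bar> \<le> real n" using real_arch_simple by blast
        then show ?thesis by (intro exI[of _ n]) (simp add: abs_le_iff)
      qed
      then show ?thesis by blast
    qed
    ultimately show False using E(2) by (simp add: null_sets_def)
  qed
  then obtain n :: nat where n: "emeasure lborel (E \<inter> {-real n..real n}) > 0" by blast
  define A where "A = E \<inter> {-real n..real n}"
  have A: "A \<in> sets borel" unfolding A_def by measurable
  have "emeasure lborel A \<le> emeasure lborel {-real n..real n}"
    unfolding A_def by (rule emeasure_mono) auto
  then have fin: "emeasure lborel A < \<infinity>" by (rule le_less_trans) simp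
  then have Am: "emeasure lborel A = ennreal (measure lborel A)" by (intro emeasure_eq_ennreal_measure) auto
  have pos: "measure lborel A > 0" using n unfolding A_def[symmetric] Am by simp
  have "A \<in> sets lebesgue" using A by (intro sets_completionI_sets) simp
  then obtain K where K: "closed K" "K \<subseteq> A" "emeasure lebesgue (A - K) < ennreal (measure lborel A)"
    using sets_lebesgue_inner_closed[OF _ pos] by metis
  have Kb [measurable]: "K \<in> sets borel" using K(1) by simp
  have lt: "emeasure lborel (A - K) < emeasure lborel A"
    using K(3) A Kb unfolding Am by (simp add: emeasure_completion)
  have "emeasure lborel K \<noteq> 0"
  proof
    assume "emeasure lborel K = 0"
    then have "emeasure lborel (A - K) = emeasure lborel A"
      using A Kb by (intro emeasure_Diff_null_set) (auto simp: null_sets_def)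
    then show False using lt by simp
  qed
  moreover have "emeasure lborel K < \<infinity>"
    using emeasure_mono[of K A lborel] K(2) A fin by (auto intro: le_less_trans)
  ultimately show ?thesis using K(1,2) by (intro that[of K]) (auto simp: A_def zero_less_iff_neq_zero)
qed

text \<open>The Schwarz transform of \<open>indicator K\<close>; its real part is the harmonic measure of \<open>K\<close>.\<close>

definition schwarz :: "real set \<Rightarrow> complex \<Rightarrow> complex" where
  "schwarz K z = (LBINT t. indicator K t *\<^sub>R (1 / (\<i> * (of_real t - z)))) / of_real pi"

context
  fixes K :: "real set"
  assumes K: "closed K" "emeasure lborel K < \<infinity>"
begin

lemma K_measurable [measurable]: "K \<in> sets borel"
  using K(1) by simp

lemma integrable_indicator_K: "integrable lborel (indicat_real K)"
  using K by (intro integrable_real_indicator) auto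

lemma integrable_indicator_K_mult:
  fixes g :: "real \<Rightarrow> complex"
  assumes [measurable]: "g \<in> borel_measurable lborel" and "\<And>t. cmod (g t) \<le> B"
  shows "integrable lborel (\<lambda>t. indicat_real K t *\<^sub>R g t)"
    "cmod (LBINT t. indicat_real K t *\<^sub>R g t) \<le> B * measure lborel K"
proof -
  have B: "B \<ge> 0" using order_trans[OF norm_ge_zero assms(2)] .
  have i: "integrable lborel (\<lambda>t. B * indicat_real K t)" using integrable_indicator_K by simp
  show j: "integrable lborel (\<lambda>t. indicat_real K t *\<^sub>R g t)"
    by (rule Bochner_Integration.integrable_bound[OF i]) (use assms(2) B in \<open>auto split: split_indicator\<close>)
  have "cmod (LBINT t. indicat_real K t *\<^sub>R g t) \<le> (LBINT t. cmod (indicat_real K t *\<^sub>R g t))"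
    by (rule integral_norm_bound)
  also have "\<dots> \<le> (LBINT t. B * indicat_real K t)"
    by (intro integral_mono i integrable_norm j) (use assms(2) in \<open>auto split: split_indicator\<close>)
  also have "\<dots> = B * measure lborel K" using K(1) by simp
  finally show "cmod (LBINT t. indicat_real K t *\<^sub>R g t) \<le> B * measure lborel K" .
qed

lemma cmod_of_real_diff_ge: "cmod (of_real t - z) \<ge> \<bar>Im z\<bar>"
  using abs_Im_le_cmod[of "of_real t - z"] by simp

text \<open>Differentiation under the integral by direct estimate: the difference quotient minus the
  expected derivative is again an integral over K, of an explicit kernel with a factor h.\<close>

lemma schwarz_holomorphic: "schwarz K holomorphic_on {z. Im z > 0}"
proof -
  let ?I = "\<lambda>z. LBINT t. indicator K t *\<^sub>R (1 / (\<i> * (of_real t - z)))"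
  have "?I field_differentiable at z" if z: "Im z > 0" for z
  proof -
    let ?D = "LBINT t. indicator K t *\<^sub>R (1 / (\<i> * (of_real t - z)\<^sup>2))"
    have ne: "of_real t - w \<noteq> 0" if "Im w > 0" for t w using that by (auto simp: complex_eq_iff)
    have i1: "integrable lborel (\<lambda>t. indicat_real K t *\<^sub>R (1 / (\<i> * (of_real t - w))))" if w: "Im w > 0" for w
    proof (rule integrable_indicator_K_mult(1))
      show "cmod (1 / (\<i> * (of_real t - w))) \<le> 1 / Im w" for t
        using cmod_of_real_diff_ge[of w t] w by (simp add: norm_divide norm_mult frac_le)
    qed measurable
    have i2: "integrable lborel (\<lambda>t. indicat_real K t *\<^sub>R (1 / (\<i> * (of_real t - z)\<^sup>2)))"
    proof (rule integrable_indicator_K_mult(1))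
      show "cmod (1 / (\<i> * (of_real t - z)\<^sup>2)) \<le> 1 / (Im z)\<^sup>2" for t
        using power_mono[OF cmod_of_real_diff_ge[of z t], of 2] z ne[OF z, of t]
        by (simp add: norm_divide norm_mult norm_power divide_left_mono)
    qed measurable
    have "((\<lambda>h. (?I (z + h) - ?I z) / h) \<longlongrightarrow> ?D) (at 0)"
    proof (rule LIM_zero_cancel, rule Lim_null_comparison)
      \<comment> \<open>For |h| < Im z / 2 one has |t - z - h| at least Im z / 2 and |t - z| at
        least Im z; the second enters squared.\<close>
      let ?C = "2 / (Im z) ^ 3 * measure lborel K"
      show "((\<lambda>h. cmod h * ?C) \<longlongrightarrow> 0) (at 0)"
        by (rule tendsto_mult_left_zero, rule tendsto_norm_zero) (rule tendsto_ident_at)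
      have "eventually (\<lambda>h. dist h 0 < Im z / 2 \<and> h \<noteq> 0) (at (0::complex))"
        using z by (auto simp: eventually_at intro!: exI[of _ "Im z / 2"])
      then show "eventually (\<lambda>h. cmod ((?I (z + h) - ?I z) / h - ?D) \<le> cmod h * ?C) (at 0)"
      proof eventually_elim
        case (elim h)
        have h: "\<bar>Im h\<bar> < Im z / 2" using elim abs_Im_le_cmod[of h] by simp
        then have zh: "Im (z + h) \<ge> Im z / 2" "Im (z + h) > 0" using z by auto
        let ?g = "\<lambda>t. h / (\<i> * ((of_real t - (z + h)) * (of_real t - z)\<^sup>2))"
        have bd: "cmod (?g t) \<le> cmod h * (2 / (Im z) ^ 3)" for t
        proof -
          have a: "cmod (of_real t - z) \<ge> Im z" using cmod_of_real_diff_ge[of z t] z by simp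
          have b: "cmod (of_real t - (z + h)) \<ge> Im z / 2" using cmod_of_real_diff_ge[of "z + h" t] zh by simp
          have "(Im z) ^ 3 / 2 = (Im z / 2) * (Im z)\<^sup>2" by (simp add: power3_eq_cube power2_eq_square)
          also have "\<dots> \<le> cmod (of_real t - (z + h)) * (cmod (of_real t - z))\<^sup>2"
            using a b z by (intro mult_mono power_mono) auto
          finally have le: "(Im z) ^ 3 / 2 \<le> cmod (of_real t - (z + h)) * (cmod (of_real t - z))\<^sup>2" .
          have "cmod (?g t) = cmod h / (cmod (of_real t - (z + h)) * (cmod (of_real t - z))\<^sup>2)"
            unfolding norm_divide norm_mult norm_power by simp
          also have "\<dots> \<le> cmod h / ((Im z) ^ 3 / 2)"
            using le z by (intro divide_left_mono mult_pos_pos) (auto simp: ne[OF z] ne[OF zh(2)])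
          finally show ?thesis by simp
        qed
        have alg: "(1 / (\<i> * (a - h)) - 1 / (\<i> * a)) / h - 1 / (\<i> * a\<^sup>2) = h / (\<i> * ((a - h) * a\<^sup>2))"
          if "a \<noteq> 0" "a - h \<noteq> 0" for a :: complex
          using that elim by (simp add: divide_simps power2_eq_square)
        have pt: "(1 / (\<i> * (of_real t - (z + h))) - 1 / (\<i> * (of_real t - z))) / h - 1 / (\<i> * (of_real t - z)\<^sup>2) = ?g t" for t
          using alg[of "of_real t - z"] ne[OF z, of t] ne[OF zh(2), of t] by (simp add: diff_diff_eq)
        have "(?I (z + h) - ?I z) / h - ?D =
            (LBINT t. (indicator K t *\<^sub>R (1 / (\<i> * (of_real t - (z + h)))) - indicator K t *\<^sub>R (1 / (\<i> * (of_real t - z)))) / h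
               - indicator K t *\<^sub>R (1 / (\<i> * (of_real t - z)\<^sup>2)))"
          using i1[OF zh(2)] i1[OF z] i2 by simp
        also have "\<dots> = (LBINT t. indicator K t *\<^sub>R ?g t)"
        proof (rule Bochner_Integration.integral_cong[OF refl])
          fix t
          show "(indicator K t *\<^sub>R (1 / (\<i> * (of_real t - (z + h)))) - indicator K t *\<^sub>R (1 / (\<i> * (of_real t - z)))) / h
               - indicator K t *\<^sub>R (1 / (\<i> * (of_real t - z)\<^sup>2)) = indicator K t *\<^sub>R ?g t"
            unfolding pt[of t, symmetric] by (auto split: split_indicator)
        qed
        also have "cmod \<dots> \<le> (cmod h * (2 / (Im z) ^ 3)) * measure lborel K"
          by (rule integrable_indicator_K_mult(2)[OF _ bd]) measurable
        finally show ?case by simp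
      qed
    qed
    then show ?thesis unfolding field_differentiable_def DERIV_def by blast
  qed
  then show ?thesis
    unfolding schwarz_def
    by (intro holomorphic_intros) (auto simp: holomorphic_on_def field_differentiable_at_within)
qed

text \<open>The real part of 1 / (i (t - z)) is y / |t - z|^2, so this is the Poisson integral of
  \<open>indicator K\<close>.\<close>

lemma Re_schwarz:
  assumes y: "y > 0"
  shows "Re (schwarz K (Complex x y)) = y / pi * (LBINT t. indicat_real K t * (1 / ((t - x)\<^sup>2 + y\<^sup>2)))"
proof -
  have i: "integrable lborel (\<lambda>t. indicat_real K t *\<^sub>R (1 / (\<i> * (of_real t - Complex x y))))"
  proof (rule integrable_indicator_K_mult(1))
    show "cmod (1 / (\<i> * (of_real t - Complex x y))) \<le> 1 / y" for t
      using cmod_of_real_diff_ge[of "Complex x y" t] y by (simp add: norm_divide norm_mult frac_le)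
  qed measurable
  have "Re (1 / (\<i> * (of_real t - Complex x y))) = y * (1 / ((t - x)\<^sup>2 + y\<^sup>2))" for t
    by (simp add: Re_divide add.commute)
  then have e: "Re (indicat_real K t *\<^sub>R (1 / (\<i> * (of_real t - Complex x y)))) = y * (indicat_real K t * (1 / ((t - x)\<^sup>2 + y\<^sup>2)))" for t
    by (simp only: scaleR_complex.simps mult.left_commute)
  have "Re (schwarz K (Complex x y)) = Re (LBINT t. indicat_real K t *\<^sub>R (1 / (\<i> * (of_real t - Complex x y)))) / pi"
    unfolding schwarz_def by simp
  also have "\<dots> = (LBINT t. y * (indicat_real K t * (1 / ((t - x)\<^sup>2 + y\<^sup>2)))) / pi"
    unfolding integral_Re[OF i, symmetric] e ..
  also have "\<dots> = y * (LBINT t. indicat_real K t * (1 / ((t - x)\<^sup>2 + y\<^sup>2))) / pi"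
    by (subst integral_mult_right_zero) (rule refl)
  finally show ?thesis by simp
qed

lemma integrable_indicator_kernel:
  assumes y: "y > 0"
  shows "integrable lborel (\<lambda>t. indicat_real K t * (1 / ((t - x)\<^sup>2 + y\<^sup>2)))"
  by (rule Bochner_Integration.integrable_bound[OF integrable_poisson_kernel[OF y, of x]])
    (use poisson_kernel_bounds(1)[OF y] in \<open>auto split: split_indicator\<close>)

lemma Re_schwarz_bounds:
  assumes y: "y > 0"
  shows "Re (schwarz K (Complex x y)) \<ge> 0" "Re (schwarz K (Complex x y)) \<le> 1"
proof -
  note k = poisson_kernel_bounds(1)[OF y, of _ x]
  show "Re (schwarz K (Complex x y)) \<ge> 0"
    unfolding Re_schwarz[OF y] using y k
    by (intro mult_nonneg_nonneg Bochner_Integration.integral_nonneg) (auto split: split_indicator)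
  have "(LBINT t. indicat_real K t * (1 / ((t - x)\<^sup>2 + y\<^sup>2))) \<le> (LBINT t. 1 / ((t - x)\<^sup>2 + y\<^sup>2))"
    by (intro integral_mono integrable_indicator_kernel integrable_poisson_kernel y)
      (use k in \<open>auto split: split_indicator\<close>)
  then have "(LBINT t. indicat_real K t * (1 / ((t - x)\<^sup>2 + y\<^sup>2))) \<le> pi / y"
    unfolding integral_poisson_kernel[OF y] .
  then have "y / pi * (LBINT t. indicat_real K t * (1 / ((t - x)\<^sup>2 + y\<^sup>2))) \<le> y / pi * (pi / y)"
    using y by (intro mult_left_mono) auto
  then show "Re (schwarz K (Complex x y)) \<le> 1"
    unfolding Re_schwarz[OF y] using y by simp
qed

text \<open>The kernel is positive everywhere and K is not null. The strict sign is what makes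
  \<open>exp (n * schwarz K)\<close> grow at interior points.\<close>

lemma Re_schwarz_pos:
  assumes y: "y > 0" and pos: "emeasure lborel K > 0"
  shows "Re (schwarz K (Complex x y)) > 0"
proof -
  note k = poisson_kernel_bounds[OF y, of _ x]
  let ?I = "LBINT t. indicat_real K t * (1 / ((t - x)\<^sup>2 + y\<^sup>2))"
  have nn: "AE t in lborel. 0 \<le> indicat_real K t * (1 / ((t - x)\<^sup>2 + y\<^sup>2))"
    using k(1) by (auto split: split_indicator)
  have "?I \<noteq> 0"
  proof
    assume "?I = 0"
    then have "AE t in lborel. indicat_real K t * (1 / ((t - x)\<^sup>2 + y\<^sup>2)) = 0"
      using integral_nonneg_eq_0_iff_AE[OF integrable_indicator_kernel[OF y] nn] by simp
    then have "AE t in lborel. t \<notin> K"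
    proof eventually_elim
      case (elim t)
      then show ?case using k(3)[of t] by (auto split: split_indicator_asm)
    qed
    then have "emeasure lborel K = 0"
      using AE_iff_measurable[of K lborel "\<lambda>t. t \<notin> K"] K(1) by simp
    then show False using pos by simp
  qed
  moreover have "?I \<ge> 0" by (rule integral_nonneg_AE[OF nn])
  ultimately have "?I > 0" by linarith
  then show ?thesis unfolding Re_schwarz[OF y] using y by (intro mult_pos_pos divide_pos_pos) auto
qed

text \<open>Since K is closed, x has a distance d > 0 from it. The kernel is then at most 1/d^2 on
  K, and the prefactor tends to 0 with the height.\<close>

lemma Re_schwarz_tendsto:
  assumes x: "x \<notin> K" and a: "\<And>j. a j > 0" "a \<longlonglongrightarrow> 0"
  shows "(\<lambda>j. Re (schwarz K (Complex x (a j)))) \<longlonglongrightarrow> 0"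
proof -
  have "open (- K)" by (rule open_Compl[OF K(1)])
  then obtain d where d: "d > 0" "ball x d \<subseteq> - K" using x open_contains_ball[of "-K"] by auto
  have le: "(LBINT t. indicat_real K t * (1 / ((t - x)\<^sup>2 + y\<^sup>2))) \<le> measure lborel K / d\<^sup>2" if y: "y > 0" for y
  proof -
    have "(LBINT t. indicat_real K t * (1 / ((t - x)\<^sup>2 + y\<^sup>2))) \<le> (LBINT t. indicat_real K t * (1 / d\<^sup>2))"
    proof (intro integral_mono integrable_indicator_kernel y)
      show "integrable lborel (\<lambda>t. indicat_real K t * (1 / d\<^sup>2))" using integrable_indicator_K by simp
      fix t
      show "indicat_real K t * (1 / ((t - x)\<^sup>2 + y\<^sup>2)) \<le> indicat_real K t * (1 / d\<^sup>2)"
      proof (cases "t \<in> K")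
        case True
        then have "d \<le> \<bar>t - x\<bar>" using d(2) by (force simp: dist_real_def)
        then have "d\<^sup>2 \<le> (t - x)\<^sup>2" using d(1) power_mono[of d "\<bar>t - x\<bar>" 2] by simp
        then have "d\<^sup>2 \<le> (t - x)\<^sup>2 + y\<^sup>2" by (simp add: add_increasing2)
        then show ?thesis using True d(1) y by (auto intro!: divide_left_mono mult_pos_pos add_nonneg_pos)
      qed simp
    qed
    also have "\<dots> = measure lborel K / d\<^sup>2" using K(1) by simp
    finally show ?thesis .
  qed
  show ?thesis
  proof (rule Lim_null_comparison)
    show "(\<lambda>j. a j / pi * (measure lborel K / d\<^sup>2)) \<longlonglongrightarrow> 0"
      using tendsto_mult[OF tendsto_divide[OF a(2) tendsto_const[of pi]] tendsto_const[of "measure lborel K / d\<^sup>2"]] by simp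
    have "norm (Re (schwarz K (Complex x (a j)))) \<le> a j / pi * (measure lborel K / d\<^sup>2)" for j
    proof -
      have "norm (Re (schwarz K (Complex x (a j)))) = Re (schwarz K (Complex x (a j)))"
        using Re_schwarz_bounds(1)[OF a(1)[of j], of x] by simp
      also have "\<dots> \<le> a j / pi * (measure lborel K / d\<^sup>2)"
        unfolding Re_schwarz[OF a(1)] using a(1)[of j] by (intro mult_left_mono le) auto
      finally show ?thesis .
    qed
    then show "eventually (\<lambda>j. norm (Re (schwarz K (Complex x (a j)))) \<le> a j / pi * (measure lborel K / d\<^sup>2)) sequentially"
      by (intro always_eventually) simp
  qed
qed

text \<open>Multiplying by \<open>exp (n * schwarz K)\<close> does not change the size of the boundary
  values off \<open>K\<close>, but multiplies interior values by an arbitrarily large factor.\<close>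

lemma hardy_ext_amplified_bound:
  assumes F: "hardy_ext f F" and f: "sq_int f" and f0: "AE x in lborel. x \<in> K \<longrightarrow> f x = 0" and y: "y > 0"
  shows "cmod (F (Complex u y)) * exp (real n * Re (schwarz K (Complex u y)))
    \<le> y / pi * (LBINT x. cmod (f x) * (1 / ((x - u)\<^sup>2 + y\<^sup>2)))"
proof -
  let ?S = "schwarz K"
  let ?k = "\<lambda>x. 1 / ((x - u)\<^sup>2 + y\<^sup>2)"
  note sF = hardy_extD(2)[OF F] and holF = hardy_extD(1)[OF F]
  note [measurable] = sq_intD(1)[OF f]
  note k0 = poisson_kernel_bounds(1)[OF y, of _ u]
  have sk: "sq_int (\<lambda>x. complex_of_real (?k x))" by (rule sq_int_poisson_kernel[OF y])
  define G where "G z = F z * exp (of_nat n * ?S z)" for z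
  define E where "E x t = exp (real n * Re (?S (Complex x t)))" for x t
  have holG: "G holomorphic_on {z. Im z > 0}"
    unfolding G_def by (intro holomorphic_intros holF schwarz_holomorphic)
  have G: "cmod (G (Complex x t)) = cmod (F (Complex x t)) * E x t" for x t
    by (simp add: G_def E_def norm_mult)
  \<comment> \<open>For fixed n the amplification is bounded, because the harmonic measure is at
    most 1; this keeps \<open>G\<close> within reach of
    \<open>poisson_representation\<close>.\<close>
  have E1: "E x t \<le> exp (real n)" "E x t \<ge> 0" if "t > 0" for x t
    using Re_schwarz_bounds(2)[OF that, of x] by (auto simp: E_def mult_left_le)
  have Gm: "(\<lambda>x. G (Complex x t)) \<in> borel_measurable lborel" if "t > 0" for t
    by (rule borel_measurable_line[OF holG that])
  have Em: "(\<lambda>x. E x t) \<in> borel_measurable lborel" if "t > 0" for t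
  proof -
    have [measurable]: "(\<lambda>x. ?S (Complex x t)) \<in> borel_measurable lborel"
      by (rule borel_measurable_line[OF schwarz_holomorphic that])
    show ?thesis unfolding E_def by measurable
  qed
  have Gb: "AE x in lborel. cmod (G (Complex x t)) \<le> exp (real n) * cmod (F (Complex x t))" if "t > 0" for t
    unfolding G using E1[OF that] by (intro AE_I2) (simp add: mult.commute mult_right_mono)
  have sG: "sq_int (\<lambda>x. G (Complex x t))" if "t > 0" for t
    by (rule sq_int_bound[OF sF[OF that] Gm[OF that] Gb[OF that]])
  have nG: "l2norm (\<lambda>x. G (Complex x t)) \<le> exp (real n) * l2norm f" if "t > 0" for t
  proof -
    have "l2norm (\<lambda>x. G (Complex x t)) \<le> exp (real n) * l2norm (\<lambda>x. F (Complex x t))"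
      by (rule l2norm_bound_AE[OF sF[OF that] Gm[OF that] Gb[OF that]]) simp
    also have "\<dots> \<le> exp (real n) * l2norm f"
      by (intro mult_left_mono hardy_ext_contraction[OF F f that]) simp
    finally show ?thesis .
  qed
  define a where "a j = inverse (real (Suc j))" for j
  have a: "a j > 0" "a \<longlonglongrightarrow> 0" for j
    unfolding a_def using LIMSEQ_inverse_real_of_nat by auto
  have ik: "integrable lborel (\<lambda>x. cmod (f x) * ?k x)"
    using integrable_norm_mult[OF f sk] by (simp only: norm_of_real abs_of_nonneg[OF k0])
  have Ek: "integrable lborel (\<lambda>x. cmod (f x) * E x t * ?k x)" if t: "t > 0" for t
  proof (rule Bochner_Integration.integrable_bound)
    note [measurable] = Em[OF t]
    show "integrable lborel (\<lambda>x. exp (real n) * (cmod (f x) * ?k x))" using ik by (rule integrable_mult_right)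
    show "(\<lambda>x. cmod (f x) * E x t * ?k x) \<in> borel_measurable lborel" by measurable
    show "AE x in lborel. norm (cmod (f x) * E x t * ?k x) \<le> norm (exp (real n) * (cmod (f x) * ?k x))"
    proof (rule AE_I2)
      fix x
      have "E x t * (cmod (f x) * ?k x) \<le> exp (real n) * (cmod (f x) * ?k x)"
        using E1[OF t] k0 by (intro mult_right_mono mult_nonneg_nonneg) auto
      then show "norm (cmod (f x) * E x t * ?k x) \<le> norm (exp (real n) * (cmod (f x) * ?k x))"
        using E1[OF t] k0[of x] by (simp add: abs_mult mult_ac)
    qed
  qed
  \<comment> \<open>From |F| \<le> |F - f| + |f|: the difference takes the crude factor exp n and
    disappears by L2 convergence, while the |f| part must keep its exact weight
    \<open>E\<close>.\<close>
  let ?R = "\<lambda>j. y / pi * (exp (real n) * (l2norm (\<lambda>x. F (Complex x (a j)) - f x) * l2norm (\<lambda>x. complex_of_real (?k x)))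
       + (LBINT x. cmod (f x) * E x (a j) * ?k x))"
  have le: "cmod (G (Complex u (a j + y))) \<le> ?R j" for j
  proof -
    let ?F = "\<lambda>x. F (Complex x (a j))"
    have sd: "sq_int (\<lambda>x. ?F x - f x)" by (rule sq_int_diff[OF sF[OF a(1)] f])
    have id: "integrable lborel (\<lambda>x. cmod (?F x - f x) * ?k x)"
      using integrable_norm_mult[OF sd sk] by (simp only: norm_of_real abs_of_nonneg[OF k0])
    have rep: "G (Complex u (a j + y)) = poisson (\<lambda>x. G (Complex x (a j))) y u"
      by (rule poisson_representation[OF holG sG nG a(1) y])
    have "cmod (LBINT x. G (Complex x (a j)) * complex_of_real (?k x)) \<le> (LBINT x. cmod (G (Complex x (a j)) * complex_of_real (?k x)))"
      by (rule integral_norm_bound)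
    also have "\<dots> \<le> (LBINT x. exp (real n) * (cmod (?F x - f x) * ?k x) + cmod (f x) * E x (a j) * ?k x)"
    proof (rule integral_mono)
      show "integrable lborel (\<lambda>x. cmod (G (Complex x (a j)) * complex_of_real (?k x)))"
        by (intro integrable_norm integrable_poisson sG a y)
      show "integrable lborel (\<lambda>x. exp (real n) * (cmod (?F x - f x) * ?k x) + cmod (f x) * E x (a j) * ?k x)"
        by (intro Bochner_Integration.integrable_add integrable_mult_right id Ek a)
      fix x
      have "cmod (G (Complex x (a j)) * complex_of_real (?k x)) = cmod (?F x) * (E x (a j) * ?k x)"
        using k0[of x] by (simp add: norm_mult G mult.assoc del: of_real_divide)
      also have "\<dots> \<le> (cmod (?F x - f x) + cmod (f x)) * (E x (a j) * ?k x)"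
        using norm_triangle_ineq[of "?F x - f x" "f x"] E1(2)[OF a(1)] k0 by (intro mult_right_mono mult_nonneg_nonneg) auto
      also have "\<dots> = E x (a j) * (cmod (?F x - f x) * ?k x) + cmod (f x) * E x (a j) * ?k x"
        by (simp only: distrib_right distrib_left mult_ac)
      also have "\<dots> \<le> exp (real n) * (cmod (?F x - f x) * ?k x) + cmod (f x) * E x (a j) * ?k x"
        using E1(1)[OF a(1)] k0 by (intro add_right_mono mult_right_mono mult_nonneg_nonneg) auto
      finally show "cmod (G (Complex x (a j)) * complex_of_real (?k x)) \<le>
          exp (real n) * (cmod (?F x - f x) * ?k x) + cmod (f x) * E x (a j) * ?k x" .
    qed
    also have "\<dots> = exp (real n) * (LBINT x. cmod (?F x - f x) * ?k x) + (LBINT x. cmod (f x) * E x (a j) * ?k x)"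
      using id Ek[OF a(1)] by (subst Bochner_Integration.integral_add) (auto simp del: times_divide_eq_right)
    also have "\<dots> \<le> exp (real n) * (l2norm (\<lambda>x. ?F x - f x) * l2norm (\<lambda>x. complex_of_real (?k x)))
       + (LBINT x. cmod (f x) * E x (a j) * ?k x)"
      using cauchy_schwarz_norm[OF sd sk] unfolding norm_of_real abs_of_nonneg[OF k0]
      by (intro add_right_mono mult_left_mono) auto
    finally have "y / pi * cmod (LBINT x. G (Complex x (a j)) * complex_of_real (?k x)) \<le>
     y / pi * (exp (real n) * (l2norm (\<lambda>x. ?F x - f x) * l2norm (\<lambda>x. complex_of_real (?k x)))
       + (LBINT x. cmod (f x) * E x (a j) * ?k x))"
      using y by (intro mult_left_mono) auto
    moreover have "cmod (G (Complex u (a j + y))) = y / pi * cmod (LBINT x. G (Complex x (a j)) * complex_of_real (?k x))"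
      unfolding rep poisson_def using y by (simp add: norm_mult del: of_real_divide)
    ultimately show ?thesis by (simp only:)
  qed
  show ?thesis
  proof (rule LIMSEQ_le)
    have "isCont G (Complex u y)"
      using holomorphic_on_imp_continuous_on[OF holG] y
      by (simp add: continuous_on_eq_continuous_at open_Im_gt)
    moreover have "(\<lambda>j. Complex u (a j + y)) \<longlonglongrightarrow> Complex u (0 + y)"
      unfolding Complex_eq by (intro tendsto_intros a)
    ultimately have "(\<lambda>j. G (Complex u (a j + y))) \<longlonglongrightarrow> G (Complex u y)"
      using isCont_tendsto_compose by fastforce
    then show "(\<lambda>j. cmod (G (Complex u (a j + y)))) \<longlonglongrightarrow> cmod (F (Complex u y)) * exp (real n * Re (?S (Complex u y)))"
      using tendsto_norm G[of u y] by (fastforce simp: E_def)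
    have "filterlim a (at_right 0) sequentially"
    proof -
      have "a j \<noteq> 0" for j using a(1)[of j] by simp
      then show ?thesis using a by (auto simp: filterlim_at intro!: always_eventually)
    qed
    from filterlim_compose[OF hardy_extD(3)[OF F] this]
    have l1: "(\<lambda>j. l2norm (\<lambda>x. F (Complex x (a j)) - f x)) \<longlonglongrightarrow> 0" .
    \<comment> \<open>On K the function f vanishes almost everywhere, and off K the weight tends to
      exp 0 = 1. So the limit no longer depends on n.\<close>
    have l2: "(\<lambda>j. LBINT x. cmod (f x) * E x (a j) * ?k x) \<longlonglongrightarrow> (LBINT x. cmod (f x) * ?k x)"
    proof (rule integral_dominated_convergence[where w="\<lambda>x. exp (real n) * (cmod (f x) * ?k x)"])
      show "integrable lborel (\<lambda>x. exp (real n) * (cmod (f x) * ?k x))" using ik by (rule integrable_mult_right)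
      show "(\<lambda>x. cmod (f x) * E x (a j) * ?k x) \<in> borel_measurable lborel" for j
        using Ek[OF a(1)] by (rule borel_measurable_integrable)
      show "(\<lambda>x. cmod (f x) * ?k x) \<in> borel_measurable lborel" by measurable
      show "AE x in lborel. (\<lambda>j. cmod (f x) * E x (a j) * ?k x) \<longlonglongrightarrow> cmod (f x) * ?k x"
        using f0
      proof eventually_elim
        case (elim x)
        show ?case
        proof (cases "x \<in> K")
          case True
          then show ?thesis using elim by simp
        next
          case False
          have "(\<lambda>j. cmod (f x) * E x (a j) * ?k x) \<longlonglongrightarrow> cmod (f x) * exp (real n * 0) * ?k x"
            unfolding E_def by (intro tendsto_mult tendsto_const tendsto_exp Re_schwarz_tendsto False a)
          then show ?thesis by simp
        qed
      qed
      show "AE x in lborel. norm (cmod (f x) * E x (a j) * ?k x) \<le> exp (real n) * (cmod (f x) * ?k x)" for j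
      proof (rule AE_I2)
        fix x
        have "E x (a j) * (cmod (f x) * ?k x) \<le> exp (real n) * (cmod (f x) * ?k x)"
          using E1[OF a(1)] k0 by (intro mult_right_mono mult_nonneg_nonneg) auto
        then show "norm (cmod (f x) * E x (a j) * ?k x) \<le> exp (real n) * (cmod (f x) * ?k x)"
          using E1[OF a(1)[of j], of x] k0[of x] by (simp add: abs_mult mult_ac)
      qed
    qed
    have "(\<lambda>j. ?R j) \<longlonglongrightarrow>
       y / pi * (exp (real n) * (0 * l2norm (\<lambda>x. complex_of_real (?k x))) + (LBINT x. cmod (f x) * ?k x))"
      by (intro tendsto_mult tendsto_add tendsto_const l1 l2)
    then show "(\<lambda>j. ?R j) \<longlonglongrightarrow> y / pi * (LBINT x. cmod (f x) * ?k x)"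
      by (simp only: mult_zero_left mult_zero_right add_0_left)
  qed (use le in blast)
qed

end

text \<open>A nonzero interior value multiplied by exp (n r) with r > 0 would stay below a constant
  independent of n. So the extension vanishes, and with it its L2 limit f.\<close>

lemma H2_uniqueness:
  assumes "f \<in> H2" "E \<in> sets lborel" "emeasure lborel E > 0" "AE x in lborel. x \<in> E \<longrightarrow> f x = 0"
  shows "l2norm f = 0"
proof -
  obtain K where K: "closed K" "K \<subseteq> E" "emeasure lborel K > 0" "emeasure lborel K < \<infinity>"
    using positive_measure_closed_subset[OF assms(2,3)] by blast
  obtain F where F: "hardy_ext f F" and f: "sq_int f" using assms(1) by (auto simp: H2_iff)
  have f0: "AE x in lborel. x \<in> K \<longrightarrow> f x = 0" using assms(4) by eventually_elim (use K(2) in auto)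
  have F0: "F (Complex u y) = 0" if y: "y > 0" for u y
  proof (rule ccontr)
    assume "F (Complex u y) \<noteq> 0"
    then have c: "cmod (F (Complex u y)) > 0" by simp
    define r where "r = Re (schwarz K (Complex u y))"
    have r: "r > 0" unfolding r_def by (rule Re_schwarz_pos[OF K(1,4) y K(3)])
    define C where "C = y / pi * (LBINT x. cmod (f x) * (1 / ((x - u)\<^sup>2 + y\<^sup>2)))"
    \<comment> \<open>Since exp t \<ge> t, linear growth in n already exceeds
      \<open>C\<close>.\<close>
    obtain n :: nat where n: "C / (cmod (F (Complex u y)) * r) < real n" using reals_Archimedean2 by blast
    have "cmod (F (Complex u y)) * (real n * r) \<le> cmod (F (Complex u y)) * exp (real n * r)"
      using exp_ge_add_one_self[of "real n * r"] by (intro mult_left_mono) (linarith, simp)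
    also have "\<dots> \<le> C"
      unfolding C_def r_def by (rule hardy_ext_amplified_bound[OF K(1,4) F f f0 y])
    finally show False using n c r by (simp add: field_simps)
  qed
  have "eventually (\<lambda>y. l2norm (\<lambda>x. F (Complex x y) - f x) = l2norm f) (at_right 0)"
    using eventually_at_right_pos by eventually_elim (simp add: F0 l2norm_def)
  then have "((\<lambda>y. l2norm (\<lambda>x. F (Complex x y) - f x)) \<longlongrightarrow> l2norm f) (at_right 0)" by (rule tendsto_eventually)
  from tendsto_unique[OF _ this hardy_extD(3)[OF F]] show ?thesis by simp
qed

section \<open>Approximation by rational functions and compactness\<close>

text \<open>Boundary values of the conformal map of the upper half-plane onto the unit disc with
  zero at \<open>\<i>\<close>; the point at infinity corresponds to 1.\<close>

definition cayley :: "real \<Rightarrow> complex" where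
  "cayley x = (of_real x - \<i>) / (of_real x + \<i>)"

lemma of_real_add_ii_neq_0: "complex_of_real x + \<i> \<noteq> 0" "complex_of_real x - \<i> \<noteq> 0"
proof -
  have "Im (complex_of_real x + \<i>) \<noteq> Im 0" "Im (complex_of_real x - \<i>) \<noteq> Im 0" by simp_all
  then show "complex_of_real x + \<i> \<noteq> 0" "complex_of_real x - \<i> \<noteq> 0" by metis+
qed

lemma cayley_neq_0 [simp]: "cayley x \<noteq> 0"
  using of_real_add_ii_neq_0[of x] by (simp add: cayley_def)

lemma norm_cayley [simp]: "cmod (cayley x) = 1"
proof -
  have "cmod (of_real x - \<i>) = cmod (cnj (of_real x - \<i>))" by (simp only: complex_mod_cnj)
  also have "\<dots> = cmod (of_real x + \<i>)" by simp
  finally show ?thesis by (simp add: cayley_def norm_divide of_real_add_ii_neq_0)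
qed

lemma measurable_cayley [measurable]: "cayley \<in> borel_measurable borel"
  unfolding cayley_def by measurable

lemma cayley_neq_1: "cayley x \<noteq> 1"
  unfolding cayley_def divide_eq_1_iff by (simp add: complex_eq_iff)

lemma inverse_cayley: "\<i> * (1 + cayley x) / (1 - cayley x) = of_real x"
proof -
  have "1 + cayley x = 2 * of_real x / (of_real x + \<i>)" "1 - cayley x = 2 * \<i> / (of_real x + \<i>)"
    using of_real_add_ii_neq_0(1)[of x] by (simp_all add: cayley_def field_simps)
  then show ?thesis using of_real_add_ii_neq_0(1)[of x] by simp
qed

text \<open>Trigonometric polynomials over a common denominator: \<open>p\<close> becomes a bounded
  analytic multiplier, and the power of z isolates what leads out of \<open>H2\<close>.\<close>

definition laurent_on_circle :: "(complex \<Rightarrow> complex) \<Rightarrow> bool" where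
  "laurent_on_circle h \<longleftrightarrow> (\<exists>p N. \<forall>z. cmod z = 1 \<longrightarrow> h z = poly p z / z ^ N)"

lemma laurent_on_circle_const: "laurent_on_circle (\<lambda>z. c)"
  unfolding laurent_on_circle_def by (intro exI[of _ "[:c:]"] exI[of _ 0]) simp

lemma laurent_on_circle_add:
  assumes "laurent_on_circle h" "laurent_on_circle k"
  shows "laurent_on_circle (\<lambda>z. h z + k z)"
proof -
  obtain p N q M where *: "\<And>z. cmod z = 1 \<Longrightarrow> h z = poly p z / z ^ N" "\<And>z. cmod z = 1 \<Longrightarrow> k z = poly q z / z ^ M"
    using assms unfolding laurent_on_circle_def by blast
  have "h z + k z = poly (p * monom 1 M + q * monom 1 N) z / z ^ (N + M)" if "cmod z = 1" for z
  proof -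
    have "z \<noteq> 0" using that by auto
    then show ?thesis using *[OF that] by (simp add: poly_monom power_add field_simps)
  qed
  then show ?thesis unfolding laurent_on_circle_def by blast
qed

lemma laurent_on_circle_mult:
  assumes "laurent_on_circle h" "laurent_on_circle k"
  shows "laurent_on_circle (\<lambda>z. h z * k z)"
proof -
  obtain p N q M where *: "\<And>z. cmod z = 1 \<Longrightarrow> h z = poly p z / z ^ N" "\<And>z. cmod z = 1 \<Longrightarrow> k z = poly q z / z ^ M"
    using assms unfolding laurent_on_circle_def by blast
  have "h z * k z = poly (p * q) z / z ^ (N + M)" if "cmod z = 1" for z
    using *[OF that] by (simp add: power_add)
  then show ?thesis unfolding laurent_on_circle_def by blast
qed

lemma laurent_on_circle_real_polynomial:
  assumes "real_polynomial_function r"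
  shows "laurent_on_circle (\<lambda>z. complex_of_real (r z))"
  using assms
proof induction
  case (linear f)
  interpret bounded_linear f by (rule linear)
  \<comment> \<open>On the circle \<open>cnj z\<close> is 1/z, so Re z and Im z are Laurent
    polynomials and f z = (a + b) z + (a - b) / z.\<close>
  define a where "a = complex_of_real (f 1) / 2"
  define b where "b = complex_of_real (f \<i>) / (2 * \<i>)"
  have "of_real (f z) = poly [:a - b, 0, a + b:] z / z ^ 1" if z1: "cmod z = 1" for z
  proof -
    have z0: "z \<noteq> 0" using z1 by auto
    have "z * cnj z = 1" using complex_norm_square[of z] z1 by simp
    then have cz: "cnj z = 1 / z" using z0 by (simp add: field_simps)
    have "z = Re z *\<^sub>R 1 + Im z *\<^sub>R \<i>" by (simp add: complex_eq_iff)
    then have "f z = Re z * f 1 + Im z * f \<i>" by (metis add scaleR real_scaleR_def)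
    then have fz: "complex_of_real (f z) = of_real (Re z) * of_real (f 1) + of_real (Im z) * of_real (f \<i>)" by simp
    have re: "complex_of_real (Re z) = (z + cnj z) / 2" by (simp add: complex_add_cnj)
    have "z - cnj z = 2 * \<i> * complex_of_real (Im z)" by (simp add: complex_eq_iff)
    then have im: "complex_of_real (Im z) = (z - cnj z) / (2 * \<i>)" by simp
    show ?thesis unfolding fz re im cz a_def b_def using z0 by (simp add: field_simps)
  qed
  then show ?case unfolding laurent_on_circle_def by blast
next
  case (const c)
  show ?case by (rule laurent_on_circle_const)
next
  case (add f g)
  then show ?case using laurent_on_circle_add by simp
next
  case (mult f g)
  then show ?case using laurent_on_circle_mult by simp
qed

lemma laurent_on_circle_polynomial_function:
  fixes P :: "complex \<Rightarrow> complex"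
  assumes "polynomial_function P"
  shows "laurent_on_circle P"
proof -
  have "real_polynomial_function (Re \<circ> P)" "real_polynomial_function (Im \<circ> P)"
    using assms bounded_linear_Re bounded_linear_Im unfolding polynomial_function_def by blast+
  then have "laurent_on_circle (\<lambda>z. of_real ((Re \<circ> P) z) + \<i> * of_real ((Im \<circ> P) z))"
    by (intro laurent_on_circle_add laurent_on_circle_mult laurent_on_circle_const laurent_on_circle_real_polynomial)
  then show ?thesis by (simp add: complex_eq[symmetric])
qed

text \<open>The Cayley transform turns the line with one point at infinity into the circle. Equality
  of the limits at both ends is continuity at 1, and Stone-Weierstrass applies there.\<close>

lemma Cinf_approx:
  assumes g: "g \<in> Cinf" and e: "e > 0"
  obtains p N where "\<And>x. cmod (g x - poly p (cayley x) / cayley x ^ N) < e"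
proof -
  let ?S = "sphere (0::complex) 1"
  obtain L where L: "(g \<longlongrightarrow> L) at_top" "(g \<longlongrightarrow> L) at_bot" and cg: "continuous_on UNIV g"
    using g by (auto simp: Cinf_def)
  have Linf: "(g \<longlongrightarrow> L) at_infinity"
    unfolding at_infinity_eq_at_top_bot using L by (rule filterlim_sup)
  define W where "W z = \<i> * (1 + z) / (1 - z)" for z :: complex
  define G where "G z = (if z = 1 then L else g (Re (W z)))" for z
  \<comment> \<open>\<open>W\<close> inverts the Cayley transform and is real on the punctured
    circle, so the \<open>Re\<close> in \<open>G\<close> changes only the type.\<close>
  have Wreal: "of_real (Re (W z)) = W z" if z: "z \<in> ?S" "z \<noteq> 1" for z
  proof -
    have "z * cnj z = 1" using complex_norm_square[of z] z(1) by simp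
    moreover have "cnj z \<noteq> 1" using z(2) by (metis complex_cnj_cnj complex_cnj_one)
    ultimately have "cnj (W z) = W z" using z(2) by (simp add: W_def field_simps)
    then show ?thesis by (metis Reals_cnj_iff of_real_Re)
  qed
  have "continuous_on ?S G"
    unfolding continuous_on_eq_continuous_within
  proof
    fix z assume z: "z \<in> ?S"
    show "continuous (at z within ?S) G"
    proof (cases "z = 1")
      case True
      \<comment> \<open>The two ends of the line need not be told apart: |W| tends to infinity, and
        \<open>g\<close> has the single limit \<open>L\<close> there.\<close>
      have "filterlim W at_infinity (at 1 within ?S)"
        unfolding W_def
      proof (rule filterlim_divide_at_infinity)
        show "((\<lambda>z. \<i> * (1 + z)) \<longlongrightarrow> \<i> * (1 + 1)) (at 1 within ?S)" by (intro tendsto_intros)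
        have "((\<lambda>z. 1 - z) \<longlongrightarrow> 1 - 1) (at 1 within ?S)" by (intro tendsto_intros)
        then show "filterlim (\<lambda>z. 1 - z) (at 0) (at 1 within ?S)"
          by (auto simp: filterlim_at eventually_at_filter)
      qed simp
      then have "filterlim (\<lambda>z. norm (W z)) at_top (at 1 within ?S)"
        by (simp add: filterlim_at_infinity_conv_norm_at_top)
      moreover have "eventually (\<lambda>z. norm (W z) = norm (Re (W z))) (at 1 within ?S)"
        unfolding eventually_at_filter
      proof (intro always_eventually allI impI)
        fix z assume "z \<noteq> 1" "z \<in> ?S"
        from Wreal[OF this(2,1)] show "norm (W z) = norm (Re (W z))" by (metis norm_of_real real_norm_def)
      qed
      ultimately have "filterlim (\<lambda>z. norm (Re (W z))) at_top (at 1 within ?S)"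
        by (simp cong: filterlim_cong)
      then have "filterlim (\<lambda>z. Re (W z)) at_infinity (at 1 within ?S)"
        by (simp add: filterlim_at_infinity_conv_norm_at_top)
      from filterlim_compose[OF Linf this]
      have "((\<lambda>z. g (Re (W z))) \<longlongrightarrow> L) (at 1 within ?S)" .
      then have "(G \<longlongrightarrow> L) (at 1 within ?S)"
        by (rule Lim_transform_eventually) (simp add: eventually_at_filter G_def)
      then show ?thesis using True by (simp add: continuous_within G_def)
    next
      case False
      have "isCont (\<lambda>z. g (Re (W z))) z"
      proof (rule isCont_o2[where g=g])
        show "isCont (\<lambda>z. Re (W z)) z" unfolding W_def using False by (intro isCont_Re continuous_intros) auto
        show "isCont g (Re (W z))" using cg by (simp add: continuous_on_eq_continuous_at)
      qed
      then have "((\<lambda>z. g (Re (W z))) \<longlongrightarrow> g (Re (W z))) (at z within ?S)"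
        by (simp add: isCont_def tendsto_within_subset[of _ _ z UNIV])
      moreover have "eventually (\<lambda>w. g (Re (W w)) = G w) (at z within ?S)"
      proof -
        have "eventually (\<lambda>w. w \<noteq> 1) (at z within ?S)"
          by (rule tendsto_imp_eventually_ne[OF tendsto_ident_at False])
        then show ?thesis by eventually_elim (simp add: G_def)
      qed
      ultimately have "(G \<longlongrightarrow> g (Re (W z))) (at z within ?S)" by (rule Lim_transform_eventually)
      then show ?thesis using False by (simp add: continuous_within G_def)
    qed
  qed
  then obtain P where P: "polynomial_function P" "\<And>z. z \<in> ?S \<Longrightarrow> cmod (G z - P z) < e"
    using Stone_Weierstrass_polynomial_function[of ?S G e] e by auto
  obtain p N where pN: "\<And>z. cmod z = 1 \<Longrightarrow> P z = poly p z / z ^ N"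
    using laurent_on_circle_polynomial_function[OF P(1)] unfolding laurent_on_circle_def by blast
  show ?thesis
  proof (rule that[of p N])
    fix x
    have "G (cayley x) = g x" using cayley_neq_1[of x] inverse_cayley[of x] by (simp add: G_def W_def)
    then show "cmod (g x - poly p (cayley x) / cayley x ^ N) < e"
      using P(2)[of "cayley x"] pN[of "cayley x"] by simp
  qed
qed

text \<open>The Cayley transform maps the half-plane into the closed unit disc, on which a
  polynomial is bounded by compactness.\<close>

lemma H2_poly_cayley:
  assumes f: "f \<in> H2"
  obtains B where "\<And>x. cmod (poly p (cayley x)) \<le> B" "(\<lambda>x. poly p (cayley x) * f x) \<in> H2"
proof -
  let ?c = "\<lambda>z. (z - \<i>) / (z + \<i>)"
  have "bounded (poly p ` cball 0 1)"
    by (intro compact_imp_bounded compact_continuous_image continuous_intros) simp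
  then obtain B where "\<forall>w\<in>poly p ` cball 0 1. cmod w \<le> B"
    unfolding bounded_iff by blast
  then have B: "cmod (poly p z) \<le> B" if "cmod z \<le> 1" for z using that by auto
  have c1: "cmod (?c z) \<le> 1" if "Im z > 0" for z
  proof -
    have "(cmod (z - \<i>))\<^sup>2 \<le> (cmod (z + \<i>))\<^sup>2"
      using that unfolding cmod_power2 by (simp add: power2_eq_square algebra_simps)
    then have "cmod (z - \<i>) \<le> cmod (z + \<i>)" by (rule power2_le_imp_le) simp
    then show ?thesis by (simp add: norm_divide divide_le_eq_1)
  qed
  have zi: "z + \<i> \<noteq> 0" if "Im z \<ge> 0" for z using that by (auto simp: complex_eq_iff)
  have "(\<lambda>x. poly p (cayley x) * f x) \<in> H2"
  proof (rule H2_mult_bounded[OF f, where Q="\<lambda>z. poly p (?c z)" and B=B])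
    have "?c holomorphic_on {z. Im z > 0}" using zi by (intro holomorphic_intros) auto
    then have "(poly p \<circ> ?c) holomorphic_on {z. Im z > 0}"
      by (rule holomorphic_on_compose) (intro holomorphic_intros)
    then show "(\<lambda>z. poly p (?c z)) holomorphic_on {z. Im z > 0}" by (simp add: o_def)
    show "cmod (poly p (?c z)) \<le> B" if "Im z > 0" for z using B c1[OF that] by simp
    have "poly p \<in> borel_measurable borel" by (intro borel_measurable_continuous_onI continuous_intros)
    then show "(\<lambda>x. poly p (cayley x)) \<in> borel_measurable lborel" by simp
    show "AE x in lborel. ((\<lambda>y. poly p (?c (Complex x y))) \<longlongrightarrow> poly p (cayley x)) (at_right 0)"
    proof (rule AE_I2)
      fix x
      have "((\<lambda>y. poly p (?c (of_real x + \<i> * of_real y))) \<longlongrightarrow> poly p (?c (of_real x + \<i> * of_real 0))) (at_right 0)"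
        using of_real_add_ii_neq_0(1)[of x] by (intro tendsto_intros) auto
      then show "((\<lambda>y. poly p (?c (Complex x y))) \<longlongrightarrow> poly p (cayley x)) (at_right 0)"
        by (simp add: Complex_eq cayley_def)
    qed
  qed
  then show ?thesis using B by (intro that[of B]) auto
qed

section \<open>Division by the Cayley transform and compactness\<close>

lemma l2_div_cayley:
  assumes "sq_int f"
  shows "sq_int (\<lambda>x. f x / cayley x ^ N)" "l2norm (\<lambda>x. f x / cayley x ^ N) = l2norm f"
proof -
  note [measurable] = sq_intD(1)[OF assms]
  have "(\<lambda>x. f x / cayley x ^ N) \<in> borel_measurable lborel" by measurable
  then show "sq_int (\<lambda>x. f x / cayley x ^ N)"
    using sq_intD(2)[OF assms] by (simp add: sq_int_def norm_divide norm_power)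
  show "l2norm (\<lambda>x. f x / cayley x ^ N) = l2norm f" by (simp add: l2norm_def norm_divide norm_power)
qed

text \<open>\<open>poisson f 1 0\<close> is the value of the extension at \<open>\<i>\<close>.
  Division by the Cayley transform creates a simple pole exactly there, and the zero cancels
  it.\<close>

lemma H2_div_cayley:
  assumes f: "f \<in> H2" and zero: "poisson f 1 0 = 0"
  shows "(\<lambda>x. f x / cayley x) \<in> H2"
proof -
  obtain F where F: "hardy_ext f F" and sf: "sq_int f" using f by (auto simp: H2_iff)
  note sF = hardy_extD(2)[OF F] and holF = hardy_extD(1)[OF F]
  have F0: "F \<i> = 0" using hardy_ext_poisson[OF F sf zero_less_one, of 0] zero by (simp add: Complex_eq)
  define q where "q z = (if z = \<i> then deriv F \<i> else (F z - F \<i>) / (z - \<i>))" for z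
  have q: "q holomorphic_on {z. Im z > 0}"
    unfolding q_def by (rule holomorphic_divided_difference[OF holF open_Im_gt])
  \<comment> \<open>This is F (z + i) / (z - i) with the singularity at \<open>\<i>\<close> filled
    in.\<close>
  define G where "G z = q z * (z + \<i>)" for z
  have holG: "G holomorphic_on {z. Im z > 0}" unfolding G_def by (intro holomorphic_intros q)
  let ?m = "\<lambda>y x. (Complex x y + \<i>) / (Complex x y - \<i>)"
  have GF: "G (Complex x y) = ?m y x * F (Complex x y)" if "Complex x y \<noteq> \<i>" for x y
    using that by (simp add: G_def q_def F0)
  \<comment> \<open>|z + i| is at most |z - i| + 2, and 2 is at most 4 |z - i| here.\<close>
  have m5: "cmod (?m y x) \<le> 5" if "cmod (Complex x y - \<i>) \<ge> 1/2" for x y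
  proof -
    have "Complex x y + \<i> = (Complex x y - \<i>) + 2 * \<i>" by simp
    then have "cmod (Complex x y + \<i>) \<le> cmod (Complex x y - \<i>) + cmod (2 * \<i>)"
      by (metis norm_triangle_ineq)
    also have "\<dots> \<le> 5 * cmod (Complex x y - \<i>)" using that by (simp add: norm_mult)
    finally have le: "cmod (Complex x y + \<i>) \<le> 5 * cmod (Complex x y - \<i>)" .
    have "cmod (Complex x y - \<i>) > 0" using that by linarith
    then show ?thesis using le unfolding norm_divide by (simp add: pos_divide_le_eq)
  qed
  have sub: "cball \<i> (1/2) \<subseteq> {z. Im z > 0}"
  proof
    fix z assume "z \<in> cball \<i> (1/2)"
    then have "Im (\<i> - z) \<le> 1/2" using abs_Im_le_cmod[of "\<i> - z"] by (simp add: dist_norm)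
    then show "z \<in> {z. Im z > 0}" by simp
  qed
  have "bounded (G ` cball \<i> (1/2))"
    using holomorphic_on_imp_continuous_on[OF holomorphic_on_subset[OF holG sub]]
    by (intro compact_imp_bounded compact_continuous_image) auto
  then obtain B where B: "\<And>z. z \<in> cball \<i> (1/2) \<Longrightarrow> cmod (G z) \<le> B"
    unfolding bounded_iff by blast
  \<comment> \<open>Lines may cross the disc where only the bound \<open>B\<close> is available. The
    disc lies over an interval of length 1, so it adds at most B^2 to the integral on any
    line.\<close>
  have Gb: "(cmod (G (Complex x y)))\<^sup>2 \<le> 25 * (cmod (F (Complex x y)))\<^sup>2 + B\<^sup>2 * indicator {-1/2..1/2} x" for x y
  proof (cases "Complex x y \<in> cball \<i> (1/2)")
    case True
    have "\<bar>x\<bar> \<le> 1/2" using True abs_Re_le_cmod[of "\<i> - Complex x y"] by (simp add: dist_norm)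
    then have "x \<in> {-1/2..1/2}" by auto
    moreover have "(cmod (G (Complex x y)))\<^sup>2 \<le> B\<^sup>2" using B[OF True] by (intro power_mono) auto
    ultimately show ?thesis by (simp add: add_increasing)
  next
    case False
    then have d: "cmod (Complex x y - \<i>) \<ge> 1/2" by (simp add: dist_norm norm_minus_commute)
    then have ne: "Complex x y \<noteq> \<i>" by auto
    have "cmod (G (Complex x y)) = cmod (?m y x) * cmod (F (Complex x y))" by (simp only: GF[OF ne] norm_mult)
    also have "\<dots> \<le> 5 * cmod (F (Complex x y))" by (intro mult_right_mono m5 d norm_ge_zero)
    finally have "cmod (G (Complex x y)) \<le> 5 * cmod (F (Complex x y))" .
    then have "(cmod (G (Complex x y)))\<^sup>2 \<le> (5 * cmod (F (Complex x y)))\<^sup>2" by (intro power_mono) auto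
    then show ?thesis by (simp add: power_mult_distrib add_increasing2)
  qed
  have sG: "sq_int (\<lambda>x. G (Complex x y))" and nG: "l2norm (\<lambda>x. G (Complex x y)) \<le> sqrt (25 * (l2norm f)\<^sup>2 + B\<^sup>2)"
    if y: "y > 0" for y
  proof -
    have ind: "integrable lborel (indicat_real {-1/2..1/2::real})" "(LBINT x. indicat_real {-1/2..1/2::real} x) = 1"
      by (auto intro!: integrable_real_indicator)
    have i: "integrable lborel (\<lambda>x. 25 * (cmod (F (Complex x y)))\<^sup>2 + B\<^sup>2 * indicat_real {-1/2..1/2} x)"
      using sq_intD(2)[OF sF[OF y]] ind(1) by (intro Bochner_Integration.integrable_add integrable_mult_right) auto
    note [measurable] = borel_measurable_line[OF holG y]
    have iG: "integrable lborel (\<lambda>x. (cmod (G (Complex x y)))\<^sup>2)"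
      by (rule Bochner_Integration.integrable_bound[OF i]) (use Gb[of _ y] in \<open>auto intro!: AE_I2 simp: abs_of_nonneg\<close>)
    show "sq_int (\<lambda>x. G (Complex x y))" unfolding sq_int_def using iG by simp
    have "(LBINT x. (cmod (G (Complex x y)))\<^sup>2) \<le> (LBINT x. 25 * (cmod (F (Complex x y)))\<^sup>2 + B\<^sup>2 * indicat_real {-1/2..1/2} x)"
      by (intro integral_mono iG i Gb)
    also have "\<dots> = 25 * (l2norm (\<lambda>x. F (Complex x y)))\<^sup>2 + B\<^sup>2"
      using sq_intD(2)[OF sF[OF y]] ind by (simp add: l2norm_sq)
    also have "\<dots> \<le> 25 * (l2norm f)\<^sup>2 + B\<^sup>2"
      using power_mono[OF hardy_ext_contraction[OF F sf y] l2norm_nonneg, of 2] by simp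
    finally show "l2norm (\<lambda>x. G (Complex x y)) \<le> sqrt (25 * (l2norm f)\<^sup>2 + B\<^sup>2)"
      unfolding l2norm_def[of "\<lambda>x. G (Complex x y)"] by (rule real_sqrt_le_mono)
  qed
  \<comment> \<open>Lines lower than 1/2 miss the disc around \<open>\<i>\<close>; this is the
    source of \<open>b = 1/2\<close> and \<open>B = 5\<close> below.\<close>
  have half: "cmod (Complex x y - \<i>) \<ge> 1/2" if "0 < y" "y < 1/2" for x y
    using abs_Im_le_cmod[of "Complex x y - \<i>"] that by simp
  have eq: "(\<lambda>x. f x / cayley x) = (\<lambda>x. 1 / cayley x * f x)" by auto
  have lim: "((\<lambda>y. l2norm (\<lambda>x. ?m y x * F (Complex x y) - 1 / cayley x * f x)) \<longlongrightarrow> 0) (at_right 0)"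
  proof (rule tendsto_l2_bounded_mult(2)[OF sf sF hardy_extD(3)[OF F], where b="1/2" and B=5])
    show "?m y \<in> borel_measurable lborel" for y unfolding Complex_eq by measurable
    show "(\<lambda>x. 1 / cayley x) \<in> borel_measurable lborel" by measurable
    show "AE x in lborel. ((\<lambda>y. ?m y x) \<longlongrightarrow> 1 / cayley x) (at_right 0)"
    proof (rule AE_I2)
      fix x
      have "((\<lambda>y. (of_real x + \<i> * of_real y + \<i>) / (of_real x + \<i> * of_real y - \<i>)) \<longlongrightarrow>
          (of_real x + \<i> * of_real 0 + \<i>) / (of_real x + \<i> * of_real 0 - \<i>)) (at_right 0)"
        using of_real_add_ii_neq_0(2)[of x] by (intro tendsto_intros) auto
      then show "((\<lambda>y. ?m y x) \<longlongrightarrow> 1 / cayley x) (at_right 0)"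
        by (simp add: Complex_eq cayley_def)
    qed
  qed (use m5 half in auto)
  have "hardy_ext (\<lambda>x. f x / cayley x) G"
    unfolding hardy_ext_def
  proof (intro conjI holG)
    show "\<exists>M. \<forall>y>0. sq_int (\<lambda>x. G (Complex x y)) \<and> l2norm (\<lambda>x. G (Complex x y)) \<le> M"
      using sG nG by blast
    show "((\<lambda>y. l2norm (\<lambda>x. G (Complex x y) - f x / cayley x)) \<longlongrightarrow> 0) (at_right 0)"
    proof (rule Lim_transform_eventually[OF lim])
      have "eventually (\<lambda>y::real. 0 < y \<and> y < 1/2) (at_right 0)"
        by (intro eventually_at_rightI[of 0 "1/2"]) auto
      then show "eventually (\<lambda>y. l2norm (\<lambda>x. ?m y x * F (Complex x y) - 1 / cayley x * f x) =
          l2norm (\<lambda>x. G (Complex x y) - f x / cayley x)) (at_right 0)"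
      proof eventually_elim
        case (elim y)
        have "Complex x y \<noteq> \<i>" for x using half[of y x] elim by auto
        then show ?case using GF by simp
      qed
    qed
  qed
  moreover have "sq_int (\<lambda>x. f x / cayley x)" using l2_div_cayley(1)[OF sf, of 1] by simp
  ultimately show ?thesis by (auto simp: H2_iff)
qed

text \<open>Up to a constant factor the reproducing kernel of \<open>H2\<close> at
  \<open>\<i>\<close>. Subtracting a multiple of it gives any \<open>H2\<close> function a zero at
  \<open>\<i>\<close>.\<close>

lemma H2_inverse_add_ii:
  shows "(\<lambda>x. 1 / (of_real x + \<i>)) \<in> H2" "poisson (\<lambda>x. 1 / (of_real x + \<i>)) 1 0 = 1 / (2 * \<i>)"
proof -
  let ?e = "\<lambda>x. 1 / (complex_of_real x + \<i>)"
  have nrm: "(cmod (1 / (Complex x y + \<i>)))\<^sup>2 = 1 / ((x - 0)\<^sup>2 + (1 + y)\<^sup>2)" for x y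
    by (simp add: norm_divide power_divide cmod_power2 add.commute)
  have ii: "(\<lambda>x. 1 / (Complex x y + \<i>)) \<in> borel_measurable lborel" for y unfolding Complex_eq by measurable
  have sq: "sq_int (\<lambda>x. 1 / (Complex x y + \<i>))" and nn: "l2norm (\<lambda>x. 1 / (Complex x y + \<i>)) \<le> sqrt pi" if y: "y \<ge> 0" for y
  proof -
    have y1: "1 + y > 0" using y by simp
    show "sq_int (\<lambda>x. 1 / (Complex x y + \<i>))" unfolding sq_int_def nrm
      using ii integrable_poisson_kernel[OF y1, of 0] by simp
    have "(LBINT x. (cmod (1 / (Complex x y + \<i>)))\<^sup>2) = pi / (1 + y)"
      unfolding nrm by (rule integral_poisson_kernel[OF y1])
    also have "\<dots> \<le> pi" using y by (simp add: divide_le_eq)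
    finally show "l2norm (\<lambda>x. 1 / (Complex x y + \<i>)) \<le> sqrt pi"
      unfolding l2norm_def by (rule real_sqrt_le_mono)
  qed
  have e: "?e = (\<lambda>x. 1 / (Complex x 0 + \<i>))" by (simp add: Complex_eq)
  have se: "sq_int ?e" unfolding e by (rule sq) simp
  have ext: "hardy_ext ?e (\<lambda>z. 1 / (z + \<i>))"
    unfolding hardy_ext_def
  proof (intro conjI)
    have "z + \<i> \<noteq> 0" if "Im z > 0" for z using that by (auto simp: complex_eq_iff)
    then show "(\<lambda>z. 1 / (z + \<i>)) holomorphic_on {z. Im z > 0}" by (intro holomorphic_intros) auto
    show "\<exists>M. \<forall>y>0. sq_int (\<lambda>x. 1 / (Complex x y + \<i>)) \<and> l2norm (\<lambda>x. 1 / (Complex x y + \<i>)) \<le> M"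
      using sq nn by (intro exI[of _ "sqrt pi"]) auto
    show "((\<lambda>y. l2norm (\<lambda>x. 1 / (Complex x y + \<i>) - ?e x)) \<longlongrightarrow> 0) (at_right 0)"
    proof (rule Lim_null_comparison)
      show "((\<lambda>y. y * l2norm ?e) \<longlongrightarrow> 0) (at_right 0)"
        by (rule tendsto_mult_left_zero) (rule tendsto_ident_at)
      show "eventually (\<lambda>y. norm (l2norm (\<lambda>x. 1 / (Complex x y + \<i>) - ?e x)) \<le> y * l2norm ?e) (at_right 0)"
        using eventually_at_right_pos
      proof eventually_elim
        case (elim y)
        have b: "cmod (1 / (Complex x y + \<i>) - ?e x) \<le> y * cmod (?e x)" for x
        proof -
          have z1: "cmod (Complex x y + \<i>) \<ge> 1" using abs_Im_le_cmod[of "Complex x y + \<i>"] elim by simp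
          then have z0: "Complex x y + \<i> \<noteq> 0" by auto
          have "1 / (Complex x y + \<i>) - ?e x = - (\<i> * of_real y) / (Complex x y + \<i>) * ?e x"
            using z0 of_real_add_ii_neq_0(1)[of x] by (simp add: field_simps Complex_eq)
          then have "cmod (1 / (Complex x y + \<i>) - ?e x) = y / cmod (Complex x y + \<i>) * cmod (?e x)"
            using elim by (simp only: norm_mult norm_divide norm_minus_cancel norm_ii norm_of_real)
          also have "\<dots> \<le> y * cmod (?e x)"
            using z1 elim by (intro mult_right_mono) (auto simp: divide_le_eq mult_le_cancel_left1)
          finally show ?thesis .
        qed
        have "(\<lambda>x. 1 / (Complex x y + \<i>) - ?e x) \<in> borel_measurable lborel"
          using sq_intD(1)[OF sq_int_diff[OF sq se]] elim by simp
        from l2norm_bound_AE[OF se this _ less_imp_le[OF elim]] show ?case using b by simp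
      qed
    qed
  qed
  show "?e \<in> H2" using ext se by (auto simp: H2_iff)
  have "poisson ?e 1 0 = 1 / (Complex 0 1 + \<i>)" using hardy_ext_poisson[OF ext se zero_less_one, of 0] by simp
  then show "poisson ?e 1 0 = 1 / (2 * \<i>)" by (simp add: Complex_eq)
qed

text \<open>Dividing by \<open>cayley\<close> is the backward shift: \<open>f / cayley\<close> lies in \<open>H2\<close> up to a one-dimensional
  error proportional to the value of \<open>f\<close> at \<open>\<i>\<close>.\<close>

lemma div_cayley_power_compact:
  assumes "\<And>n. fn n \<in> H2" "\<And>n. l2norm (fn n) \<le> B"
  shows "\<exists>r. strict_mono (r :: nat \<Rightarrow> nat) \<and> (\<forall>e>0. \<exists>n0. \<forall>m\<ge>n0. \<forall>n\<ge>n0. \<exists>b\<in>H2.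
    l2norm (\<lambda>x. (fn (r m) x - fn (r n) x) / cayley x ^ N - b x) < e)"
  using assms
\<comment> \<open>The step replaces the sequence by its backward shifts, which satisfy a different
  bound, so \<open>fn\<close> and \<open>B\<close> must vary.\<close>
proof (induction N arbitrary: fn B)
  case 0
  show ?case
  proof (intro exI[of _ id] conjI allI impI)
    show "strict_mono (id :: nat \<Rightarrow> nat)" by (simp add: strict_mono_def)
    fix e :: real assume e: "e > 0"
    have "\<exists>b\<in>H2. l2norm (\<lambda>x. (fn (id m) x - fn (id n) x) / cayley x ^ 0 - b x) < e" for m n
      using e by (intro bexI[of _ "\<lambda>x. fn m x - fn n x"] H2_diff 0) simp
    then show "\<exists>n0. \<forall>m\<ge>n0. \<forall>n\<ge>n0. \<exists>b\<in>H2. l2norm (\<lambda>x. (fn (id m) x - fn (id n) x) / cayley x ^ 0 - b x) < e"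
      by blast
  qed
next
  case (Suc N)
  let ?e = "\<lambda>x. 1 / (complex_of_real x + \<i>)"
  have sf: "sq_int (fn n)" for n using H2_sq_int[OF Suc.prems(1)] .
  have se: "sq_int ?e" by (rule H2_sq_int[OF H2_inverse_add_ii(1)])
  define c where "c n = poisson (fn n) 1 0" for n
  \<comment> \<open>The values at \<open>\<i>\<close> are bounded scalars, so a subsequence of them
    converges. This is where compactness enters.\<close>
  have cb: "cmod (c n) \<le> B" for n
  proof -
    have "cmod (c n) \<le> l2norm (fn n) / sqrt (pi * 1)" unfolding c_def by (rule poisson_pointwise_le[OF sf]) simp
    also have "\<dots> \<le> l2norm (fn n)"
    proof -
      have "l2norm (fn n) * 1 \<le> l2norm (fn n) * sqrt pi"
        using pi_ge_two by (intro mult_left_mono) auto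
      then show ?thesis by (simp add: pos_divide_le_eq)
    qed
    finally show ?thesis using Suc.prems(2)[of n] by simp
  qed
  then have "bounded (range c)" by (auto simp: bounded_iff)
  then obtain l r where r: "strict_mono (r :: nat \<Rightarrow> nat)" "(c \<circ> r) \<longlonglongrightarrow> l"
    using bounded_imp_convergent_subsequence by blast
  \<comment> \<open>\<open>?e\<close> has the value 1/(2i) at \<open>\<i>\<close>, so this
    coefficient makes \<open>d n * ?e\<close> agree there with \<open>fn (r n)\<close>.\<close>
  define d where "d n = 2 * \<i> * c (r n)" for n
  define gn where "gn n x = (fn (r n) x - d n * ?e x) / cayley x" for n x
  have sd: "sq_int (\<lambda>x. fn (r n) x - d n * ?e x)" for n by (intro sq_int_diff sf sq_int_cmult se)
  have gH: "gn n \<in> H2" for n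
    unfolding gn_def
  proof (rule H2_div_cayley)
    show "(\<lambda>x. fn (r n) x - d n * ?e x) \<in> H2" by (intro H2_diff H2_cmult Suc.prems H2_inverse_add_ii)
    have "poisson (\<lambda>x. d n * ?e x) 1 0 = d n * poisson ?e 1 0"
      unfolding poisson_def mult.assoc by (subst integral_mult_right_zero) (simp add: mult_ac)
    moreover have "d n * (1 / (2 * \<i>)) = c (r n)" by (simp add: d_def complex_eq_iff)
    ultimately show "poisson (\<lambda>x. fn (r n) x - d n * ?e x) 1 0 = 0"
      unfolding poisson_diff[OF sf sq_int_cmult[OF se] zero_less_one] H2_inverse_add_ii(2) c_def by simp
  qed
  have gB: "l2norm (gn n) \<le> B + 2 * B * l2norm ?e" for n
  proof -
    have "l2norm (gn n) = l2norm (\<lambda>x. fn (r n) x - d n * ?e x)"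
      using l2_div_cayley(2)[OF sd, of n 1] by (simp add: gn_def[abs_def])
    also have "\<dots> \<le> l2norm (fn (r n)) + cmod (d n) * l2norm ?e"
      using l2norm_triangle_minus[OF sf[of "r n"] sq_int_cmult[OF se, of "d n"]] unfolding l2norm_cmult .
    also have "cmod (d n) \<le> 2 * B" using cb[of "r n"] by (simp add: d_def norm_mult)
    finally show ?thesis using Suc.prems(2)[of "r n"] by (simp add: mult_right_mono)
  qed
  obtain r' where r': "strict_mono (r' :: nat \<Rightarrow> nat)"
    "\<And>e. e > 0 \<Longrightarrow> \<exists>n0. \<forall>m\<ge>n0. \<forall>n\<ge>n0. \<exists>b\<in>H2. l2norm (\<lambda>x. (gn (r' m) x - gn (r' n) x) / cayley x ^ N - b x) < e"
    using Suc.IH[of gn, OF gH gB] by blast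
  have "(\<lambda>n. d (r' n)) \<longlonglongrightarrow> 2 * \<i> * l"
    using LIMSEQ_subseq_LIMSEQ[OF r(2) r'(1)] unfolding d_def by (intro tendsto_intros) (simp add: o_def)
  then have dC: "Cauchy (\<lambda>n. d (r' n))" by (rule LIMSEQ_imp_Cauchy)
  have "\<exists>n0. \<forall>m\<ge>n0. \<forall>n\<ge>n0. \<exists>b\<in>H2. l2norm (\<lambda>x. (fn ((r \<circ> r') m) x - fn ((r \<circ> r') n) x) / cayley x ^ Suc N - b x) < e"
    if e: "e > 0" for e
  proof -
    obtain n0 where n0: "\<And>m n. m \<ge> n0 \<Longrightarrow> n \<ge> n0 \<Longrightarrow> \<exists>b\<in>H2. l2norm (\<lambda>x. (gn (r' m) x - gn (r' n) x) / cayley x ^ N - b x) < e / 2"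
      using r'(2)[of "e / 2"] e by auto
    \<comment> \<open>The added 1 keeps the denominator positive without computing the norm of
      \<open>?e\<close>.\<close>
    have "2 * (c + 1) > 0" if "c \<ge> 0" for c :: real using that by simp
    then have ep: "2 * (l2norm ?e + 1) > 0" using l2norm_nonneg by blast
    then have "e / (2 * (l2norm ?e + 1)) > 0" using e by (intro divide_pos_pos)
    then obtain n1 where n1: "\<And>m n. m \<ge> n1 \<Longrightarrow> n \<ge> n1 \<Longrightarrow> cmod (d (r' m) - d (r' n)) < e / (2 * (l2norm ?e + 1))"
      using CauchyD[OF dC] by blast
    have "\<exists>b\<in>H2. l2norm (\<lambda>x. (fn ((r \<circ> r') m) x - fn ((r \<circ> r') n) x) / cayley x ^ Suc N - b x) < e"
      if mn: "m \<ge> max n0 n1" "n \<ge> max n0 n1" for m n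
    proof -
      obtain b where b: "b \<in> H2" "l2norm (\<lambda>x. (gn (r' m) x - gn (r' n) x) / cayley x ^ N - b x) < e / 2"
        using n0[of m n] mn by auto
      let ?D = "d (r' m) - d (r' n)"
      let ?F = "\<lambda>x. (fn ((r \<circ> r') m) x - fn ((r \<circ> r') n) x) / cayley x ^ Suc N - b x" and ?G = "\<lambda>x. (gn (r' m) x - gn (r' n) x) / cayley x ^ N - b x"
        and ?E = "\<lambda>x. (?D * ?e x) / cayley x ^ Suc N"
      \<comment> \<open>One of the Suc N divisions is absorbed into \<open>gn\<close>, leaving N for
        the induction hypothesis. The rest is a multiple of \<open>?e\<close> with a Cauchy
        coefficient, and division by unimodular powers does not change its norm.\<close>
      have eq: "(\<lambda>x. ?F x) =
         (\<lambda>x. ?G x + ?E x)"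
      proof
        fix x
        have "fn (r (r' k)) x = gn (r' k) x * cayley x + d (r' k) * ?e x" for k
          by (simp add: gn_def)
        then have "fn ((r \<circ> r') m) x - fn ((r \<circ> r') n) x = (gn (r' m) x - gn (r' n) x) * cayley x + ?D * ?e x"
          unfolding o_def by (simp only: algebra_simps)
        moreover have "(a * cayley x + q) / cayley x ^ Suc N - b x = (a / cayley x ^ N - b x) + q / cayley x ^ Suc N" for a q
          by (simp add: add_divide_distrib)
        ultimately show "?F x =
           ?G x + ?E x" by simp
      qed
      have s1: "sq_int (\<lambda>x. ?G x)"
        by (intro sq_int_diff l2_div_cayley(1) H2_sq_int gH b)
      have "l2norm (\<lambda>x. ?F x) \<le>
          l2norm (\<lambda>x. ?G x) + l2norm (\<lambda>x. ?E x)"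
        unfolding eq by (rule l2norm_triangle[OF s1 l2_div_cayley(1)[OF sq_int_cmult[OF se]]])
      also have "l2norm (\<lambda>x. ?E x) = cmod ?D * l2norm ?e"
        unfolding l2_div_cayley(2)[OF sq_int_cmult[OF se]] l2norm_cmult ..
      also have "cmod ?D * l2norm ?e \<le> e / (2 * (l2norm ?e + 1)) * (l2norm ?e + 1)"
        using n1[of m n] mn e by (intro mult_mono) auto
      also have "\<dots> = e / 2"
      proof -
        have "e / (2 * c) * c = e / 2" if "2 * c > 0" for c :: real using that by simp
        then show ?thesis using ep by blast
      qed
      finally show ?thesis using b by (intro bexI[of _ b]) auto
    qed
    then show ?thesis by blast
  qed
  moreover have "strict_mono (r \<circ> r')" using r(1) r'(1) by (rule strict_mono_o)
  ultimately show ?case by blast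
qed

text \<open>The distance to \<open>H2\<close> ignores the \<open>Hinf\<close> part of the symbol,
  which maps \<open>H2\<close> into itself. Replacing the continuous part by p / cayley^N costs the
  factor \<epsilon>; with \<open>p\<close> absorbed into the sequence,
  \<open>div_cayley_power_compact\<close> supplies the subsequence.\<close>

lemma HinfC_almost_compact:
  assumes \<phi>: "\<phi> \<in> HinfC" and f: "\<And>n. fn n \<in> H2" "\<And>n. l2norm (fn n) \<le> B" and e: "\<epsilon> > 0"
  obtains r where "strict_mono (r :: nat \<Rightarrow> nat)"
    "\<And>e. e > 0 \<Longrightarrow> \<exists>n0. \<forall>m\<ge>n0. \<forall>n\<ge>n0. \<exists>b\<in>H2.
       l2norm (\<lambda>x. \<phi> x * (fn (r m) x - fn (r n) x) - b x) \<le> \<epsilon> * l2norm (\<lambda>x. fn (r m) x - fn (r n) x) + e"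
proof -
  obtain h g where hg: "h \<in> Hinf" "g \<in> Cinf" "AE x in lborel. \<phi> x = h x + g x" and \<phi>L: "\<phi> \<in> Linf"
    using \<phi> unfolding HinfC_def by blast
  have \<phi>m [measurable]: "\<phi> \<in> borel_measurable lborel" using \<phi>L by (simp add: Linf_def)
  have gm [measurable]: "g \<in> borel_measurable borel"
    using hg(2) by (auto simp: Cinf_def intro!: borel_measurable_continuous_onI)
  obtain p N where pN: "\<And>x. cmod (g x - poly p (cayley x) / cayley x ^ N) < \<epsilon>"
    using Cinf_approx[OF hg(2) e] by blast
  \<comment> \<open>Only the bound is extracted, so the zero function serves as the member of
    \<open>H2\<close>.\<close>
  obtain C where C: "\<And>x. cmod (poly p (cayley x)) \<le> C" using H2_poly_cayley[OF H2_zero] by blast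
  have pm [measurable]: "poly p \<in> borel_measurable borel" by (intro borel_measurable_continuous_onI continuous_intros)
  have pf: "(\<lambda>x. poly p (cayley x) * fn n x) \<in> H2" for n using H2_poly_cayley[OF f(1)] by blast
  have sf: "sq_int (fn n)" for n using H2_sq_int[OF f(1)] .
  have C0: "C \<ge> 0" using order_trans[OF norm_ge_zero C] .
  have pB: "l2norm (\<lambda>x. poly p (cayley x) * fn n x) \<le> C * B" for n
  proof -
    have "l2norm (\<lambda>x. poly p (cayley x) * fn n x) \<le> C * l2norm (fn n)"
      by (rule l2norm_bound_AE[OF sf sq_intD(1)[OF H2_sq_int[OF pf]] _ C0])
        (use C in \<open>auto simp: norm_mult mult_right_mono\<close>)
    also have "\<dots> \<le> C * B" by (intro mult_left_mono f C0)
    finally show ?thesis .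
  qed
  obtain r where r: "strict_mono (r :: nat \<Rightarrow> nat)"
    "\<And>e. e > 0 \<Longrightarrow> \<exists>n0. \<forall>m\<ge>n0. \<forall>n\<ge>n0. \<exists>b\<in>H2.
      l2norm (\<lambda>x. (poly p (cayley x) * fn (r m) x - poly p (cayley x) * fn (r n) x) / cayley x ^ N - b x) < e"
    using div_cayley_power_compact[of "\<lambda>n x. poly p (cayley x) * fn n x", OF pf pB, of N] by blast
  show ?thesis
  proof (rule that[OF r(1)])
    fix e :: real assume "e > 0"
    then obtain n0 where n0: "\<And>m n. m \<ge> n0 \<Longrightarrow> n \<ge> n0 \<Longrightarrow> \<exists>b\<in>H2.
      l2norm (\<lambda>x. (poly p (cayley x) * fn (r m) x - poly p (cayley x) * fn (r n) x) / cayley x ^ N - b x) < e"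
      using r(2) by blast
    have "\<exists>b\<in>H2. l2norm (\<lambda>x. \<phi> x * (fn (r m) x - fn (r n) x) - b x) \<le> \<epsilon> * l2norm (\<lambda>x. fn (r m) x - fn (r n) x) + e"
      if mn: "m \<ge> n0" "n \<ge> n0" for m n
    proof -
      let ?w = "\<lambda>x. fn (r m) x - fn (r n) x"
      obtain b where b: "b \<in> H2"
        "l2norm (\<lambda>x. (poly p (cayley x) * fn (r m) x - poly p (cayley x) * fn (r n) x) / cayley x ^ N - b x) < e"
        using n0[OF mn] by blast
      have w: "?w \<in> H2" by (intro H2_diff f)
      have sw: "sq_int ?w" by (rule H2_sq_int[OF w])
      have sb: "sq_int b" by (rule H2_sq_int[OF b(1)])
      note [measurable] = sq_intD(1)[OF sw] sq_intD(1)[OF sb]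
      let ?q = "\<lambda>x. (poly p (cayley x) * fn (r m) x - poly p (cayley x) * fn (r n) x) / cayley x ^ N - b x"
      have sq: "sq_int ?q" by (intro sq_int_diff l2_div_cayley(1) H2_sq_int pf b)
      let ?d = "\<lambda>x. (g x - poly p (cayley x) / cayley x ^ N) * ?w x"
      have db: "AE x in lborel. cmod (?d x) \<le> \<epsilon> * cmod (?w x)"
        using pN by (auto simp: norm_mult less_imp_le mult_right_mono)
      have dm: "?d \<in> borel_measurable lborel" by measurable
      have sd: "sq_int ?d" by (rule sq_int_bound[OF sw dm db])
      have hw: "(\<lambda>x. h x * ?w x) \<in> H2" by (rule H2_mult_Hinf[OF hg(1) w])
      have bH: "(\<lambda>x. h x * ?w x + b x) \<in> H2" by (rule H2_add[OF hw b(1)])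
      note [measurable] = sq_intD(1)[OF H2_sq_int[OF bH]]
      have "l2norm (\<lambda>x. \<phi> x * ?w x - (h x * ?w x + b x)) = l2norm (\<lambda>x. ?d x + ?q x)"
      proof (rule l2norm_cong_AE)
        show "(\<lambda>x. \<phi> x * ?w x - (h x * ?w x + b x)) \<in> borel_measurable lborel" by measurable
        show "(\<lambda>x. ?d x + ?q x) \<in> borel_measurable lborel" by (rule sq_intD(1)[OF sq_int_add[OF sd sq]])
        show "AE x in lborel. \<phi> x * ?w x - (h x * ?w x + b x) = ?d x + ?q x"
          using hg(3)
        proof eventually_elim
          case (elim x)
          have "(g x - P / Q) * (u - v) + ((P * u - P * v) / Q - b x) = g x * (u - v) - b x" for P Q u v
            by (simp add: algebra_simps diff_divide_distrib)
          then show ?case unfolding elim by (simp add: algebra_simps)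
        qed
      qed
      also have "\<dots> \<le> l2norm ?d + l2norm ?q" by (rule l2norm_triangle[OF sd sq])
      also have "\<dots> \<le> \<epsilon> * l2norm ?w + e"
        using l2norm_bound_AE[OF sw dm db] e b(2) by simp
      finally show ?thesis using bH by (intro bexI[of _ "\<lambda>x. h x * ?w x + b x"]) auto
    qed
    then show "\<exists>n0. \<forall>m\<ge>n0. \<forall>n\<ge>n0. \<exists>b\<in>H2.
       l2norm (\<lambda>x. \<phi> x * (fn (r m) x - fn (r n) x) - b x) \<le> \<epsilon> * l2norm (\<lambda>x. fn (r m) x - fn (r n) x) + e"
      by blast
  qed
qed

section \<open>The projection and the norm of the Hankel operator\<close>

text \<open>\<open>Pminus\<close> is a choice and says nothing until a projection is known to exist;
  existence comes from \<open>H2minus\<close> being a closed subspace.\<close>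

lemma is_Pminus_Pminus:
  assumes "sq_int g"
  shows "is_Pminus g (Pminus g)"
proof -
  obtain h where "h \<in> H2minus" "\<And>k. k \<in> H2minus \<Longrightarrow> l2inner (\<lambda>x. g x - h x) k = 0"
  proof (rule l2_projection[of H2minus g])
    show "\<And>vn v. (\<And>n. vn n \<in> H2minus) \<Longrightarrow> sq_int v \<Longrightarrow> (\<lambda>n. l2norm (\<lambda>x. vn n x - v x)) \<longlonglongrightarrow> 0 \<Longrightarrow> v \<in> H2minus"
      by (rule H2minus_closed)
  qed (use H2minus_sq_int H2minus_zero H2minus_add H2minus_cmult assms in auto)
  then have "is_Pminus g h" by (simp add: is_Pminus_def)
  then show ?thesis unfolding Pminus_def by (rule someI[of "is_Pminus g"])
qed

lemma is_Pminus_pythagoras: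
  assumes g: "sq_int g" and h: "is_Pminus g h"
  shows "(l2norm g)\<^sup>2 = (l2norm (\<lambda>x. g x - h x))\<^sup>2 + (l2norm h)\<^sup>2"
proof -
  have hH: "h \<in> H2minus" and o: "l2inner (\<lambda>x. g x - h x) h = 0" using h by (auto simp: is_Pminus_def)
  have sh: "sq_int h" by (rule H2minus_sq_int[OF hH])
  show ?thesis using l2norm_add_sq[OF sq_int_diff[OF g sh] sh] by (simp add: o)
qed

text \<open>Linearity is stated for the relation: projections are determined only up to null sets,
  so the function chosen for a difference need not be the difference of the chosen
  functions.\<close>

lemma is_Pminus_diff:
  assumes "sq_int g" "sq_int g'" "is_Pminus g h" "is_Pminus g' h'"
  shows "is_Pminus (\<lambda>x. g x - g' x) (\<lambda>x. h x - h' x)"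
  unfolding is_Pminus_def
proof
  have H: "h \<in> H2minus" "h' \<in> H2minus" using assms by (auto simp: is_Pminus_def)
  then show "(\<lambda>x. h x - h' x) \<in> H2minus" by (rule H2minus_diff)
  have s: "sq_int (\<lambda>x. g x - h x)" "sq_int (\<lambda>x. g' x - h' x)"
    using assms H H2minus_sq_int sq_int_diff by auto
  show "\<forall>k\<in>H2minus. l2inner (\<lambda>x. g x - g' x - (h x - h' x)) k = 0"
  proof
    fix k assume k: "k \<in> H2minus"
    have sk: "sq_int (\<lambda>x. cnj (k x))" by (rule sq_int_cnj[OF H2minus_sq_int[OF k]])
    have "l2inner (\<lambda>x. g x - g' x - (h x - h' x)) k =
        (LBINT x. (g x - h x) * cnj (k x) - (g' x - h' x) * cnj (k x))"
      unfolding l2inner_def by (intro Bochner_Integration.integral_cong) (auto simp: algebra_simps)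
    also have "\<dots> = l2inner (\<lambda>x. g x - h x) k - l2inner (\<lambda>x. g' x - h' x) k"
      unfolding l2inner_def by (intro Bochner_Integration.integral_diff integrable_mult s sk)
    finally show "l2inner (\<lambda>x. g x - g' x - (h x - h' x)) k = 0"
      using assms(3,4) k by (simp add: is_Pminus_def)
  qed
qed

text \<open>Both b and g - h are orthogonal to h, so the inner product of h with itself equals that
  of g - b with h, and Cauchy-Schwarz applies. This is the easy half of Nehari's theorem, and it
  turns estimates modulo \<open>H2\<close> into estimates for the projection.\<close>

lemma is_Pminus_le_dist_H2:
  assumes g: "sq_int g" and h: "is_Pminus g h" and b: "b \<in> H2"
  shows "l2norm h \<le> l2norm (\<lambda>x. g x - b x)"
proof (cases "l2norm h = 0")
  case False
  have hH: "h \<in> H2minus" and o: "l2inner (\<lambda>x. g x - h x) h = 0" using h by (auto simp: is_Pminus_def)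
  have sh: "sq_int h" by (rule H2minus_sq_int[OF hH])
  have sc: "sq_int (\<lambda>x. cnj (h x))" by (rule sq_int_cnj[OF sh])
  have sb: "sq_int b" by (rule H2_sq_int[OF b])
  have "l2inner h h = (LBINT x. (g x - b x) * cnj (h x) + b x * cnj (h x) - (g x - h x) * cnj (h x))"
    unfolding l2inner_def by (intro Bochner_Integration.integral_cong) (auto simp: algebra_simps)
  also have "\<dots> = (LBINT x. (g x - b x) * cnj (h x) + b x * cnj (h x)) - l2inner (\<lambda>x. g x - h x) h"
    unfolding l2inner_def
    by (intro Bochner_Integration.integral_diff Bochner_Integration.integrable_add integrable_mult sq_int_diff g sb sh sc)
  also have "(LBINT x. (g x - b x) * cnj (h x) + b x * cnj (h x)) = (LBINT x. (g x - b x) * cnj (h x)) + l2inner b h"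
    unfolding l2inner_def
    by (intro Bochner_Integration.integral_add integrable_mult sq_int_diff g sb sc)
  finally have "l2inner h h = (LBINT x. (g x - b x) * cnj (h x))"
    using o H2_orthogonal_H2minus[OF b hH] by simp
  then have "cmod (l2inner h h) \<le> l2norm (\<lambda>x. g x - b x) * l2norm h"
    using cauchy_schwarz[OF sq_int_diff[OF g sb] sc] by simp
  moreover have "cmod (l2inner h h) = l2norm h * l2norm h"
    unfolding l2inner_self norm_of_real by (simp add: power2_eq_square)
  ultimately have "l2norm h * l2norm h \<le> l2norm (\<lambda>x. g x - b x) * l2norm h" by simp
  moreover have "l2norm h > 0" using False l2norm_nonneg[of h] by linarith
  ultimately show ?thesis by simp
qed simp

lemma l2norm_Jrefl: "l2norm (Jrefl h) = l2norm h"
  using lborel_integral_real_affine[of "-1" "\<lambda>x. (cmod (h x))\<^sup>2" 0]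
  by (simp add: l2norm_def Jrefl_def)

text \<open>The theorem in sequential form. The explicit deficit 1/(n + 1) provides one rate
  \<open>s\<close> for all the errors below.\<close>

lemma no_norm_attaining_sequence:
  assumes \<phi>: "\<phi> \<in> HinfC" and le1: "AE x in lborel. cmod (\<phi> x) \<le> 1"
    and pos: "emeasure lborel {x. cmod (\<phi> x) < 1} > 0"
    and f: "\<And>n. fn n \<in> H2" "\<And>n. l2norm (fn n) \<le> 1"
    and lower: "\<And>n. l2norm (Pminus (\<lambda>x. \<phi> x * fn n x)) > 1 - 1 / real (Suc n)"
  shows False
proof -
  have \<phi>m [measurable]: "\<phi> \<in> borel_measurable lborel" using \<phi> by (simp add: HinfC_def Linf_def)
  have sf: "sq_int (fn n)" for n by (rule H2_sq_int[OF f(1)])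
  note mult = l2_contractive_mult[OF _ \<phi>m le1]
  \<comment> \<open>Nonzero exactly where |\<phi>| differs from 1, so \<rho> g = 0 will make g
    vanish on a set of positive measure.\<close>
  define \<rho> where "\<rho> x = complex_of_real (1 - (cmod (\<phi> x))\<^sup>2)" for x
  have \<rho>m [measurable]: "\<rho> \<in> borel_measurable lborel" unfolding \<rho>_def by measurable
  have \<rho>1: "AE x in lborel. cmod (\<rho> x) \<le> 1"
    using le1
  proof eventually_elim
    case (elim x)
    then have "(cmod (\<phi> x))\<^sup>2 \<le> 1" by (simp add: power_le_one)
    then show ?case unfolding \<rho>_def norm_of_real by simp
  qed
  note multr = l2_contractive_mult[OF _ \<rho>m \<rho>1]
  define P where "P n = Pminus (\<lambda>x. \<phi> x * fn n x)" for n
  have P: "is_Pminus (\<lambda>x. \<phi> x * fn n x) (P n)" for n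
    unfolding P_def by (rule is_Pminus_Pminus[OF mult(1)[OF sf]])
  have sP: "sq_int (P n)" for n using P[of n] by (simp add: is_Pminus_def H2minus_sq_int)
  \<comment> \<open>Squaring the lower bound gives 1 - 2/(n + 1), so every defect in the Pythagorean
    identity is at most 2/(n + 1).\<close>
  define s where "s n = sqrt (2 / real (Suc n))" for n
  have e: "(1 - 1 / real (Suc n))\<^sup>2 \<ge> 1 - 2 / real (Suc n)" for n
    by (simp add: power2_diff)
  have Pl: "(l2norm (P n))\<^sup>2 \<ge> 1 - 2 / real (Suc n)" for n
  proof -
    have "(1 - 1 / real (Suc n))\<^sup>2 \<le> (l2norm (P n))\<^sup>2"
      using lower[of n] by (intro power_mono) (auto simp: P_def)
    then show ?thesis using e[of n] by linarith
  qed
  have pyth: "(l2norm (\<lambda>x. \<phi> x * fn n x))\<^sup>2 = (l2norm (\<lambda>x. \<phi> x * fn n x - P n x))\<^sup>2 + (l2norm (P n))\<^sup>2" for n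
    by (rule is_Pminus_pythagoras[OF mult(1)[OF sf] P])
  have f1: "(l2norm (fn n))\<^sup>2 \<le> 1" for n using f(2)[of n] by (simp add: power_le_one)
  have rem: "l2norm (\<lambda>x. \<phi> x * fn n x - P n x) \<le> s n" for n
  proof -
    have "(l2norm (\<lambda>x. \<phi> x * fn n x))\<^sup>2 \<le> (l2norm (fn n))\<^sup>2" by (intro power_mono mult(2) sf) simp
    then have "(l2norm (\<lambda>x. \<phi> x * fn n x - P n x))\<^sup>2 \<le> 2 / real (Suc n)"
      using pyth[of n] Pl[of n] f1[of n] by linarith
    then show ?thesis unfolding s_def by (rule real_le_rsqrt)
  qed
  have small: "l2norm (\<lambda>x. \<rho> x * fn n x) \<le> s n" for n
  proof -
    note i = sq_intD(2)[OF multr(1)[OF sf]] sq_intD(2)[OF sf] sq_intD(2)[OF mult(1)[OF sf]]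
    have "(l2norm (\<lambda>x. \<rho> x * fn n x))\<^sup>2 \<le> (LBINT x. (cmod (fn n x))\<^sup>2 - (cmod (\<phi> x * fn n x))\<^sup>2)"
      unfolding l2norm_sq
    proof (rule integral_mono_AE)
      show "integrable lborel (\<lambda>x. (cmod (\<rho> x * fn n x))\<^sup>2)" by (rule i)
      show "integrable lborel (\<lambda>x. (cmod (fn n x))\<^sup>2 - (cmod (\<phi> x * fn n x))\<^sup>2)"
        by (intro Bochner_Integration.integrable_diff i)
      show "AE x in lborel. (cmod (\<rho> x * fn n x))\<^sup>2 \<le> (cmod (fn n x))\<^sup>2 - (cmod (\<phi> x * fn n x))\<^sup>2"
        using le1
      proof eventually_elim
        case (elim x)
        define t where "t = 1 - (cmod (\<phi> x))\<^sup>2"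
        have t: "0 \<le> t" "t \<le> 1" using elim by (auto simp: t_def power_le_one)
        have "(cmod (\<rho> x * fn n x))\<^sup>2 = t * t * (cmod (fn n x))\<^sup>2"
          unfolding \<rho>_def t_def[symmetric] norm_mult norm_of_real power_mult_distrib by (simp add: power2_eq_square)
        \<comment> \<open>As t lies in [0, 1], t^2 \<le> t; this bounds the weighted square by the
          pointwise loss in passing from f_n to \<phi> f_n.\<close>
        also have "\<dots> \<le> t * (cmod (fn n x))\<^sup>2"
          using t by (intro mult_right_mono mult_left_le) auto
        also have "\<dots> = (cmod (fn n x))\<^sup>2 - (cmod (\<phi> x * fn n x))\<^sup>2"
          by (simp add: t_def norm_mult power_mult_distrib algebra_simps)
        finally show ?case .
      qed
    qed
    also have "\<dots> = (l2norm (fn n))\<^sup>2 - (l2norm (\<lambda>x. \<phi> x * fn n x))\<^sup>2"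
      unfolding l2norm_sq by (intro Bochner_Integration.integral_diff i)
    also have "\<dots> \<le> 2 / real (Suc n)"
      using pyth[of n] Pl[of n] f1[of n] zero_le_power2[of "l2norm (\<lambda>x. \<phi> x * fn n x - P n x)"] by linarith
    finally show ?thesis unfolding s_def by (rule real_le_rsqrt)
  qed
  have slim: "s \<longlonglongrightarrow> 0"
  proof -
    have "(\<lambda>n. sqrt (2 * (1 / real (Suc n)))) \<longlonglongrightarrow> sqrt (2 * 0)"
      by (intro tendsto_real_sqrt tendsto_mult tendsto_const LIMSEQ_Suc[OF lim_1_over_n])
    then show ?thesis by (simp add: s_def[abs_def])
  qed
  have quarter: "(1/4 :: real) > 0" by simp
  obtain r where r: "strict_mono (r :: nat \<Rightarrow> nat)"
    "\<And>e. e > 0 \<Longrightarrow> \<exists>n0. \<forall>m\<ge>n0. \<forall>n\<ge>n0. \<exists>b\<in>H2.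
       l2norm (\<lambda>x. \<phi> x * (fn (r m) x - fn (r n) x) - b x) \<le> 1/4 * l2norm (\<lambda>x. fn (r m) x - fn (r n) x) + e"
    by (rule HinfC_almost_compact[of \<phi> fn, OF \<phi> f quarter]) (rule that, assumption, blast)
  have sr: "(\<lambda>n. s (r n)) \<longlonglongrightarrow> 0" using LIMSEQ_subseq_LIMSEQ[OF slim r(1)] by (simp add: o_def)
  \<comment> \<open>The difference w splits as \<rho> w + |\<phi>|^2 w, and |\<phi>|^2 \<le>
    |\<phi>|. So its norm is at most that of \<rho> w plus that of \<phi> w, and \<phi> w is the
    difference of the projections up to a small remainder. Two errors of size
    \<open>s M + s N\<close> arise, and the quarter from the projections moves to the left.\<close>
  have key: "3/4 * l2norm (\<lambda>x. fn M x - fn N x) \<le> 2 * s M + 2 * s N + e"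
    if b: "b \<in> H2" "l2norm (\<lambda>x. \<phi> x * (fn M x - fn N x) - b x) \<le> 1/4 * l2norm (\<lambda>x. fn M x - fn N x) + e" for b M N e
  proof -
    let ?w = "\<lambda>x. fn M x - fn N x"
    have sw: "sq_int ?w" by (intro sq_int_diff sf)
    have 1: "l2norm (\<lambda>x. \<rho> x * ?w x) \<le> s M + s N"
      using l2norm_triangle_minus[OF multr(1)[OF sf[of M]] multr(1)[OF sf[of N]]] small[of M] small[of N]
      by (simp add: right_diff_distrib)
    have 2: "l2norm (\<lambda>x. \<phi> x * ?w x - (P M x - P N x)) \<le> s M + s N"
    proof -
      have sM: "sq_int (\<lambda>x. \<phi> x * fn n x - P n x)" for n by (intro sq_int_diff mult sf sP)
      have "(\<lambda>x. \<phi> x * ?w x - (P M x - P N x)) = (\<lambda>x. (\<phi> x * fn M x - P M x) - (\<phi> x * fn N x - P N x))"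
        by (auto simp: algebra_simps)
      then show ?thesis using l2norm_triangle_minus[OF sM[of M] sM[of N]] rem[of M] rem[of N] by simp
    qed
    have "is_Pminus (\<lambda>x. \<phi> x * fn M x - \<phi> x * fn N x) (\<lambda>x. P M x - P N x)"
      by (intro is_Pminus_diff mult sf P)
    then have "is_Pminus (\<lambda>x. \<phi> x * ?w x) (\<lambda>x. P M x - P N x)" by (simp add: right_diff_distrib)
    from is_Pminus_le_dist_H2[OF mult(1)[OF sw] this b(1)]
    have 3: "l2norm (\<lambda>x. P M x - P N x) \<le> 1/4 * l2norm ?w + e" using b(2) by linarith
    have 4: "l2norm (\<lambda>x. \<phi> x * ?w x) \<le> l2norm (\<lambda>x. P M x - P N x) + l2norm (\<lambda>x. \<phi> x * ?w x - (P M x - P N x))"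
      by (rule l2norm_triangle_le[OF mult(1)[OF sw] sq_int_diff[OF sP sP]])
    have 5: "l2norm (\<lambda>x. ?w x - \<rho> x * ?w x) \<le> l2norm (\<lambda>x. \<phi> x * ?w x)"
    proof (rule l2norm_mono_AE[OF mult(1)[OF sw] sq_int_diff[OF sw multr(1)[OF sw]]])
      show "AE x in lborel. cmod (?w x - \<rho> x * ?w x) \<le> cmod (\<phi> x * ?w x)"
        using le1
      proof eventually_elim
        case (elim x)
        have "?w x - \<rho> x * ?w x = of_real ((cmod (\<phi> x))\<^sup>2) * ?w x" by (simp add: \<rho>_def algebra_simps)
        then have "cmod (?w x - \<rho> x * ?w x) = cmod (\<phi> x) * (cmod (\<phi> x) * cmod (?w x))"
          by (simp only: norm_mult norm_of_real) (simp add: power2_eq_square)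
        also have "\<dots> \<le> 1 * (cmod (\<phi> x) * cmod (?w x))" using elim by (intro mult_right_mono) auto
        finally show ?case by (simp add: norm_mult)
      qed
    qed
    have "l2norm ?w \<le> l2norm (\<lambda>x. \<rho> x * ?w x) + l2norm (\<lambda>x. ?w x - \<rho> x * ?w x)"
      by (rule l2norm_triangle_le[OF sw multr(1)[OF sw]])
    then show ?thesis using 1 2 3 4 5 by linarith
  qed
  have "\<exists>N. \<forall>m\<ge>N. \<forall>n\<ge>N. l2norm (\<lambda>x. fn (r m) x - fn (r n) x) < e" if e: "e > 0" for e
  proof -
    \<comment> \<open>With every error below e/8, \<open>key\<close> bounds 3/4 of the norm by 5e/8,
      which is less than 3e/4.\<close>
    obtain n0 where n0: "\<And>m n. m \<ge> n0 \<Longrightarrow> n \<ge> n0 \<Longrightarrow> \<exists>b\<in>H2.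
       l2norm (\<lambda>x. \<phi> x * (fn (r m) x - fn (r n) x) - b x) \<le> 1/4 * l2norm (\<lambda>x. fn (r m) x - fn (r n) x) + e/8"
      using r(2)[of "e/8"] e by auto
    obtain n1 where n1: "\<And>n. n \<ge> n1 \<Longrightarrow> s (r n) < e/8"
      using order_tendstoD(2)[OF sr, of "e/8"] e by (auto simp: eventually_sequentially)
    have "l2norm (\<lambda>x. fn (r m) x - fn (r n) x) < e" if mn: "m \<ge> max n0 n1" "n \<ge> max n0 n1" for m n
    proof -
      obtain b where "b \<in> H2" "l2norm (\<lambda>x. \<phi> x * (fn (r m) x - fn (r n) x) - b x) \<le> 1/4 * l2norm (\<lambda>x. fn (r m) x - fn (r n) x) + e/8"
        using n0[of m n] mn by auto
      from key[OF this] show ?thesis using n1[of m] n1[of n] mn e by simp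
    qed
    then show ?thesis by blast
  qed
  then obtain g where g: "sq_int g" "(\<lambda>n. l2norm (\<lambda>x. fn (r n) x - g x)) \<longlonglongrightarrow> 0"
    using l2_complete[of "\<lambda>n. fn (r n)"] sf by blast
  have gH: "g \<in> H2" by (rule H2_closed[OF f(1) g])
  have "l2norm (\<lambda>x. \<rho> x * g x) \<le> 0"
  proof (rule tendsto_lowerbound)
    show "(\<lambda>n. s (r n) + l2norm (\<lambda>x. fn (r n) x - g x)) \<longlonglongrightarrow> 0"
      using tendsto_add[OF sr g(2)] by simp
    have "l2norm (\<lambda>x. \<rho> x * g x) \<le> s (r n) + l2norm (\<lambda>x. fn (r n) x - g x)" for n
    proof -
      have "l2norm (\<lambda>x. \<rho> x * g x - \<rho> x * fn (r n) x) \<le> l2norm (\<lambda>x. g x - fn (r n) x)"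
        using multr(2)[OF sq_int_diff[OF g(1) sf[of "r n"]]] by (simp add: right_diff_distrib)
      then show ?thesis
        using l2norm_triangle_le[OF multr(1)[OF g(1)] multr(1)[OF sf[of "r n"]]] small[of "r n"]
          l2norm_minus_commute[of g "fn (r n)"] by simp
    qed
    then show "\<forall>\<^sub>F n in sequentially. l2norm (\<lambda>x. \<rho> x * g x) \<le> s (r n) + l2norm (\<lambda>x. fn (r n) x - g x)"
      by (intro always_eventually) simp
  qed simp
  then have "l2norm (\<lambda>x. \<rho> x * g x) = 0" using l2norm_nonneg[of "\<lambda>x. \<rho> x * g x"] by linarith
  from l2norm_eq_0[OF multr(1)[OF g(1)] this]
  have "AE x in lborel. x \<in> {x. cmod (\<phi> x) < 1} \<longrightarrow> g x = 0"
  proof eventually_elim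
    case (elim x)
    show ?case
    proof
      assume "x \<in> {x. cmod (\<phi> x) < 1}"
      then have "(cmod (\<phi> x))\<^sup>2 < 1" by (simp add: power_less_one_iff)
      then have "\<rho> x \<noteq> 0" unfolding \<rho>_def of_real_eq_0_iff by simp
      then show "g x = 0" using elim by simp
    qed
  qed
  moreover have "{x. cmod (\<phi> x) < 1} \<in> sets lborel" by measurable
  ultimately have g0: "l2norm g = 0" using H2_uniqueness[OF gH _ pos] by blast
  \<comment> \<open>As g has norm 0, the subsequence would tend to 0 in norm, against norms bounded
    below by numbers tending to 1.\<close>
  have "1 - 1 / real (Suc (r n)) \<le> l2norm (\<lambda>x. fn (r n) x - g x)" for n
  proof -
    have "(l2norm (P (r n)))\<^sup>2 \<le> (l2norm (\<lambda>x. \<phi> x * fn (r n) x))\<^sup>2"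
      using pyth[of "r n"] zero_le_power2[of "l2norm (\<lambda>x. \<phi> x * fn (r n) x - P (r n) x)"] by linarith
    then have "l2norm (P (r n)) \<le> l2norm (\<lambda>x. \<phi> x * fn (r n) x)" by (rule power2_le_imp_le) simp
    also have "\<dots> \<le> l2norm (fn (r n))" by (rule mult(2)[OF sf])
    also have "\<dots> \<le> l2norm g + l2norm (\<lambda>x. fn (r n) x - g x)" by (rule l2norm_triangle_le[OF sf g(1)])
    finally show ?thesis using lower[of "r n"] g0 by (simp add: P_def)
  qed
  moreover have "(\<lambda>n. 1 - 1 / real (Suc (r n))) \<longlonglongrightarrow> 1 - 0"
    using LIMSEQ_subseq_LIMSEQ[OF LIMSEQ_Suc[OF lim_1_over_n] r(1)]
    by (intro tendsto_diff tendsto_const) (simp add: o_def)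
  ultimately have "(1::real) - 0 \<le> 0"
    using g(2) by (intro LIMSEQ_le) auto
  then show False by simp
qed

theorem theorem5p8:
  fixes \<phi> :: "real \<Rightarrow> complex"
  assumes "\<phi> \<in> HinfC"
    and "AE x in lborel. cmod (\<phi> x) \<le> 1"
    and "AE x in lborel. \<phi> (- x) = cnj (\<phi> x)"
    and "emeasure lborel {x. cmod (\<phi> x) < 1} > 0"
  shows "hankel_norm \<phi> < 1"
proof (rule ccontr)
  let ?S = "{l2norm (hankel \<phi> f) | f. f \<in> H2 \<and> l2norm f \<le> 1}"
  assume "\<not> hankel_norm \<phi> < 1"
  then have S: "1 \<le> Sup ?S" by (simp add: hankel_norm_def)
  \<comment> \<open>The zero function is a witness; with nonemptiness, numbers below the supremum
    are exceeded by members of \<open>?S\<close>.\<close>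
  have ne: "?S \<noteq> {}" using H2_zero by force
  have "\<exists>f. f \<in> H2 \<and> l2norm f \<le> 1 \<and> l2norm (Pminus (\<lambda>x. \<phi> x * f x)) > 1 - 1 / real (Suc n)" for n
  proof -
    have "1 - 1 / real (Suc n) < 1" by simp
    then have "1 - 1 / real (Suc n) < Sup ?S" using S by linarith
    from less_cSupD[OF ne this] show ?thesis by (auto simp: hankel_def l2norm_Jrefl)
  qed
  then obtain fn where "\<And>n. fn n \<in> H2" "\<And>n. l2norm (fn n) \<le> 1"
    "\<And>n. l2norm (Pminus (\<lambda>x. \<phi> x * fn n x)) > 1 - 1 / real (Suc n)" by metis
  then show False by (rule no_norm_attaining_sequence[OF assms(1,2,4)])
qed

end
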